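(* Let $g:X\to X$ satisfy the standing assumptions of the context, and let $(\mathcal H,d_{\mathcal H},\iota_{\mathcal H})$ be of Type 1 or Type 2 (as defined in the context). If the range $G(g)$ of the Schwartzman asymptotic cycle for $g$ is dense in $\mathbb R$, then $$\mathcal{ML}(\mathcal H,\iota_{\mathcal H}):=\{H\in C^0(X,\mathcal H)\mid \Phi(H)\text{ is mode-locked}\}$$ is open and dense in $C^0(X,\mathcal H)$ (with respect to the distance $D_{\mathcal H}$).
   Context: **Standing assumptions.** $\mathbb T=\mathbb R/\mathbb Z$. $X$ is a compact metric space and $g:X\to X$ is a strictly ergodic (uniquely ergodic and minimal) homeomorphism with a non-periodic factor of finite dimension: there are $d\ge 1$, an infinite compact set $Y\subset\mathbb R^d$, a homeomorphism $\bar g:Y\to Y$ and a continuous onto map $h:X\to Y$ with $h\circ g=\bar g\circ h$. $\nu$ is the unique $g$-invariant probability measure. **$g$-forced maps.** $f:X\times\mathbb T\to X\times\mathbb T$ is a $g$-forced circle homeomorphism if there is a homeomorphism $F:X\times\mathbb R\to X\times\mathbb R$, $F(x,w)=(g(x),F_x(w))$, with every $F_x$ an orientation preserving homeomorphism of $\mathbb R$, such that $(\mathrm{Id}\times\pi)\circ F=f\circ(\mathrm{Id}\times\pi)$, where $\pi:\mathbb R\to\mathbb T$ is the projection; $F$ is called a lift of $f$. With $\pi_2:X\times\mathbb R\to\mathbb R$ the projection, the limit $\rho(F)=\lim_{n\to+\infty}\pi_2F^n(x,w)/n$ exists and is independent of $(x,w)$; $\rho(f)=\rho(F)\bmod 1$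 is independent of the lift. $f$ is mode-locked if $\rho(f')=\rho(f)$ for every $g$-forced circle homeomorphism $f'$ sufficiently close to $f$ in the $C^0$ topology. **The spaces $\mathcal H$.** $\mathrm{Diff}^1(\mathbb T)$ denotes orientation preserving $C^1$ diffeomorphisms of $\mathbb T$. - Type 1: for some $r\in\mathbb Z_{\ge1}\cup\{\infty\}$, $\mathcal H=\{f\in\mathrm{Diff}^r(\mathbb R)\text{ orientation preserving}\mid f(y+1)=f(y)+1\ \forall y\}$, $\iota_{\mathcal H}(h)(y\bmod 1)=h(y)\bmod 1$, and $d_{\mathcal H}=d_r$, where for finite $k\ge 1$, $d_k(f,h)=d_{C^k}(f,h)+d_{C^k}(f^{-1},h^{-1})$, $d_{C^k}(f,h)=\sum_{j=0}^k\sup|D^jf-D^jh|$, and $d_\infty=\sum_{k\ge1}2^{-k}\frac{d_k}{d_k+1}$. - Type 2: $\mathcal H=\mathbb R$ with the Euclidean distance $d_{\mathcal H}$, and for some non-constant real analytic $P:\mathbb T\to\mathbb R$ with $\|P'\|<1$ (sup norm), $\iota_{\mathcal H}(h)(w)=w+P(w)+h\bmod 1$. $C^0(X,\mathcal H)$ is the set of continuous maps $X\to\mathcal H$ with distance $D_{\mathcal H}(H,H')=\sup_{x}d_{\mathcal H}(H(x),H'(x))$. For $H\in C^0(X,\mathcal H)$, $\Phi(H)(x,w)=(g(x),\iota_{\mathcal H}(H(x))(w))$, a $g$-forced circle diffeomorphism. **Schwartzman range.** $G(g)\subset\mathbb R$ is the subgroup of all $t$ for which there exist continuous $\phi:X\to\mathbb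 R$ and $\psi:X\to\mathbb R/\mathbb Z$ with $t=\int\phi\,d\nu$ and $\psi(g(x))-\psi(x)=\phi(x)\bmod 1$ for all $x$. *)

theory Defs
  imports "HOL-Analysis.Analysis" "HOL-Analysis.Urysohn" "HOL-Probability.Probability"
    "HOL-Library.Extended_Nat"
begin

section \<open>The circle \<open>\<real> / \<int>\<close>\<close>

quotient_type circle = real / "\<lambda>x y :: real. x - y \<in> \<int>"
  morphisms rep_circle to_circle
proof (rule equivpI)
  show "reflp (\<lambda>x y :: real. x - y \<in> \<int>)"
    by (rule reflpI) simp
  show "symp (\<lambda>x y :: real. x - y \<in> \<int>)"
    by (rule sympI) (metis Ints_minus minus_diff_eq)
  show "transp (\<lambda>x y :: real. x - y \<in> \<int>)"
    by (rule transpI) (metis Ints_add add_diff_eq diff_add_cancel)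
qed

instantiation circle :: ab_group_add
begin

lift_definition zero_circle :: circle is 0 .

lift_definition plus_circle :: "circle \<Rightarrow> circle \<Rightarrow> circle" is "(+)"
  by (metis Ints_add add_diff_add)

lift_definition uminus_circle :: "circle \<Rightarrow> circle" is uminus
  by (metis Ints_minus minus_diff_minus)

lift_definition minus_circle :: "circle \<Rightarrow> circle \<Rightarrow> circle" is "(-)"
proof -
  fix x x' y y' :: real
  assume "x - x' \<in> \<int>" "y - y' \<in> \<int>"
  then have "(x - x') - (y - y') \<in> \<int>" by (rule Ints_diff)
  then show "(x - y) - (x' - y') \<in> \<int>" by (simp add: algebra_simps)
qed

instance
  by standard (transfer; simp)+

end

instantiation circle :: metric_space
begin

text \<open>The distance of two classes is the distance from the difference of two representatives
  to the nearest integer.\<close>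

lift_definition dist_circle :: "circle \<Rightarrow> circle \<Rightarrow> real"
  is "\<lambda>x y :: real. \<bar>(x - y) - of_int (round (x - y))\<bar>"
proof -
  fix x y x' y' :: real
  assume "x - x' \<in> \<int>" "y - y' \<in> \<int>"
  then obtain m n :: int where "x - x' = of_int m" "y - y' = of_int n"
    by (auto elim!: Ints_cases)
  then have "x = x' + of_int m" "y = y' + of_int n" by simp_all
  then have "x - y = (x' - y') + of_int (m - n)"
    by simp
  moreover have "round ((x' - y') + of_int (m - n)) = round (x' - y') + (m - n)"
    by (simp only: round_def) linarith
  ultimately show "\<bar>(x - y) - of_int (round (x - y))\<bar> = \<bar>(x' - y') - of_int (round (x' - y'))\<bar>"
    by simp
qed

definition uniformity_circle :: "(circle \<times> circle) filter"
  where "uniformity_circle = (INF e\<in>{0<..}. principal {(x, y). dist x y < e})"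

definition open_circle :: "circle set \<Rightarrow> bool"
  where "open_circle U = (\<forall>x\<in>U. eventually (\<lambda>(x', y). x' = x \<longrightarrow> y \<in> U) uniformity)"

instance
proof
  show "(uniformity :: (circle \<times> circle) filter) = (INF e\<in>{0<..}. principal {(x, y). dist x y < e})"
    by (rule uniformity_circle_def)
  show "open U = (\<forall>x\<in>U. \<forall>\<^sub>F (x', y) in uniformity. x' = x \<longrightarrow> y \<in> U)" for U :: "circle set"
    by (rule open_circle_def)
  show "(dist x y = 0) = (x = y)" for x y :: circle
  proof transfer
    fix x y :: real
    show "(\<bar>x - y - of_int (round (x - y))\<bar> = 0) = (x - y \<in> \<int>)"
    proof
      assume "\<bar>x - y - of_int (round (x - y))\<bar> = 0"
      then have "x - y = of_int (round (x - y))" by simp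
      then show "x - y \<in> \<int>" by (metis Ints_of_int)
    qed (auto elim!: Ints_cases)
  qed
  show "dist x y \<le> dist x z + dist y z" for x y z :: circle
  proof transfer
    fix x y z :: real
    have "\<bar>x - y - of_int (round (x - y))\<bar> \<le> \<bar>x - y - of_int (round (x - z) - round (y - z))\<bar>"
      by (rule round_diff_minimal)
    also have "\<dots> \<le> \<bar>x - z - of_int (round (x - z))\<bar> + \<bar>y - z - of_int (round (y - z))\<bar>"
      by simp
    finally show "\<bar>x - y - of_int (round (x - y))\<bar>
        \<le> \<bar>x - z - of_int (round (x - z))\<bar> + \<bar>y - z - of_int (round (y - z))\<bar>" .
  qed
qed

end

lemma to_circle_eq_iff: "to_circle x = to_circle y \<longleftrightarrow> x - y \<in> \<int>"
  by (simp add: circle.abs_eq_iff)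

lemma to_circle_rep [simp]: "to_circle (rep_circle w) = w"
  by (metis Quotient_abs_rep Quotient_circle)

lemma dist_to_circle_le: "dist (to_circle x) (to_circle y) \<le> \<bar>x - y\<bar>"
  using round_diff_minimal[of "x - y" 0] by (simp add: dist_circle.abs_eq)

lemma dist_to_circle_attained: obtains x where "to_circle x = w" "dist (to_circle y) w = \<bar>y - x\<bar>"
proof
  define z where "z = rep_circle w"
  show "to_circle (z + of_int (round (y - z))) = w"
    by (metis Ints_of_int add_diff_cancel_left' to_circle_eq_iff to_circle_rep z_def)
  have "dist (to_circle y) (to_circle z) = \<bar>y - (z + of_int (round (y - z)))\<bar>"
    by (simp add: dist_circle.abs_eq algebra_simps)
  then show "dist (to_circle y) w = \<bar>y - (z + of_int (round (y - z)))\<bar>"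
    by (simp add: z_def)
qed

text \<open>The metric induces the quotient topology.\<close>

lemma open_circle_iff_quotient: "open (U :: circle set) \<longleftrightarrow> open (to_circle -` U)"
proof
  assume U: "open U"
  show "open (to_circle -` U)"
    unfolding open_dist
  proof (intro ballI)
    fix x assume "x \<in> to_circle -` U"
    with U obtain e where e: "e > 0" "\<And>v. dist v (to_circle x) < e \<Longrightarrow> v \<in> U"
      unfolding open_dist by (metis vimageE)
    have "y \<in> to_circle -` U" if "dist y x < e" for y
      using e(2)[of "to_circle y"] dist_to_circle_le[of y x] that by (simp add: dist_real_def)
    with e(1) show "\<exists>e>0. \<forall>y. dist y x < e \<longrightarrow> y \<in> to_circle -` U" by blast
  qed
next
  assume U: "open (to_circle -` U)"
  show "open U"
    unfolding open_dist
  proof (intro ballI)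
    fix w assume "w \<in> U"
    then have "rep_circle w \<in> to_circle -` U"
      by simp
    with U obtain e where e: "e > 0" "\<And>y. dist y (rep_circle w) < e \<Longrightarrow> to_circle y \<in> U"
      unfolding open_dist by (metis vimageE)
    have "v \<in> U" if "dist v w < e" for v
    proof -
      obtain y where y: "to_circle y = v" "dist (to_circle (rep_circle w)) v = \<bar>rep_circle w - y\<bar>"
        by (rule dist_to_circle_attained)
      with that have "dist y (rep_circle w) < e"
        by (simp add: dist_real_def dist_commute abs_minus_commute)
      with e(2) y(1) show ?thesis by blast
    qed
    with e(1) show "\<exists>e>0. \<forall>v. dist v w < e \<longrightarrow> v \<in> U" by blast
  qed
qed


section \<open>The base dynamics\<close>

definition invariant_prob :: "('a::topological_space \<Rightarrow> 'a) \<Rightarrow> 'a measure \<Rightarrow> bool"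
  where "invariant_prob g \<nu> \<longleftrightarrow> prob_space \<nu> \<and> sets \<nu> = sets borel \<and> distr \<nu> borel g = \<nu>"

definition minimal_map :: "('a::topological_space \<Rightarrow> 'a) \<Rightarrow> bool"
  where "minimal_map g \<longleftrightarrow> (\<forall>K. closed K \<and> K \<noteq> {} \<and> g ` K = K \<longrightarrow> K = UNIV)"

definition strictly_ergodic :: "('a::topological_space \<Rightarrow> 'a) \<Rightarrow> bool"
  where "strictly_ergodic g \<longleftrightarrow> (\<exists>!\<nu>. invariant_prob g \<nu>) \<and> minimal_map g"

definition schwartzman_range :: "('a::metric_space \<Rightarrow> 'a) \<Rightarrow> 'a measure \<Rightarrow> real set"
  where "schwartzman_range g \<nu> =
    {t. \<exists>(\<phi> :: 'a \<Rightarrow> real) (\<psi> :: 'a \<Rightarrow> circle).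
        continuous_on UNIV \<phi> \<and> continuous_on UNIV \<psi> \<and> t = (\<integral>x. \<phi> x \<partial>\<nu>) \<and>
        (\<forall>x. \<psi> (g x) - \<psi> x = to_circle (\<phi> x))}"


section \<open>Forced circle homeomorphisms and mode-locking\<close>

definition is_lift ::
    "('a::metric_space \<Rightarrow> 'a) \<Rightarrow> ('a \<times> real \<Rightarrow> 'a \<times> real) \<Rightarrow> ('a \<times> circle \<Rightarrow> 'a \<times> circle) \<Rightarrow> bool"
  where "is_lift g F f \<longleftrightarrow>
    homeomorphism UNIV UNIV F (inv F) \<and>
    (\<forall>x w. fst (F (x, w)) = g x) \<and>
    (\<forall>x. strict_mono (\<lambda>w. snd (F (x, w))) \<and>
         homeomorphism UNIV UNIV (\<lambda>w. snd (F (x, w))) (inv (\<lambda>w. snd (F (x, w))))) \<and>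
    map_prod id to_circle \<circ> F = f \<circ> map_prod id to_circle"

text \<open>Requiring \<open>f\<close> itself to be a homeomorphism forces every fibre map of a lift to commute with
  the unit translation; the existence of a lift alone would also admit fibre maps such as
  \<open>w \<mapsto> 2 * w\<close>.\<close>

definition forced_circle_homeo ::
    "('a::metric_space \<Rightarrow> 'a) \<Rightarrow> ('a \<times> circle \<Rightarrow> 'a \<times> circle) \<Rightarrow> bool"
  where "forced_circle_homeo g f \<longleftrightarrow>
    homeomorphism UNIV UNIV f (inv f) \<and> (\<exists>F. is_lift g F f)"

definition lift_rotation :: "('a \<times> real \<Rightarrow> 'a \<times> real) \<Rightarrow> real"
  where "lift_rotation F = (THE \<rho>. \<forall>z. (\<lambda>n. snd ((F ^^ n) z) / real n) \<longlonglongrightarrow> \<rho>)"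

definition rotation_number ::
    "('a::metric_space \<Rightarrow> 'a) \<Rightarrow> ('a \<times> circle \<Rightarrow> 'a \<times> circle) \<Rightarrow> circle"
  where "rotation_number g f = (THE \<theta>. \<exists>F. is_lift g F f \<and> \<theta> = to_circle (lift_rotation F))"

definition mode_locked ::
    "('a::metric_space \<Rightarrow> 'a) \<Rightarrow> ('a \<times> circle \<Rightarrow> 'a \<times> circle) \<Rightarrow> bool"
  where "mode_locked g f \<longleftrightarrow> forced_circle_homeo g f \<and>
    (\<exists>\<epsilon>>0. \<forall>f'. forced_circle_homeo g f' \<and> (\<forall>z. dist (f' z) (f z) < \<epsilon>) \<longrightarrow>
        rotation_number g f' = rotation_number g f)"


section \<open>Spaces of fibre maps\<close>

definition C_fun :: "nat \<Rightarrow> (real \<Rightarrow> real) \<Rightarrow> bool"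
  where "C_fun k f \<longleftrightarrow> (\<forall>j<k. (deriv ^^ j) f differentiable_on UNIV) \<and>
                        continuous_on UNIV ((deriv ^^ k) f)"

text \<open>For \<open>r = \<infinity>\<close> the condition \<open>enat k \<le> r\<close> holds for all \<open>k\<close>.\<close>

definition Diff_real :: "enat \<Rightarrow> (real \<Rightarrow> real) set"
  where "Diff_real r = {f. bij f \<and> (\<forall>k. enat k \<le> r \<longrightarrow> C_fun k f \<and> C_fun k (inv f))}"

definition lifted_Diff :: "enat \<Rightarrow> (real \<Rightarrow> real) set"
  where "lifted_Diff r = {f \<in> Diff_real r. strict_mono f \<and> (\<forall>y. f (y + 1) = f y + 1)}"

definition dist_C :: "nat \<Rightarrow> (real \<Rightarrow> real) \<Rightarrow> (real \<Rightarrow> real) \<Rightarrow> real"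
  where "dist_C k f h = (\<Sum>j\<le>k. SUP y. \<bar>(deriv ^^ j) f y - (deriv ^^ j) h y\<bar>)"

definition dist_Diff_fin :: "nat \<Rightarrow> (real \<Rightarrow> real) \<Rightarrow> (real \<Rightarrow> real) \<Rightarrow> real"
  where "dist_Diff_fin k f h = dist_C k f h + dist_C k (inv f) (inv h)"

definition dist_Diff :: "enat \<Rightarrow> (real \<Rightarrow> real) \<Rightarrow> (real \<Rightarrow> real) \<Rightarrow> real"
  where "dist_Diff r f h = (case r of
      enat k \<Rightarrow> dist_Diff_fin k f h
    | \<infinity> \<Rightarrow> (\<Sum>i. (1 / 2) ^ Suc i * (dist_Diff_fin (Suc i) f h / (dist_Diff_fin (Suc i) f h + 1))))"

text \<open>\<^const>\<open>Metric_space\<close> wants a total distance function that is symmetric and nonnegative also off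
  the carrier, hence the value \<open>0\<close> there.\<close>

definition type1_metric :: "enat \<Rightarrow> (real \<Rightarrow> real) metric"
  where "type1_metric r = metric (lifted_Diff r,
    \<lambda>f h. if f \<in> lifted_Diff r \<and> h \<in> lifted_Diff r then dist_Diff r f h else 0)"

text \<open>On \<open>lifted_Diff r\<close> this does not depend on the representative, see \<open>type1_action_to_circle\<close>.\<close>

definition type1_action :: "(real \<Rightarrow> real) \<Rightarrow> circle \<Rightarrow> circle"
  where "type1_action h w = to_circle (h (rep_circle w))"

definition real_analytic :: "(real \<Rightarrow> real) \<Rightarrow> bool"
  where "real_analytic f \<longleftrightarrow>
    (\<forall>x. \<exists>a. \<exists>r>0. \<forall>y. \<bar>y - x\<bar> < r \<longrightarrow> (\<lambda>n. a n * (y - x) ^ n) sums f y)"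

definition type2_potential :: "(circle \<Rightarrow> real) \<Rightarrow> bool"
  where "type2_potential P \<longleftrightarrow>
    real_analytic (\<lambda>y. P (to_circle y)) \<and>
    (\<nexists>c. \<forall>w. P w = c) \<and>
    (SUP y. \<bar>deriv (\<lambda>y. P (to_circle y)) y\<bar>) < 1"

definition type2_action :: "(circle \<Rightarrow> real) \<Rightarrow> real \<Rightarrow> circle \<Rightarrow> circle"
  where "type2_action P h w = w + to_circle (P w + h)"

definition skew_product :: "('a \<Rightarrow> 'a) \<Rightarrow> ('h \<Rightarrow> circle \<Rightarrow> circle) \<Rightarrow> ('a \<Rightarrow> 'h) \<Rightarrow>
    'a \<times> circle \<Rightarrow> 'a \<times> circle"
  where "skew_product g \<iota> H = (\<lambda>(x, w). (g x, \<iota> (H x) w))"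

text \<open>For compact \<open>'a\<close>, \<open>cfunspace euclidean m\<close> is the space of all continuous maps from \<open>'a\<close> to the
  metric space \<open>m\<close> with the sup distance, see \<open>mspace_cfunspace_compact\<close> and
  \<open>mdist_cfunspace_compact\<close>.\<close>

definition mode_locked_set :: "('a::metric_space \<Rightarrow> 'a) \<Rightarrow> 'h metric \<Rightarrow> ('h \<Rightarrow> circle \<Rightarrow> circle) \<Rightarrow> ('a \<Rightarrow> 'h) set"
  where "mode_locked_set g m \<iota> = {H \<in> mspace (cfunspace euclidean m). mode_locked g (skew_product g \<iota> H)}"

definition open_dense_in :: "'b metric \<Rightarrow> 'b set \<Rightarrow> bool"
  where "open_dense_in m S \<longleftrightarrow>
    openin (mtopology_of m) S \<and> mtopology_of m closure_of S = mspace m"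


section \<open>Well-definedness\<close>

lemma type1_action_to_circle:
  assumes "h \<in> lifted_Diff r"
  shows "type1_action h (to_circle y) = to_circle (h y)"
proof -
  have step: "h (y + 1) = h y + 1" for y
    using assms by (simp add: lifted_Diff_def)
  have nat: "h (y + real n) = h y + real n" for y n
  proof (induction n)
    case (Suc n)
    then show ?case using step[of "y + real n"] by (simp add: algebra_simps)
  qed simp
  have int: "h (y + of_int n) = h y + of_int n" for y n
  proof (cases "n \<ge> 0")
    case True
    then show ?thesis using nat[of y "nat n"] by simp
  next
    case False
    then show ?thesis using nat[of "y + of_int n" "nat (- n)"] by simp
  qed
  have "rep_circle (to_circle y) - y \<in> \<int>"
    by (metis to_circle_eq_iff to_circle_rep)
  then obtain n where "rep_circle (to_circle y) - y = of_int n"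
    by (rule Ints_cases)
  then have "rep_circle (to_circle y) = y + of_int n" by simp
  then show ?thesis
    by (simp add: type1_action_def to_circle_eq_iff int)
qed

lemma type2_action_to_circle:
  "type2_action P h (to_circle y) = to_circle (y + P (to_circle y) + h)"
  unfolding type2_action_def plus_circle.abs_eq by (simp only: add.assoc)

lemma higher_deriv_shift1:
  fixes f :: "real \<Rightarrow> real"
  assumes "\<And>y. f (y + 1) = f y + 1"
  shows "(deriv ^^ j) f (y + 1) = (deriv ^^ j) f y + (if j = 0 then 1 else 0)"
proof (induction j arbitrary: y)
  case 0
  then show ?case by (simp add: assms)
next
  case (Suc j)
  let ?f = "(deriv ^^ j) f" and ?c = "if j = 0 then 1 else 0 :: real"
  have "(?f has_field_derivative D) (at (y + 1)) \<longleftrightarrow> (?f has_field_derivative D) (at y)" for D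
  proof -
    have "(?f has_field_derivative D) (at (y + 1)) \<longleftrightarrow>
        ((\<lambda>y. ?f y + ?c) has_field_derivative D) (at y)"
      unfolding DERIV_shift Suc.IH ..
    also have "\<dots> \<longleftrightarrow> (?f has_field_derivative D) (at y)"
      by (simp add: DERIV_def)
    finally show ?thesis .
  qed
  then have "deriv ?f (y + 1) = deriv ?f y"
    by (simp only: deriv_def)
  then show ?case by simp
qed

lemma bounded_range_periodic:
  fixes u :: "real \<Rightarrow> real"
  assumes cont: "continuous_on UNIV u" and per: "\<And>y. u (y + 1) = u y"
  shows "bounded (range u)"
proof -
  have nat: "u (y + real n) = u y" for y n
  proof (induction n)
    case (Suc n)
    then show ?case using per[of "y + real n"] by (simp add: algebra_simps)
  qed simp
  have int: "u (y + of_int n) = u y" for y n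
  proof (cases "n \<ge> 0")
    case True
    then show ?thesis using nat[of y "nat n"] by simp
  next
    case False
    then show ?thesis using nat[of "y + of_int n" "nat (- n)"] by simp
  qed
  have "u y \<in> u ` {0..1}" for y
  proof
    show "u y = u (frac y)"
      using int[of "frac y" "\<lfloor>y\<rfloor>"] by (simp add: frac_def)
    show "frac y \<in> {0..1}"
      using frac_ge_0[of y] frac_lt_1[of y] by simp
  qed
  then have "range u \<subseteq> u ` {0..1}" by auto
  moreover have "compact (u ` {0..1})"
    using cont by (intro compact_continuous_image) (auto intro: continuous_on_subset)
  ultimately show ?thesis
    by (meson bounded_subset compact_imp_bounded)
qed

lemma C_fun_continuous:
  assumes "C_fun k f" "j \<le> k"
  shows "continuous_on UNIV ((deriv ^^ j) f)"
  using assms by (cases "j = k") (auto simp: C_fun_def intro: differentiable_imp_continuous_on)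

definition lift_like :: "nat \<Rightarrow> (real \<Rightarrow> real) set"
  where "lift_like k = {f. C_fun k f \<and> (\<forall>y. f (y + 1) = f y + 1)}"

lemma bdd_above_deriv_diff:
  assumes "f \<in> lift_like k" "h \<in> lift_like k" "j \<le> k"
  shows "bdd_above (range (\<lambda>y. \<bar>(deriv ^^ j) f y - (deriv ^^ j) h y\<bar>))"
proof -
  let ?u = "\<lambda>y. \<bar>(deriv ^^ j) f y - (deriv ^^ j) h y\<bar>"
  have "continuous_on UNIV ?u"
    using assms by (auto simp: lift_like_def intro!: continuous_intros C_fun_continuous[of k])
  moreover have "?u (y + 1) = ?u y" for y
    using assms by (simp add: lift_like_def higher_deriv_shift1)
  ultimately show ?thesis
    by (intro bounded_imp_bdd_above bounded_range_periodic)
qed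

lemma dist_C_nonneg:
  assumes "f \<in> lift_like k" "h \<in> lift_like k"
  shows "0 \<le> dist_C k f h"
  unfolding dist_C_def
proof (intro sum_nonneg)
  fix j assume "j \<in> {..k}"
  then have "bdd_above (range (\<lambda>y. \<bar>(deriv ^^ j) f y - (deriv ^^ j) h y\<bar>))"
    using assms by (intro bdd_above_deriv_diff) auto
  from cSUP_upper2[OF this, of 0 0] show "0 \<le> (SUP y. \<bar>(deriv ^^ j) f y - (deriv ^^ j) h y\<bar>)"
    by simp
qed

lemma dist_C_commute: "dist_C k f h = dist_C k h f"
  by (simp add: dist_C_def abs_minus_commute)

lemma dist_C_self [simp]: "dist_C k f f = 0"
  by (simp add: dist_C_def)

lemma dist_C_ge:
  assumes "f \<in> lift_like k" "h \<in> lift_like k"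
  shows "\<bar>f y - h y\<bar> \<le> dist_C k f h"
proof -
  have bdd: "bdd_above (range (\<lambda>y. \<bar>(deriv ^^ j) f y - (deriv ^^ j) h y\<bar>))" if "j \<le> k" for j
    using assms that by (rule bdd_above_deriv_diff)
  have "\<bar>f y - h y\<bar> \<le> (SUP y. \<bar>(deriv ^^ 0) f y - (deriv ^^ 0) h y\<bar>)"
    using cSUP_upper[OF _ bdd[of 0], of y] by simp
  also have "\<dots> \<le> dist_C k f h"
    unfolding dist_C_def
  proof (rule member_le_sum)
    fix j assume "j \<in> {..k} - {0}"
    then show "0 \<le> (SUP y. \<bar>(deriv ^^ j) f y - (deriv ^^ j) h y\<bar>)"
      using cSUP_upper2[OF bdd[of j], of 0 0] by simp
  qed auto
  finally show ?thesis .
qed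

lemma dist_C_triangle:
  assumes "f \<in> lift_like k" "h \<in> lift_like k" "l \<in> lift_like k"
  shows "dist_C k f l \<le> dist_C k f h + dist_C k h l"
  unfolding dist_C_def sum.distrib[symmetric]
proof (intro sum_mono cSUP_least)
  fix j y assume "j \<in> {..k}"
  then have j: "j \<le> k" by simp
  have "\<bar>(deriv ^^ j) f y - (deriv ^^ j) l y\<bar> \<le>
      \<bar>(deriv ^^ j) f y - (deriv ^^ j) h y\<bar> + \<bar>(deriv ^^ j) h y - (deriv ^^ j) l y\<bar>"
    by simp
  also have "\<dots> \<le> (SUP y. \<bar>(deriv ^^ j) f y - (deriv ^^ j) h y\<bar>) +
                  (SUP y. \<bar>(deriv ^^ j) h y - (deriv ^^ j) l y\<bar>)"
    using assms j by (intro add_mono cSUP_upper bdd_above_deriv_diff) auto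
  finally show "\<bar>(deriv ^^ j) f y - (deriv ^^ j) l y\<bar> \<le> \<dots>" .
qed auto

lemma lifted_DiffD:
  assumes "f \<in> lifted_Diff r" "enat k \<le> r"
  shows "f \<in> lift_like k" "inv f \<in> lift_like k"
proof -
  have f: "bij f" "C_fun k f" "C_fun k (inv f)" "\<And>y. f (y + 1) = f y + 1"
    using assms by (auto simp: lifted_Diff_def Diff_real_def)
  then show "f \<in> lift_like k" by (simp add: lift_like_def)
  have "inv f (y + 1) = inv f y + 1" for y
    using f by (metis bij_inv_eq_iff)
  with f show "inv f \<in> lift_like k" by (simp add: lift_like_def)
qed

lemma dist_Diff_fin:
  assumes "f \<in> lifted_Diff r" "h \<in> lifted_Diff r" "enat k \<le> r"
  shows "0 \<le> dist_Diff_fin k f h"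
    and "\<bar>f y - h y\<bar> \<le> dist_Diff_fin k f h"
    and "l \<in> lifted_Diff r \<Longrightarrow> dist_Diff_fin k f l \<le> dist_Diff_fin k f h + dist_Diff_fin k h l"
proof -
  note D = lifted_DiffD[OF _ assms(3)]
  note n = dist_C_nonneg[OF D(1)[OF assms(1)] D(1)[OF assms(2)]]
      dist_C_nonneg[OF D(2)[OF assms(1)] D(2)[OF assms(2)]]
  then show "0 \<le> dist_Diff_fin k f h" by (simp add: dist_Diff_fin_def)
  show "\<bar>f y - h y\<bar> \<le> dist_Diff_fin k f h"
    using dist_C_ge[OF D(1)[OF assms(1)] D(1)[OF assms(2)], of y] n
    by (simp add: dist_Diff_fin_def)
  show "dist_Diff_fin k f l \<le> dist_Diff_fin k f h + dist_Diff_fin k h l" if "l \<in> lifted_Diff r"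
    using dist_C_triangle[OF D(1)[OF assms(1)] D(1)[OF assms(2)] D(1)[OF that]]
      dist_C_triangle[OF D(2)[OF assms(1)] D(2)[OF assms(2)] D(2)[OF that]]
    by (simp add: dist_Diff_fin_def)
qed

lemma dist_Diff_fin_commute: "dist_Diff_fin k f h = dist_Diff_fin k h f"
  unfolding dist_Diff_fin_def
  by (subst dist_C_commute, subst (2) dist_C_commute) (rule refl)

lemma dist_Diff_fin_self [simp]: "dist_Diff_fin k f f = 0"
  by (simp add: dist_Diff_fin_def)

lemma bounded_quotient_triangle:
  fixes a b c :: real
  assumes "0 \<le> a" "0 \<le> b" "0 \<le> c" "a \<le> b + c"
  shows "a / (a + 1) \<le> b / (b + 1) + c / (c + 1)"
proof -
  have "a / (a + 1) \<le> (b + c) / (b + c + 1)"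
    using assms by (simp add: divide_simps) (simp add: algebra_simps)
  also have "\<dots> = b / (b + c + 1) + c / (b + c + 1)"
    by (simp add: add_divide_distrib)
  also have "\<dots> \<le> b / (b + 1) + c / (c + 1)"
    using assms by (intro add_mono divide_left_mono) auto
  finally show ?thesis .
qed

lemma Metric_space_type1:
  "Metric_space (lifted_Diff r)
     (\<lambda>f h. if f \<in> lifted_Diff r \<and> h \<in> lifted_Diff r then dist_Diff r f h else 0)"
proof (cases r)
  case (enat k)
  have k: "enat k \<le> r" by (simp add: enat)
  show ?thesis
  proof (rule Metric_space.intro, goal_cases)
    case (3 f h)
    have "f = h" if "dist_Diff_fin k f h = 0"
      using dist_Diff_fin(2)[OF 3 k] that by (intro ext) simp
    with 3 show ?case by (auto simp: dist_Diff_def enat)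
  next
    case (1 f h)
    then show ?case using dist_Diff_fin(1)[OF _ _ k] by (auto simp: dist_Diff_def enat)
  next
    case (2 f h)
    show ?case using dist_Diff_fin_commute[of k f h] by (auto simp: dist_Diff_def enat)
  next
    case (4 f h l)
    then show ?case using dist_Diff_fin(3)[OF 4(1,2) k 4(3)] by (simp add: dist_Diff_def enat)
  qed
next
  case infinity
  have k: "enat k \<le> r" for k by (simp add: infinity)
  define t where "t = (\<lambda>f h i. (1 / 2) ^ Suc i *
    (dist_Diff_fin (Suc i) f h / (dist_Diff_fin (Suc i) f h + 1)))"
  have d: "dist_Diff r f h = (\<Sum>i. t f h i)" for f h
    by (simp add: dist_Diff_def infinity t_def)
  have nonneg: "0 \<le> t f h i" if "f \<in> lifted_Diff r" "h \<in> lifted_Diff r" for f h i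
    using dist_Diff_fin(1)[OF that k] by (simp add: t_def)
  have summ: "summable (t f h)" if "f \<in> lifted_Diff r" "h \<in> lifted_Diff r" for f h
  proof (rule summable_comparison_test)
    have "t f h i \<le> (1 / 2) ^ Suc i" for i
    proof -
      have "dist_Diff_fin (Suc i) f h / (dist_Diff_fin (Suc i) f h + 1) \<le> 1"
        using dist_Diff_fin(1)[OF that k, of "Suc i"] by simp
      then show ?thesis unfolding t_def by (intro mult_left_le) auto
    qed
    with nonneg[OF that] show "\<exists>N. \<forall>n\<ge>N. norm (t f h n) \<le> (1 / 2) ^ Suc n" by simp
    show "summable (\<lambda>n. (1 / 2 :: real) ^ Suc n)"
      by (subst summable_Suc_iff) (simp add: summable_geometric)
  qed
  show ?thesis
  proof (rule Metric_space.intro, goal_cases)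
    case (1 f h)
    then show ?case by (auto simp: d intro: suminf_nonneg summ nonneg)
  next
    case (2 f h)
    then show ?case using dist_Diff_fin_commute[of _ f h] by (auto simp: d t_def)
  next
    case (3 f h)
    have "f = h" if "(\<Sum>i. t f h i) = 0"
    proof -
      have "t f h 0 = 0"
        using suminf_eq_zero_iff[OF summ[OF 3] nonneg[OF 3]] that by auto
      then have "dist_Diff_fin 1 f h = 0"
        using dist_Diff_fin(1)[OF 3 k, of 1] by (simp add: t_def)
      then show ?thesis
        using dist_Diff_fin(2)[OF 3 k, of _ 1] by (intro ext) simp
    qed
    moreover have "(\<Sum>i. t f f i) = 0" by (simp add: t_def)
    ultimately show ?case using 3 by (auto simp: d)
  next
    case (4 f h l)
    have "t f l i \<le> t f h i + t h l i" for i
    proof -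
      have "dist_Diff_fin (Suc i) f l / (dist_Diff_fin (Suc i) f l + 1) \<le>
          dist_Diff_fin (Suc i) f h / (dist_Diff_fin (Suc i) f h + 1) +
          dist_Diff_fin (Suc i) h l / (dist_Diff_fin (Suc i) h l + 1)"
        using 4 k by (intro bounded_quotient_triangle dist_Diff_fin) auto
      then show ?thesis
        unfolding t_def distrib_left[symmetric] by (intro mult_left_mono) auto
    qed
    then have "(\<Sum>i. t f l i) \<le> (\<Sum>i. t f h i + t h l i)"
      using 4 by (intro suminf_le summ summable_add)
    also have "\<dots> = (\<Sum>i. t f h i) + (\<Sum>i. t h l i)"
      using 4 by (intro suminf_add[symmetric] summ)
    finally show ?case using 4 by (simp add: d)
  qed
qed

lemma mspace_type1_metric [simp]: "mspace (type1_metric r) = lifted_Diff r"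
  unfolding type1_metric_def by (rule Metric_space.mspace_metric[OF Metric_space_type1])

lemma mdist_type1_metric:
  assumes "f \<in> lifted_Diff r" "h \<in> lifted_Diff r"
  shows "mdist (type1_metric r) f h = dist_Diff r f h"
  unfolding type1_metric_def using assms by (simp add: Metric_space.mdist_metric[OF Metric_space_type1])

lemma mspace_cfunspace_compact:
  assumes "compact (UNIV :: 'a::metric_space set)"
  shows "mspace (cfunspace (euclidean :: 'a topology) m) =
    {H. continuous_map euclidean (mtopology_of m) H}"
proof -
  have "Metric_space.mbounded (mspace m) (mdist m) (range H)"
    if "continuous_map euclidean (mtopology_of m) H" for H :: "'a \<Rightarrow> 'b"
  proof -
    have "compactin (mtopology_of m) (H ` UNIV)"
      using assms that by (intro image_compactin[where X = euclidean]) auto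
    then show ?thesis
      by (simp add: mtopology_of_def Metric_space.compactin_imp_mbounded)
  qed
  then show ?thesis
    by (auto simp: extensional_def continuous_map_def)
qed

lemma mdist_cfunspace_compact:
  assumes "H \<in> mspace (cfunspace (euclidean :: 'a::metric_space topology) m)"
    and "H' \<in> mspace (cfunspace (euclidean :: 'a topology) m)"
  shows "mdist (cfunspace euclidean m) H H' = (SUP x. mdist m (H x) (H' x))"
  using assms
  by (simp add: mdist_cfunspace_eq_mdist_funspace Metric_space.fdist_def Metric_space.fspace_def Pi_iff image_subset_iff)

end

theory Submission
  imports Defs "HOL-Complex_Analysis.Cauchy_Integral_Formula"
begin

text \<open>Openness holds because the condition defining mode-locking survives, with half the tolerance, at
every nearby map. The content is density: every forced map is a limit of mode-locked ones.

Fix a lift \<open>f\<close> and \<open>e > 0\<close>. The base is uniquely ergodic, so every lift has a rotation number,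
attained uniformly over all starting points (\<open>has_rotation_exists\<close>). If \<open>f - e\<close> and \<open>f + e\<close> have
the same rotation number, then so has every lift squeezed between them, and \<open>f\<close> is mode-locked
(\<open>equal_rotation_mode_locked\<close>). Otherwise some \<open>c\<close> in the dense Schwartzman range lies strictly
between the two numbers, say \<open>c = \<integral>\<phi>\<close> with \<open>\<psi> \<circ> g - \<psi> = \<phi> mod 1\<close>. In the moving frame that rotates
the fibre over \<open>x\<close> by \<open>\<psi> x\<close>, the map becomes the lift \<open>twist \<psi> \<phi> f\<close>, whose rotation number is
smaller by \<open>c\<close>. Thus orbits of the twisted \<open>f + e\<close> drift uniformly to \<open>+\<infinity>\<close>, those of the twisted
\<open>f - e\<close> to \<open>-\<infinity>\<close>.

The heart of the proof is that such a map has a continuous section \<open>u\<close> that is invariant up to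
\<open>e\<close> (\<open>pseudo_invariant_section\<close>). Call a sequence \<open>w\<^sub>n\<close> along an orbit of the base admissible
if \<open>w\<^sub>n\<^sub>+\<^sub>1\<close> lies between the images of \<open>w\<^sub>n\<close> under \<open>f - e\<close> and \<open>f + e\<close>. Since the fibre maps are
increasing, the minimum of admissible sequences is admissible. For each time \<open>t\<close> the largest
admissible sequence that vanishes at time \<open>t\<close> follows \<open>f + e\<close> after \<open>t\<close> and \<open>f - e\<close> before \<open>t\<close>,
and it tends to \<open>+\<infinity>\<close> in both directions. The minimum over all \<open>t\<close> is therefore attained among
boundedly many times, is continuous in the base point, and does not depend on where time starts:
its value at time \<open>0\<close> is \<open>u\<close>.

A rotation of the fibres by at most \<open>e\<close> makes \<open>u\<close> exactly invariant. If the Lyapunov exponent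
along \<open>u\<close>, the integral of the logarithm of the fibre derivative, does not vanish, then a thin
strip around \<open>u\<close> (or the complement of one) is mapped strictly into itself. All lifts near \<open>f\<close>
are then caught in the same strip, which pins their orbits at a bounded distance from those of
\<open>f\<close> (\<open>hyperbolic_section_mode_locked\<close>). It remains to perturb once more should the exponent
vanish. For diffeomorphisms one adds a small multiple of a sine wave that vanishes on the section
and increases the derivative there. In the family \<open>w + P w + h\<close> only rotations are available, so
one moves the section instead: a non-constant analytic periodic \<open>P\<close> has non-vanishing second
derivative on a dense set, so the exponent changes when \<open>u\<close> is pushed over a small part of the
base.\<close>

section \<open>Unique ergodicity and uniform Birkhoff averages\<close>

text \<open>Membership in the sets \<open>B j\<close> is recorded by the ternary digits \<open>0\<close> and \<open>2\<close>, as for the Cantor set.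
The first digit in which two codes differ contributes \<open>2 * r ^ Suc i\<close> to their difference and all
later digits together at most half of this. Here \<open>r\<close> is \<open>1 / 3\<close>.\<close>

lemma code_by_ternary_digits:
  fixes B :: "nat \<Rightarrow> 'a set" and c :: "'a \<Rightarrow> real" and r :: real
  assumes r: "3 * r = 1"
    and c: "\<And>x. c x = (\<Sum>j. of_bool (x \<in> B j) * (2 * r ^ Suc j))"
  shows "\<bar>c x\<bar> \<le> 1"
    and "\<bar>c x - c y\<bar> < r ^ J \<Longrightarrow> j < J \<Longrightarrow> x \<in> B j \<longleftrightarrow> y \<in> B j"
proof -
  let ?t = "\<lambda>x j. of_bool (x \<in> B j) * (2 * r ^ Suc j)"
  have r01: "0 < r" "r < 1" "norm r < 1" using r by auto
  have geo: "(\<lambda>i. 2 * r ^ Suc (i + m)) sums (r ^ m)" for m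
  proof -
    have "(\<lambda>i. (2 * r * r ^ m) * r ^ i) sums ((2 * r * r ^ m) * (1 / (1 - r)))"
      by (intro sums_mult geometric_sums) fact
    also have "(2 * r * r ^ m) * (1 / (1 - r)) = r ^ m"
    proof -
      have "1 - r = 2 * r" using r by simp
      with r01(1) show ?thesis by (simp only: nonzero_mult_div_cancel_left) simp
    qed
    also have "(\<lambda>i. (2 * r * r ^ m) * r ^ i) = (\<lambda>i. 2 * r ^ Suc (i + m))"
      by (simp only: power_add power_Suc mult_ac)
    finally show ?thesis .
  qed
  have pos: "0 \<le> 2 * r ^ Suc k" for k using r01 by simp
  have t01: "0 \<le> ?t x j" "?t x j \<le> 2 * r ^ Suc (j + 0)" "norm (?t x j) \<le> 2 * r ^ Suc (j + 0)" for x j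
    using pos[of j] by (simp_all only: of_bool_def split: if_splits) auto
  have t: "summable (?t x)" for x
    by (rule summable_comparison_test'[OF sums_summable[OF geo[of 0]], of 0]) (rule t01(3))
  have "0 \<le> c x" unfolding c by (intro suminf_nonneg t t01)
  moreover have "c x \<le> (\<Sum>j. 2 * r ^ Suc (j + 0))"
    unfolding c by (rule suminf_le[OF t01(2) t sums_summable[OF geo[of 0]]])
  ultimately show "\<bar>c x\<bar> \<le> 1" using sums_unique[OF geo[of 0]] by simp
  show "x \<in> B j \<longleftrightarrow> y \<in> B j" if close: "\<bar>c x - c y\<bar> < r ^ J" and "j < J"
  proof (rule ccontr)
    assume differ: "\<not> (x \<in> B j \<longleftrightarrow> y \<in> B j)"
    define i where "i = (LEAST i. (x \<in> B i) \<noteq> (y \<in> B i))"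
    have i: "(x \<in> B i) \<noteq> (y \<in> B i)" "i \<le> j"
      using LeastI[of "\<lambda>i. (x \<in> B i) \<noteq> (y \<in> B i)" j] Least_le[of "\<lambda>i. (x \<in> B i) \<noteq> (y \<in> B i)" j] differ
      unfolding i_def by blast+
    have before: "of_bool (x \<in> B k) = (of_bool (y \<in> B k) :: real)" if "k < i" for k
      using not_less_Least[of k "\<lambda>i. (x \<in> B i) \<noteq> (y \<in> B i)"] that by (auto simp: i_def)
    define d where "d k = ?t x k - ?t y k" for k
    have sd: "summable d" unfolding d_def by (intro summable_diff t)
    have "c x - c y = suminf d"
      unfolding c d_def by (rule suminf_diff[OF t t])
    also have "\<dots> = (\<Sum>k. d (k + Suc i)) + (\<Sum>k<Suc i. d k)"
      by (rule suminf_split_initial_segment[OF sd])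
    also have "(\<Sum>k<Suc i. d k) = d i" by (simp add: d_def before)
    finally have eq: "c x - c y = (\<Sum>k. d (k + Suc i)) + d i" .
    have le: "\<bar>d (k + Suc i)\<bar> \<le> 2 * r ^ Suc (k + Suc i)" for k
      using t01(1,2)[of x "k + Suc i"] t01(1,2)[of y "k + Suc i"] by (simp only: d_def add_0_right)
    have sum_abs: "summable (\<lambda>k. \<bar>d (k + Suc i)\<bar>)"
      by (rule summable_comparison_test'[OF sums_summable[OF geo[of "Suc i"]], of 0])
        (simp only: real_norm_def abs_idempotent le)
    then have "\<bar>\<Sum>k. d (k + Suc i)\<bar> \<le> (\<Sum>k. \<bar>d (k + Suc i)\<bar>)" by (rule summable_rabs)
    also have "\<dots> \<le> (\<Sum>k. 2 * r ^ Suc (k + Suc i))"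
      by (rule suminf_le[OF le sum_abs sums_summable[OF geo]])
    also have "\<dots> = r ^ Suc i" by (rule sums_unique[OF geo, symmetric])
    finally have tail: "\<bar>\<Sum>k. d (k + Suc i)\<bar> \<le> r ^ Suc i" .
    have "\<bar>d i\<bar> = 2 * r ^ Suc i" using i(1) pos[of i] by (auto simp: d_def)
    with tail eq have "r ^ Suc i \<le> \<bar>c x - c y\<bar>" by linarith
    moreover have "r ^ J \<le> r ^ Suc i"
      using i(2) \<open>j < J\<close> r01 by (intro power_decreasing) auto
    ultimately show False using close by linarith
  qed
qed

text \<open>The digits record membership in countably many balls which, for every radius, contain a finite
cover by balls of that radius. Points whose codes share sufficiently many digits lie in a common
small ball, so decoding is uniformly continuous. The code itself is not continuous.\<close>

lemma compact_metric_real_code: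
  assumes "compact (UNIV :: 'a::metric_space set)"
  obtains c :: "'a::metric_space \<Rightarrow> real"
  where "\<And>x. \<bar>c x\<bar> \<le> 1" "\<And>e. e > 0 \<Longrightarrow> \<exists>d>0. \<forall>x y. \<bar>c x - c y\<bar> < d \<longrightarrow> dist x y < e"
proof -
  have "\<exists>A. finite A \<and> (UNIV :: 'a set) \<subseteq> (\<Union>x\<in>A. ball x (1 / real (Suc n)))" for n
    using seq_compact_imp_totally_bounded[of "UNIV :: 'a set"] assms
    by (force simp: compact_eq_seq_compact_metric)
  then obtain A where A: "\<And>n. finite (A n)" "\<And>n. (UNIV :: 'a set) \<subseteq> (\<Union>x\<in>A n. ball x (1 / real (Suc n)))"
    by metis
  define D where "D = (SIGMA n:UNIV. A n)"
  have D: "countable D"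
    unfolding D_def using countable_finite[OF A(1)] by (auto intro!: countable_SIGMA)
  define B where "B j = (case from_nat_into D j of (n, x) \<Rightarrow> ball x (1 / real (Suc n)))" for j
  define c where "c x = (\<Sum>j. of_bool (x \<in> B j) * (2 * (1 / 3) ^ Suc j :: real))" for x
  have "3 * (1 / 3) = (1 :: real)" by simp
  note code = code_by_ternary_digits[OF this c_def]
  show thesis
  proof (rule that[OF code(1)])
    fix e :: real assume "e > 0"
    then obtain n where n: "2 / real (Suc n) < e"
      using reals_Archimedean[of "e / 2"] by (auto simp: field_simps)
    have "\<forall>x\<in>A n. \<exists>j. from_nat_into D j = (n, x)"
      using from_nat_into_surj[OF D] by (auto simp: D_def)
    then obtain j where j: "\<And>x. x \<in> A n \<Longrightarrow> from_nat_into D (j x) = (n, x)" by metis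
    define J where "J = Suc (Max (j ` A n))"
    have "dist x y < e" if "\<bar>c x - c y\<bar> < (1 / 3) ^ J" for x y
    proof -
      obtain a where a: "a \<in> A n" "x \<in> ball a (1 / real (Suc n))" using A(2)[of n] by blast
      then have "j a < J" using A(1)[of n] by (auto simp: J_def less_Suc_eq_le)
      moreover have Bj: "B (j a) = ball a (1 / real (Suc n))" using j[OF a(1)] by (simp add: B_def)
      ultimately have "y \<in> ball a (1 / real (Suc n))" using code(2)[OF that] a(2) by blast
      with a(2) have "dist x y < 2 / real (Suc n)"
        using dist_triangle[of x y a] by (simp add: dist_commute)
      with n show ?thesis by simp
    qed
    then show "\<exists>d>0. \<forall>x y. \<bar>c x - c y\<bar> < d \<longrightarrow> dist x y < e"
      by (intro exI[of _ "(1 / 3) ^ J"]) auto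
  qed
qed

text \<open>Extending the decoding map to the closure of all codes exhibits the space as a continuous image
of a compact set of reals. Through it, compactness of probability measures on the real line
yields compactness on the space.\<close>

lemma compact_metric_is_image_of_closed_real_set:
  assumes comp: "compact (UNIV :: 'a::metric_space set)"
  obtains c :: "'a::metric_space \<Rightarrow> real" and C q
  where "\<And>x. \<bar>c x\<bar> \<le> 1" "closed C" "range c \<subseteq> C" "continuous_on C q" "\<And>x. q (c x) = x"
proof -
  obtain c :: "'a \<Rightarrow> real" where c: "\<And>x. \<bar>c x\<bar> \<le> 1"
      and sep: "\<And>e. e > 0 \<Longrightarrow> \<exists>d>0. \<forall>x y. \<bar>c x - c y\<bar> < d \<longrightarrow> dist x y < e"
    using compact_metric_real_code[OF comp] by blast
  define C where "C = closure (range c)"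
  have "\<exists>x. \<forall>e>0. \<exists>d>0. \<forall>x'. \<bar>c x' - y\<bar> < d \<longrightarrow> dist x' x < e" if y: "y \<in> C" for y
  proof -
    have "\<forall>n. \<exists>x. \<bar>c x - y\<bar> < 1 / real (Suc n)"
      using y unfolding C_def closure_approachable by (force simp: dist_real_def)
    then obtain x where x: "\<And>n. \<bar>c (x n) - y\<bar> < 1 / real (Suc n)" by metis
    obtain l r where l: "strict_mono (r :: nat \<Rightarrow> nat)" "(x \<circ> r) \<longlonglongrightarrow> l"
      using comp unfolding compact_def by (metis UNIV_I)
    show ?thesis
    proof (rule exI[of _ l], intro allI impI)
      fix e :: real assume "e > 0"
      then obtain d where d: "d > 0" "\<And>x y. \<bar>c x - c y\<bar> < d \<Longrightarrow> dist x y < e / 2"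
        using sep[of "e / 2"] by auto
      have "dist x' l < e" if x': "\<bar>c x' - y\<bar> < d / 2" for x'
      proof -
        obtain N where N: "\<And>n. n \<ge> N \<Longrightarrow> dist (x (r n)) l < e / 2"
          using metric_LIMSEQ_D[OF l(2), of "e / 2"] \<open>e > 0\<close> by auto
        obtain K where K: "1 / real (Suc K) < d / 2"
          using reals_Archimedean[of "d / 2"] d(1) by (auto simp: field_simps)
        define n where "n = max N K"
        have "K \<le> r n" using seq_suble[OF l(1), of n] by (simp add: n_def)
        then have "1 / real (Suc (r n)) \<le> 1 / real (Suc K)" by (simp add: divide_simps)
        with K x[of "r n"] x' have "\<bar>c x' - c (x (r n))\<bar> < d" by linarith
        from d(2)[OF this] N[of n] show ?thesis
          using dist_triangle[of x' l "x (r n)"] by (simp add: n_def)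
      qed
      with d(1) show "\<exists>d>0. \<forall>x'. \<bar>c x' - y\<bar> < d \<longrightarrow> dist x' l < e"
        by (intro exI[of _ "d / 2"]) auto
    qed
  qed
  \<comment> \<open>The chosen point \<open>q y\<close> is the limit of all points whose codes tend to \<open>y\<close>.\<close>
  then obtain q where q: "\<And>y e. y \<in> C \<Longrightarrow> e > 0 \<Longrightarrow> \<exists>d>0. \<forall>x'. \<bar>c x' - y\<bar> < d \<longrightarrow> dist x' (q y) < e"
    by metis
  have "continuous_on C q"
    unfolding continuous_on_iff
  proof (intro ballI allI impI)
    fix y and e :: real assume y: "y \<in> C" and e: "e > 0"
    obtain d where d: "d > 0" "\<And>x'. \<bar>c x' - y\<bar> < d \<Longrightarrow> dist x' (q y) < e / 2"
      using q[OF y, of "e / 2"] e by auto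
    have "dist (q y') (q y) < e" if y': "y' \<in> C" "dist y' y < d / 2" for y'
    proof -
      obtain d' where d': "d' > 0" "\<And>x'. \<bar>c x' - y'\<bar> < d' \<Longrightarrow> dist x' (q y') < e / 2"
        using q[OF y'(1), of "e / 2"] e by auto
      obtain x' where x': "\<bar>c x' - y'\<bar> < min d' (d / 2)"
        using y'(1) d d'(1) unfolding C_def closure_approachable
        by (metis dist_real_def half_gt_zero min_less_iff_conj rangeE)
      with y'(2) have "\<bar>c x' - y\<bar> < d" unfolding dist_real_def by linarith
      then have "dist x' (q y) < e / 2" by (rule d(2))
      moreover have "dist x' (q y') < e / 2" by (rule d'(2)) (use x' in simp)
      ultimately show ?thesis
        using dist_triangle[of "q y'" "q y" x'] dist_commute[of "q y'" x'] by linarith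
    qed
    with d(1) show "\<exists>d>0. \<forall>y'\<in>C. dist y' y < d \<longrightarrow> dist (q y') (q y) < e"
      by (intro exI[of _ "d / 2"]) auto
  qed
  moreover have "range c \<subseteq> C" unfolding C_def by (rule closure_subset)
  moreover have "q (c x) = x" for x
  proof (rule ccontr)
    assume "q (c x) \<noteq> x"
    moreover have "c x \<in> C" using \<open>range c \<subseteq> C\<close> by blast
    ultimately obtain d where "d > 0" "\<And>x'. \<bar>c x' - c x\<bar> < d \<Longrightarrow> dist x' (q (c x)) < dist x (q (c x))"
      using q[of "c x" "dist x (q (c x))"] by (metis dist_pos_lt)
    from this(2)[of x] this(1) show False by simp
  qed
  moreover have "closed C" unfolding C_def by (rule closed_closure)
  ultimately show thesis using that[of c C q] c by blast
qed

text \<open>The indicator of a closed set is the pointwise limit of continuous functions of the distance to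
it, and the closed sets generate the Borel sets.\<close>

lemma finite_borel_measure_eqI_continuous:
  fixes \<mu> \<nu> :: "'a::metric_space measure"
  assumes "finite_measure \<mu>" "finite_measure \<nu>" and sets: "sets \<mu> = sets borel" "sets \<nu> = sets borel"
    and eq: "\<And>\<xi> :: 'a \<Rightarrow> real. continuous_on UNIV \<xi> \<Longrightarrow> (\<And>x. \<bar>\<xi> x\<bar> \<le> 1) \<Longrightarrow> (\<integral>x. \<xi> x \<partial>\<mu>) = (\<integral>x. \<xi> x \<partial>\<nu>)"
  shows "\<mu> = \<nu>"
proof (rule measure_eqI_generator_eq[where E = "Collect closed" and A = "\<lambda>_. UNIV" and \<Omega> = UNIV])
  interpret \<mu>: finite_measure \<mu> by fact
  interpret \<nu>: finite_measure \<nu> by fact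
  show "Int_stable (Collect closed :: 'a set set)" by (auto simp: Int_stable_def)
  show "sets \<mu> = sigma_sets UNIV (Collect closed)" "sets \<nu> = sigma_sets UNIV (Collect closed)"
    unfolding sets borel_eq_closed by simp_all
  show "emeasure \<mu> K = emeasure \<nu> K" if "K \<in> Collect closed" for K
  proof (cases "K = {}")
    case False
    from that have K: "closed K" by simp
    define \<xi> where "\<xi> n x = max 0 (1 - real n * infdist x K)" for n x
    have cont: "continuous_on UNIV (\<xi> n)" for n unfolding \<xi>_def by (intro continuous_intros)
    have bound: "\<bar>\<xi> n x\<bar> \<le> 1" for n x using infdist_nonneg[of x K] by (auto simp: \<xi>_def max_def)
    have lim: "(\<lambda>n. \<xi> n x) \<longlonglongrightarrow> indicator K x" for x
    proof (cases "x \<in> K")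
      case True then show ?thesis by (simp add: \<xi>_def)
    next
      case nin: False
      then have pos: "infdist x K > 0"
        using K False infdist_nonneg[of x K] in_closed_iff_infdist_zero[of K x] by force
      then obtain N where N: "1 < real N * infdist x K" using reals_Archimedean3 by blast
      have "\<xi> n x = 0" if "n \<ge> N" for n
      proof -
        have "real N * infdist x K \<le> real n * infdist x K" using that pos by (intro mult_right_mono) auto
        with N show ?thesis by (simp add: \<xi>_def)
      qed
      then have "eventually (\<lambda>n. \<xi> n x = indicator K x) sequentially"
        using nin by (auto simp: eventually_sequentially)
      then show ?thesis by (rule tendsto_eventually)
    qed
    have conv: "(\<lambda>n. \<integral>x. \<xi> n x \<partial>M) \<longlonglongrightarrow> measure M K" if "finite_measure M" "sets M = sets borel" for M :: "'a measure"
    proof -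
      interpret M: finite_measure M by fact
      have meas: "\<xi> n \<in> borel_measurable M" for n
        using borel_measurable_continuous_onI[OF cont[of n]] that(2) by (simp cong: measurable_cong_sets)
      have "K \<in> sets M" using K that(2) by auto
      then have "(\<lambda>n. \<integral>x. \<xi> n x \<partial>M) \<longlonglongrightarrow> (\<integral>x. indicator K x \<partial>M)"
        using lim bound meas
        by (intro integral_dominated_convergence[where w = "\<lambda>_. 1"]) auto
      then show ?thesis
        using \<open>K \<in> sets M\<close> sets_eq_imp_space_eq[OF that(2)] by (simp add: Int_absorb2)
    qed
    have "measure \<mu> K = measure \<nu> K"
      using conv[OF assms(1) sets(1)] conv[OF assms(2) sets(2)] eq[OF cont bound]
      by (simp add: LIMSEQ_unique)
    then show ?thesis by (simp add: \<mu>.emeasure_eq_measure \<nu>.emeasure_eq_measure)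
  qed simp
  show "emeasure \<mu> UNIV \<noteq> \<infinity>" for i :: nat by simp
qed auto

text \<open>The compactness step of the Krylov--Bogoliubov argument. The empirical measures of orbit segments
are transported to the line by the code, where Helly's theorem provides a limit. The limit is
carried by the closed set of codes and is brought back by the continuous decoding map.\<close>

lemma empirical_averages_accumulate:
  fixes g :: "'a::metric_space \<Rightarrow> 'a" and x :: "nat \<Rightarrow> 'a" and n :: "nat \<Rightarrow> nat"
  assumes comp: "compact (UNIV :: 'a set)" and n: "\<And>k. n k > 0"
  obtains \<mu> :: "'a measure" and r :: "nat \<Rightarrow> nat"
  where "strict_mono r" "prob_space \<mu>" "sets \<mu> = sets borel"
    "\<And>\<phi> :: 'a \<Rightarrow> real. continuous_on UNIV \<phi> \<Longrightarrow>
      (\<lambda>k. (\<Sum>j<n (r k). \<phi> ((g ^^ j) (x (r k)))) / real (n (r k))) \<longlonglongrightarrow> (\<integral>y. \<phi> y \<partial>\<mu>)"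
proof -
  obtain c :: "'a \<Rightarrow> real" and C q where c: "\<And>x. \<bar>c x\<bar> \<le> 1" and C: "closed C" "range c \<subseteq> C"
      and q: "continuous_on C q" "\<And>x. q (c x) = x"
    using compact_metric_is_image_of_closed_real_set[OF comp] by metis
  define M where "M k = distr (measure_pmf (pmf_of_set {..<n k})) borel (\<lambda>j. c ((g ^^ j) (x k)))" for k
  have M: "real_distribution (M k)" for k
    unfolding M_def by (intro prob_space.real_distribution_distr) (auto simp: measure_pmf.prob_space_axioms)
  have int_M: "(\<integral>y. f y \<partial>M k) = (\<Sum>j<n k. f (c ((g ^^ j) (x k)))) / real (n k)"
    if "f \<in> borel_measurable borel" for f :: "real \<Rightarrow> real" and k
  proof -
    have "(\<integral>y. f y \<partial>M k) = measure_pmf.expectation (pmf_of_set {..<n k}) (\<lambda>j. f (c ((g ^^ j) (x k))))"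
      unfolding M_def using that by (subst integral_distr) auto
    also have "\<dots> = (\<Sum>j<n k. f (c ((g ^^ j) (x k)))) / real (n k)"
      using n[of k] by (subst integral_pmf_of_set) auto
    finally show ?thesis .
  qed
  have "measure (M k) {-2<..1} = 1" for k
  proof -
    have "measure (M k) {-2<..1} = measure (measure_pmf (pmf_of_set {..<n k})) UNIV"
      unfolding M_def
    proof (subst measure_distr)
      have "- 2 < c y \<and> c y \<le> 1" for y using c[of y] by linarith
      then show "measure (measure_pmf (pmf_of_set {..<n k}))
          ((\<lambda>j. c ((g ^^ j) (x k))) -` {- 2<..1} \<inter> space (measure_pmf (pmf_of_set {..<n k}))) =
        measure (measure_pmf (pmf_of_set {..<n k})) UNIV"
        by (intro arg_cong2[where f = measure]) auto
    qed auto
    then show ?thesis using measure_pmf.prob_space by simp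
  qed
  then have "tight M"
    unfolding tight_def using M
    by (intro conjI allI impI exI[of _ "-2 :: real"] exI[of _ "1 :: real"]) simp_all
  from tight_imp_convergent_subsubsequence[OF this strict_mono_id]
  obtain r L where r: "strict_mono (r :: nat \<Rightarrow> nat)" and L: "real_distribution L"
      and wc: "weak_conv_m (M \<circ> r) L" by auto
  interpret L: real_distribution L by fact
  have conv: "(\<lambda>k. (\<Sum>j<n (r k). f (c ((g ^^ j) (x (r k))))) / real (n (r k))) \<longlonglongrightarrow> (\<integral>y. f y \<partial>L)"
    if f: "continuous_on UNIV f" "\<And>y. \<bar>f y\<bar> \<le> B" for f :: "real \<Rightarrow> real" and B
  proof -
    have "(\<lambda>k. \<integral>y. f y \<partial>(M \<circ> r) k) \<longlonglongrightarrow> (\<integral>y. f y \<partial>L)"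
    proof (rule weak_conv_imp_integral_bdd_continuous_conv[OF _ L wc])
      show "real_distribution ((M \<circ> r) k)" for k using M by simp
      show "isCont f y" for y using f(1) by (simp add: continuous_on_eq_continuous_at)
      show "norm (f y) \<le> B" for y using f(2) by simp
    qed
    then show ?thesis
      using int_M[OF borel_measurable_continuous_onI[OF f(1)]] by simp
  qed
  have "C \<noteq> {}" using C(2) by auto
  \<comment> \<open>The limit does not charge the complement of \<open>C\<close>: the distance to \<open>C\<close> vanishes on all codes.\<close>
  have "AE y in L. y \<in> C"
  proof -
    let ?f = "\<lambda>y. min 1 (infdist y C)"
    have cf: "continuous_on UNIV ?f" by (intro continuous_intros)
    have "(\<lambda>k. (\<Sum>j<n (r k). ?f (c ((g ^^ j) (x (r k))))) / real (n (r k))) \<longlonglongrightarrow> (\<integral>y. ?f y \<partial>L)"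
      by (rule conv[OF cf, of 1]) (metis abs_of_nonneg infdist_nonneg min.cobounded1 min_def zero_le_one)
    moreover have "?f (c z) = 0" for z using C(2) by (subst infdist_zero) auto
    ultimately have "(\<integral>y. ?f y \<partial>L) = 0" by (simp add: LIMSEQ_const_iff)
    moreover have "integrable L ?f"
    proof (rule L.integrable_const_bound[where B = 1], intro AE_I2)
      show "norm (?f y) \<le> 1" for y using infdist_nonneg[of y C] by simp
    qed (use borel_measurable_continuous_onI[OF cf] in simp)
    ultimately have "AE y in L. ?f y = 0"
      using infdist_nonneg by (subst (asm) integral_nonneg_eq_0_iff_AE) auto
    then show ?thesis
    proof (rule AE_mp[OF _ AE_I2], intro impI)
      fix y assume "?f y = 0"
      then have "infdist y C = 0" by (simp add: min_def split: if_splits)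
      then show "y \<in> C" using in_closed_iff_infdist_zero[OF C(1) \<open>C \<noteq> {}\<close>] by simp
    qed
  qed
  define q' where "q' y = (if y \<in> C then q y else undefined)" for y
  have q': "q' \<in> measurable borel borel"
    unfolding q'_def
  proof (rule measurable_If_restrict_space_iff[THEN iffD2])
    show "q \<in> restrict_space borel {y. y \<in> C} \<rightarrow>\<^sub>M borel \<and>
        (\<lambda>_. undefined) \<in> restrict_space borel {y. y \<notin> C} \<rightarrow>\<^sub>M borel"
      using borel_measurable_continuous_on_restrict[OF q(1)] by simp
  qed (use C(1) in auto)
  define \<mu> where "\<mu> = distr L borel q'"
  have q'_L: "q' \<in> measurable L borel" using q' by (simp cong: measurable_cong_sets)
  show thesis
  proof (rule that[OF r, of \<mu>])
    show "prob_space \<mu>" unfolding \<mu>_def using q'_L by (rule L.prob_space_distr)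
    show "sets \<mu> = sets borel" by (simp add: \<mu>_def)
    fix \<phi> :: "'a \<Rightarrow> real" assume \<phi>: "continuous_on UNIV \<phi>"
    obtain B where B: "B \<ge> 0" "\<And>z. \<bar>\<phi> z\<bar> \<le> B"
    proof -
      have "compact (range \<phi>)" using \<phi> comp by (rule compact_continuous_image)
      then have "bounded (range \<phi>)" by (rule compact_imp_bounded)
      then obtain B where "\<And>z. \<bar>\<phi> z\<bar> \<le> B" by (auto simp: bounded_iff)
      moreover from this have "B \<ge> 0" by (meson abs_ge_zero order_trans)
      ultimately show thesis using that by blast
    qed
    have "continuous_on C (\<lambda>y. \<phi> (q y))"
      by (rule continuous_on_compose2[OF \<phi> q(1)]) auto
    moreover have "closedin (top_of_set UNIV) C" using C(1) by simp
    ultimately obtain f :: "real \<Rightarrow> real" where f: "continuous_on UNIV f" "\<And>y. y \<in> C \<Longrightarrow> f y = \<phi> (q y)"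
        "\<And>y. norm (f y) \<le> B"
      using Tietze[of C "\<lambda>y. \<phi> (q y)" UNIV B] B by auto
    have fc: "f (c z) = \<phi> z" for z using f(2)[of "c z"] C(2) q(2) by auto
    have "(\<lambda>k. (\<Sum>j<n (r k). f (c ((g ^^ j) (x (r k))))) / real (n (r k))) \<longlonglongrightarrow> (\<integral>y. f y \<partial>L)"
      by (rule conv[OF f(1), of B]) (use f(3) in simp)
    moreover have "(\<integral>y. f y \<partial>L) = (\<integral>y. \<phi> (q' y) \<partial>L)"
    proof (rule integral_cong_AE)
      show "f \<in> borel_measurable L" using borel_measurable_continuous_onI[OF f(1)] by simp
      show "(\<lambda>y. \<phi> (q' y)) \<in> borel_measurable L"
        by (rule measurable_compose[OF q'_L borel_measurable_continuous_onI[OF \<phi>]])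
      show "AE y in L. f y = \<phi> (q' y)"
        using \<open>AE y in L. y \<in> C\<close> by (rule AE_mp[OF _ AE_I2]) (simp add: f(2) q'_def)
    qed
    moreover have "\<dots> = (\<integral>y. \<phi> y \<partial>\<mu>)"
      unfolding \<mu>_def by (subst integral_distr[OF q'_L borel_measurable_continuous_onI[OF \<phi>]]) simp
    ultimately show "(\<lambda>k. (\<Sum>j<n (r k). \<phi> ((g ^^ j) (x (r k)))) / real (n (r k))) \<longlonglongrightarrow> (\<integral>y. \<phi> y \<partial>\<mu>)"
      by (simp add: fc)
  qed
qed


text \<open>If the convergence were not uniform, orbit segments violating it would have empirical measures
accumulating at an invariant measure that gives \<open>\<phi>\<close> a different integral.\<close>

lemma uniform_birkhoff:
  fixes g :: "'a::metric_space \<Rightarrow> 'a" and \<phi> :: "'a \<Rightarrow> real"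
  assumes comp: "compact (UNIV :: 'a set)" and g: "continuous_on UNIV g"
    and unique: "\<And>\<mu>. invariant_prob g \<mu> \<Longrightarrow> \<mu> = \<nu>"
    and \<phi>: "continuous_on UNIV \<phi>" and e: "e > 0"
  obtains N where "\<And>n x. n \<ge> N \<Longrightarrow> \<bar>(\<Sum>j<n. \<phi> ((g ^^ j) x)) - real n * (\<integral>y. \<phi> y \<partial>\<nu>)\<bar> \<le> e * real n"
proof (rule ccontr)
  assume "\<not> thesis"
  with that have "\<forall>k. \<exists>n x. n \<ge> Suc k \<and> e * real n < \<bar>(\<Sum>j<n. \<phi> ((g ^^ j) x)) - real n * (\<integral>y. \<phi> y \<partial>\<nu>)\<bar>"
    by (metis not_le)
  then obtain n x where n: "\<And>k. n k \<ge> Suc k"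
      and bad: "\<And>k. e * real (n k) < \<bar>(\<Sum>j<n k. \<phi> ((g ^^ j) (x k))) - real (n k) * (\<integral>y. \<phi> y \<partial>\<nu>)\<bar>"
    by metis
  have n0: "n k > 0" for k using n[of k] by simp
  obtain \<mu> :: "'a measure" and r where r: "strict_mono (r :: nat \<Rightarrow> nat)"
      and \<mu>: "prob_space \<mu>" "sets \<mu> = sets borel"
      and lim: "\<And>\<phi> :: 'a \<Rightarrow> real. continuous_on UNIV \<phi> \<Longrightarrow>
        (\<lambda>k. (\<Sum>j<n (r k). \<phi> ((g ^^ j) (x (r k)))) / real (n (r k))) \<longlonglongrightarrow> (\<integral>y. \<phi> y \<partial>\<mu>)"
    by (rule empirical_averages_accumulate[where n = n and g = g and x = x, OF comp n0]) blast
  interpret \<mu>: prob_space \<mu> by fact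
  have gm: "g \<in> measurable \<mu> borel"
    using borel_measurable_continuous_onI[OF g] \<mu>(2) by (simp cong: measurable_cong_sets)
  have inv_r: "(\<lambda>k. c / real (n (r k))) \<longlonglongrightarrow> 0" for c :: real
  proof -
    have "k \<le> n (r k)" for k using n[of "r k"] seq_suble[OF r, of k] by simp
    then have "filterlim (\<lambda>k. n (r k)) at_top sequentially"
      by (intro filterlim_at_top_mono[OF filterlim_ident]) auto
    then show ?thesis
      by (intro real_tendsto_divide_at_top[where c = c] tendsto_const filterlim_compose[OF filterlim_real_sequentially])
  qed
  have inv: "(\<integral>y. \<xi> (g y) \<partial>\<mu>) = (\<integral>y. \<xi> y \<partial>\<mu>)"
    if \<xi>: "continuous_on UNIV \<xi>" "\<And>y. \<bar>\<xi> y\<bar> \<le> 1" for \<xi> :: "'a \<Rightarrow> real"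
  proof -
    have cg: "continuous_on UNIV (\<lambda>y. \<xi> (g y))"
      by (rule continuous_on_compose2[OF \<xi>(1) g]) auto
    let ?A = "\<lambda>\<xi> k. (\<Sum>j<n (r k). \<xi> ((g ^^ j) (x (r k)))) / real (n (r k))"
    have "(\<lambda>k. ?A (\<lambda>y. \<xi> (g y)) k - ?A \<xi> k) \<longlonglongrightarrow> 0"
    proof (rule tendsto_0_le[OF inv_r[of 2], of _ 1], intro always_eventually allI)
      fix k
      let ?a = "\<lambda>j. \<xi> ((g ^^ j) (x (r k)))"
      have "?A (\<lambda>y. \<xi> (g y)) k - ?A \<xi> k = (\<Sum>j<n (r k). ?a (Suc j) - ?a j) / real (n (r k))"
        by (simp add: sum_subtractf diff_divide_distrib)
      also have "\<dots> = (?a (n (r k)) - ?a 0) / real (n (r k))"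
        by (simp only: sum_lessThan_telescope[of ?a "n (r k)"])
      finally have "\<bar>?A (\<lambda>y. \<xi> (g y)) k - ?A \<xi> k\<bar> = \<bar>?a (n (r k)) - ?a 0\<bar> / real (n (r k))" by simp
      also have "\<dots> \<le> 2 / real (n (r k))"
        using \<xi>(2)[of "(g ^^ n (r k)) (x (r k))"] \<xi>(2)[of "x (r k)"]
        by (intro divide_right_mono) (auto simp: abs_le_iff)
      finally show "norm (?A (\<lambda>y. \<xi> (g y)) k - ?A \<xi> k) \<le> norm (2 / real (n (r k))) * 1" by simp
    qed
    moreover have "(\<lambda>k. ?A (\<lambda>y. \<xi> (g y)) k - ?A \<xi> k) \<longlonglongrightarrow> (\<integral>y. \<xi> (g y) \<partial>\<mu>) - (\<integral>y. \<xi> y \<partial>\<mu>)"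
      by (intro tendsto_diff lim cg \<xi>(1))
    ultimately show ?thesis using LIMSEQ_unique by fastforce
  qed
  have "distr \<mu> borel g = \<mu>"
  proof (rule finite_borel_measure_eqI_continuous)
    show "finite_measure (distr \<mu> borel g)" by (rule \<mu>.finite_measure_distr[OF gm])
    show "finite_measure \<mu>" by (rule \<mu>.finite_measure_axioms)
    fix \<xi> :: "'a \<Rightarrow> real" assume \<xi>: "continuous_on UNIV \<xi>" "\<And>y. \<bar>\<xi> y\<bar> \<le> 1"
    show "(\<integral>y. \<xi> y \<partial>distr \<mu> borel g) = (\<integral>y. \<xi> y \<partial>\<mu>)"
      using inv[OF \<xi>] integral_distr[OF gm borel_measurable_continuous_onI[OF \<xi>(1)]] by simp
  qed (use \<mu>(2) in auto)
  then have "invariant_prob g \<mu>" using \<mu> by (simp add: invariant_prob_def)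
  then have "\<mu> = \<nu>" by (rule unique)
  obtain k where
    "norm ((\<Sum>j<n (r k). \<phi> ((g ^^ j) (x (r k)))) / real (n (r k)) - (\<integral>y. \<phi> y \<partial>\<mu>)) < e"
    using LIMSEQ_D[OF lim[OF \<phi>] e] by blast
  then have k: "\<bar>(\<Sum>j<n (r k). \<phi> ((g ^^ j) (x (r k)))) / real (n (r k)) - (\<integral>y. \<phi> y \<partial>\<nu>)\<bar> < e"
    by (simp add: \<open>\<mu> = \<nu>\<close>)
  have "(\<Sum>j<n (r k). \<phi> ((g ^^ j) (x (r k)))) - real (n (r k)) * (\<integral>y. \<phi> y \<partial>\<nu>)
      = real (n (r k)) * ((\<Sum>j<n (r k). \<phi> ((g ^^ j) (x (r k)))) / real (n (r k)) - (\<integral>y. \<phi> y \<partial>\<nu>))"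
    using n0[of "r k"] by (simp add: right_diff_distrib)
  then have "\<bar>(\<Sum>j<n (r k). \<phi> ((g ^^ j) (x (r k)))) - real (n (r k)) * (\<integral>y. \<phi> y \<partial>\<nu>)\<bar>
      \<le> real (n (r k)) * e"
    using k by (simp only: abs_mult) (intro mult_mono, auto)
  with bad[of "r k"] show False by (simp add: mult.commute)
qed

section \<open>Lifts of forced circle maps\<close>

text \<open>Only the fibre maps of a lift are recorded. Commutation with the unit translation makes them
descend to degree one maps of the circle.\<close>

definition fibre_lift :: "('a::metric_space \<Rightarrow> real \<Rightarrow> real) \<Rightarrow> bool"
  where "fibre_lift f \<longleftrightarrow> continuous_on UNIV (\<lambda>(x, w). f x w) \<and>
    (\<forall>x. strict_mono (f x)) \<and> (\<forall>x w. f x (w + 1) = f x w + 1)"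

primrec orbit :: "('a \<Rightarrow> 'a) \<Rightarrow> ('a \<Rightarrow> real \<Rightarrow> real) \<Rightarrow> nat \<Rightarrow> 'a \<Rightarrow> real \<Rightarrow> real"
  where
    "orbit g f 0 x w = w"
  | "orbit g f (Suc n) x w = f ((g ^^ n) x) (orbit g f n x w)"

definition circle_map :: "('a \<Rightarrow> 'a) \<Rightarrow> ('a \<Rightarrow> real \<Rightarrow> real) \<Rightarrow> 'a \<times> circle \<Rightarrow> 'a \<times> circle"
  where "circle_map g f = (\<lambda>(x, \<theta>). (g x, to_circle (f x (rep_circle \<theta>))))"

lemma fibre_liftD:
  assumes "fibre_lift f"
  shows "continuous_on UNIV (\<lambda>(x, w). f x w)" "strict_mono (f x)" "f x (w + 1) = f x w + 1"
  using assms by (auto simp: fibre_lift_def)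

lemma step_one_imp_step_int:
  fixes f :: "real \<Rightarrow> real"
  assumes step: "\<And>w. f (w + 1) = f w + 1"
  shows "f (w + of_int k) = f w + of_int k"
proof -
  have nat: "f (w + real n) = f w + real n" for w n
  proof (induction n)
    case (Suc n)
    then show ?case using step[of "w + real n"] by (simp add: algebra_simps)
  qed simp
  show ?thesis
  proof (cases "k \<ge> 0")
    case True
    then show ?thesis using nat[of w "nat k"] by simp
  next
    case False
    then show ?thesis using nat[of "w + of_int k" "nat (- k)"] by simp
  qed
qed

lemma step_zero_imp_periodic:
  fixes h :: "real \<Rightarrow> real"
  assumes step: "\<And>w. h (w + 1) = h w" and "w - v \<in> \<int>"
  shows "h w = h v"
proof -
  obtain m where m: "w - v = of_int m" using \<open>w - v \<in> \<int>\<close> by (rule Ints_cases)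
  have "h (v + of_int m) + (v + of_int m) = h v + v + of_int m"
    by (rule step_one_imp_step_int[of "\<lambda>w. h w + w"]) (simp add: step)
  moreover have "w = v + of_int m" using m by simp
  ultimately show ?thesis by simp
qed

lemma frac_diff_Ints: "w - frac w \<in> \<int>"
  by (simp add: frac_def)

lemma fibre_lift_int: "fibre_lift f \<Longrightarrow> f x (w + of_int k) = f x w + of_int k"
  by (rule step_one_imp_step_int) (rule fibre_liftD)

lemma fibre_lift_continuous:
  assumes "fibre_lift f" "continuous_on S a" "continuous_on S b"
  shows "continuous_on S (\<lambda>z. f (a z) (b z))"
proof -
  have "continuous_on S (\<lambda>z. case (a z, b z) of (x, w) \<Rightarrow> f x w)"
    by (rule continuous_on_compose2[OF fibre_liftD(1)[OF assms(1)] continuous_on_Pair[OF assms(2,3)]]) auto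
  then show ?thesis by simp
qed

lemma fibre_lift_shift:
  assumes f: "fibre_lift f" and t: "continuous_on UNIV t"
  shows "fibre_lift (\<lambda>x w. f x w + t x)"
  unfolding fibre_lift_def
proof (intro conjI allI)
  show "continuous_on UNIV (\<lambda>(x, w). f x w + t x)"
    unfolding case_prod_beta
    by (intro continuous_intros fibre_lift_continuous[OF f] continuous_on_compose2[OF t]) auto
  show "strict_mono (\<lambda>w. f x w + t x)" for x
    using fibre_liftD(2)[OF f, of x] by (auto simp: strict_mono_def)
qed (simp add: fibre_liftD(3)[OF f])

lemma orbit_step:
  assumes "fibre_lift f"
  shows "orbit g f n x (w + 1) = orbit g f n x w + 1"
  by (induction n) (auto simp: fibre_liftD(3)[OF assms])

lemma orbit_strict_mono: "fibre_lift f \<Longrightarrow> strict_mono (orbit g f n x)"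
  by (induction n) (auto simp: strict_mono_def fibre_lift_def)

lemma orbit_add: "orbit g f (m + n) x w = orbit g f m ((g ^^ n) x) (orbit g f n x w)"
  by (induction m) (auto simp: funpow_add)

lemma continuous_on_funpow:
  fixes g :: "'a::topological_space \<Rightarrow> 'a"
  shows "continuous_on UNIV g \<Longrightarrow> continuous_on UNIV (g ^^ n)"
  by (induction n) (auto intro: continuous_on_compose2 continuous_on_id simp: comp_def)

lemma orbit_continuous:
  assumes f: "fibre_lift f" and g: "continuous_on UNIV g"
    and a: "continuous_on S a" and b: "continuous_on S b"
  shows "continuous_on S (\<lambda>z. orbit g f n (a z) (b z))"
proof (induction n)
  case (Suc n)
  have "continuous_on S (\<lambda>z. (g ^^ n) (a z))"
    by (rule continuous_on_compose2[OF continuous_on_funpow[OF g] a]) auto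
  then show ?case using Suc by (auto intro: fibre_lift_continuous[OF f])
qed (use b in simp)

lemma orbit_mono_map:
  assumes f: "fibre_lift f" and le: "\<And>x w. f x w \<le> f' x w"
  shows "orbit g f n x w \<le> orbit g f' n x w"
proof (induction n)
  case (Suc n)
  have "f ((g ^^ n) x) (orbit g f n x w) \<le> f ((g ^^ n) x) (orbit g f' n x w)"
    using Suc strict_mono_less_eq[OF fibre_liftD(2)[OF f]] by blast
  also have "\<dots> \<le> f' ((g ^^ n) x) (orbit g f' n x w)" by (rule le)
  finally show ?case by simp
qed simp

text \<open>Two points can be interlaced with integer translates of each other, and an increasing map that
commutes with these translates preserves the interlacing.\<close>

lemma displacement_varies_at_most_one:
  fixes f :: "real \<Rightarrow> real"
  assumes mono: "strict_mono f" and step: "\<And>w. f (w + 1) = f w + 1"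
  shows "\<bar>(f w - w) - (f w' - w')\<bar> \<le> 1"
proof -
  define k where "k = \<lfloor>w - w'\<rfloor>"
  have k: "w' + of_int k \<le> w" "w \<le> w' + of_int (k + 1)" unfolding k_def by linarith+
  have "f (w' + of_int k) \<le> f w" "f w \<le> f (w' + of_int (k + 1))"
    using k strict_mono_less_eq[OF mono] by auto
  then have "f w' + of_int k \<le> f w" "f w \<le> f w' + of_int (k + 1)"
    by (simp_all only: step_one_imp_step_int[of f, OF step])
  with k show ?thesis by (simp add: abs_le_iff)
qed

lemma orbit_displacement:
  "fibre_lift f \<Longrightarrow> \<bar>(orbit g f n x w - w) - (orbit g f n x w' - w')\<bar> \<le> 1"
  by (intro displacement_varies_at_most_one orbit_strict_mono orbit_step)

lemma orbit_shift_int: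
  assumes f: "fibre_lift f"
  shows "orbit g (\<lambda>x w. f x w + of_int (k x)) n x w = orbit g f n x w + of_int (\<Sum>j<n. k ((g ^^ j) x))"
proof (induction n)
  case (Suc n)
  have "orbit g (\<lambda>x w. f x w + of_int (k x)) (Suc n) x w =
      f ((g ^^ n) x) (orbit g f n x w + of_int (\<Sum>j<n. k ((g ^^ j) x))) + of_int (k ((g ^^ n) x))"
    by (simp only: orbit.simps Suc)
  then show ?case unfolding fibre_lift_int[OF f] by simp
qed simp

lemma funpow_skew: "((\<lambda>(x, w). (g x, f x w)) ^^ n) (x, w) = ((g ^^ n) x, orbit g f n x w)"
  by (induction n) auto

lemma fibre_lift_bij:
  assumes f: "fibre_lift f"
  shows "bij (f x)"
proof (rule bijI)
  show "inj (f x)" using fibre_liftD(2)[OF f] by (rule strict_mono_imp_inj_on)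
  show "surj (f x)"
  proof (rule surjI)
    fix y
    define k where "k = \<lfloor>y - f x 0\<rfloor>"
    have "f x (0 + of_int k) \<le> y" "y \<le> f x (0 + of_int (k + 1))"
      unfolding fibre_lift_int[OF f] k_def by linarith+
    moreover have "continuous_on {0 + of_int k..0 + of_int (k + 1)} (f x)"
      by (intro fibre_lift_continuous[OF f] continuous_intros)
    ultimately have "\<exists>w. f x w = y"
      using IVT'[of "f x" "0 + of_int k" y "0 + of_int (k + 1)"] by auto
    then show "f x (SOME w. f x w = y) = y" by (rule someI_ex)
  qed
qed

text \<open>For a jointly continuous family of increasing functions the inverses are jointly continuous as
well, since a strict inequality \<open>f z (w - e) < y < f z (w + e)\<close> persists for nearby \<open>z\<close> and \<open>y\<close>.\<close>

lemma strict_mono_inverse_continuous: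
  fixes f :: "'z::topological_space \<Rightarrow> real \<Rightarrow> real" and G :: "'z \<Rightarrow> real \<Rightarrow> real"
  assumes cont: "continuous_on (S \<times> UNIV) (\<lambda>(z, w). f z w)"
    and mono: "\<And>z. z \<in> S \<Longrightarrow> strict_mono (f z)"
    and G: "\<And>z y. z \<in> S \<Longrightarrow> f z (G z y) = y"
  shows "continuous_on (S \<times> UNIV) (\<lambda>(z, y). G z y)"
  unfolding continuous_on_def
proof
  fix p :: "'z \<times> real" assume p: "p \<in> S \<times> UNIV"
  obtain z y where zy: "p = (z, y)" "z \<in> S" using p by auto
  show "((\<lambda>(z, y). G z y) \<longlongrightarrow> (case p of (z, y) \<Rightarrow> G z y)) (at p within S \<times> UNIV)"
  proof (rule tendstoI)
    fix e :: real assume e: "e > 0"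
    have slice: "continuous_on (S \<times> UNIV) (\<lambda>p. f (fst p) w - snd p)" for w
    proof -
      have "continuous_on (S \<times> UNIV) (\<lambda>p. case (fst p, w) of (z, w) \<Rightarrow> f z w)"
        by (rule continuous_on_compose2[OF cont]) (auto intro!: continuous_intros)
      then show ?thesis by (intro continuous_intros) simp
    qed
    have lim: "((\<lambda>p. f (fst p) w - snd p) \<longlongrightarrow> f z w - y) (at p within S \<times> UNIV)" for w
      using slice[of w] p zy by (auto simp: continuous_on_def)
    have lt: "f z (G z y - e) < f z (G z y)" "f z (G z y) < f z (G z y + e)"
      using e by (auto intro!: strict_monoD[OF mono[OF zy(2)]])
    have "eventually (\<lambda>p. f (fst p) (G z y - e) - snd p < 0) (at p within S \<times> UNIV)"
      using lt(1) G[OF zy(2), of y] by (intro order_tendstoD(2)[OF lim]) simp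
    moreover have "eventually (\<lambda>p. 0 < f (fst p) (G z y + e) - snd p) (at p within S \<times> UNIV)"
      using lt(2) G[OF zy(2), of y] by (intro order_tendstoD(1)[OF lim]) simp
    moreover have "eventually (\<lambda>p. p \<in> S \<times> UNIV) (at p within S \<times> UNIV)"
      by (simp add: eventually_at_topological) blast
    ultimately show "eventually (\<lambda>q. dist (case q of (z, y) \<Rightarrow> G z y) (case p of (z, y) \<Rightarrow> G z y) < e) (at p within S \<times> UNIV)"
    proof eventually_elim
      case (elim q)
      obtain z' y' where q: "q = (z', y')" "z' \<in> S" using elim(3) by auto
      have "f z' (G z y - e) < f z' (G z' y')" "f z' (G z' y') < f z' (G z y + e)"
        using elim(1,2) q G[OF q(2)] by auto
      then have "G z y - e < G z' y'" "G z' y' < G z y + e"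
        using strict_mono_less[OF mono[OF q(2)]] by auto
      then show ?case using q zy by (simp add: dist_real_def)
    qed
  qed
qed

lemma compact_circle: "compact (UNIV :: circle set)"
proof -
  have "continuous_on {0..1} to_circle"
    unfolding continuous_on_iff
    by (metis dist_real_def dist_to_circle_le order_le_less_trans)
  then have "compact (to_circle ` {0..1})" by (rule compact_continuous_image) simp
  moreover have "\<theta> \<in> to_circle ` {0..1}" for \<theta>
  proof
    show "\<theta> = to_circle (frac (rep_circle \<theta>))"
      by (metis Ints_of_int diff_diff_eq2 add_diff_cancel_left' frac_def to_circle_eq_iff to_circle_rep)
    show "frac (rep_circle \<theta>) \<in> {0..1}" using frac_lt_1[of "rep_circle \<theta>"] by simp
  qed
  ultimately show ?thesis by (metis UNIV_eq_I)
qed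

lemma continuous_to_circle:
  assumes "continuous_on S b"
  shows "continuous_on S (\<lambda>z. to_circle (b z))"
proof (rule continuous_on_compose2[OF _ assms])
  show "continuous_on UNIV to_circle"
    unfolding continuous_on_iff dist_real_def by (metis dist_to_circle_le order_le_less_trans)
qed auto

text \<open>The representative \<open>rep_circle \<theta>\<close> is not continuous in \<open>\<theta>\<close>. It may nevertheless be inserted into a
periodic function, because nearby points of the circle have nearby representatives.\<close>

lemma periodic_descends_continuous:
  fixes k :: "'a::metric_space \<Rightarrow> real \<Rightarrow> 'b::metric_space"
  assumes cont: "continuous_on UNIV (\<lambda>(x, w). k x w)" and per: "\<And>x w v. w - v \<in> \<int> \<Longrightarrow> k x w = k x v"
    and a: "continuous_on S a" and \<theta>: "continuous_on S \<theta>"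
  shows "continuous_on S (\<lambda>z. k (a z) (rep_circle (\<theta> z)))"
proof -
  have "continuous_on UNIV (\<lambda>(x, \<theta>). k x (rep_circle \<theta>))"
    unfolding continuous_on_iff
  proof (intro ballI allI impI, clarify)
    fix x \<theta> and e :: real assume e: "e > 0"
    obtain d where d: "d > 0" "\<And>q. dist q (x, rep_circle \<theta>) < d \<Longrightarrow> dist (case q of (x, w) \<Rightarrow> k x w) (k x (rep_circle \<theta>)) < e"
      using cont e unfolding continuous_on_iff by (metis UNIV_I case_prod_conv)
    have "dist (k x' (rep_circle \<theta>')) (k x (rep_circle \<theta>)) < e" if "dist (x', \<theta>') (x, \<theta>) < d" for x' \<theta>'
    proof -
      obtain y where y: "to_circle y = \<theta>'" "dist (to_circle (rep_circle \<theta>)) \<theta>' = \<bar>rep_circle \<theta> - y\<bar>"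
        by (rule dist_to_circle_attained)
      have "dist (x', y) (x, rep_circle \<theta>) = dist (x', \<theta>') (x, \<theta>)"
        using y(2) by (simp add: dist_Pair_Pair dist_real_def dist_commute abs_minus_commute)
      then have "dist (k x' y) (k x (rep_circle \<theta>)) < e" using d(2)[of "(x', y)"] that by simp
      moreover have "k x' y = k x' (rep_circle \<theta>')"
        using y(1) by (intro per) (metis to_circle_eq_iff to_circle_rep)
      ultimately show ?thesis by simp
    qed
    with d(1) show "\<exists>d>0. \<forall>x'\<in>UNIV. dist x' (x, \<theta>) < d \<longrightarrow>
        dist (case x' of (x, \<theta>) \<Rightarrow> k x (rep_circle \<theta>)) (k x (rep_circle \<theta>)) < e"
      by auto
  qed
  from continuous_on_compose2[OF this continuous_on_Pair[OF a \<theta>]] show ?thesis by simp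
qed

lemma circle_map_to_circle:
  assumes f: "fibre_lift f"
  shows "circle_map g f (x, to_circle w) = (g x, to_circle (f x w))"
proof -
  have "rep_circle (to_circle w) - w \<in> \<int>" by (metis to_circle_eq_iff to_circle_rep)
  then obtain k where "rep_circle (to_circle w) = w + of_int k"
    by (metis Ints_cases add.commute diff_add_cancel)
  then show ?thesis by (simp add: circle_map_def to_circle_eq_iff fibre_lift_int[OF f])
qed

lemma circle_map_cong_int: "circle_map g (\<lambda>x w. f x w + of_int (k x)) = circle_map g f"
  by (auto simp: circle_map_def to_circle_eq_iff fun_eq_iff)

locale compact_homeo =
  fixes g :: "'a::metric_space \<Rightarrow> 'a"
  assumes compact_space: "compact (UNIV :: 'a set)"
    and homeo: "homeomorphism UNIV UNIV g (inv g)"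
begin

lemma g_continuous: "continuous_on S g" and inv_g_continuous: "continuous_on S (inv g)"
  using homeo unfolding homeomorphism_def by (auto intro: continuous_on_subset)

lemma inv_g [simp]: "inv g (g x) = x" "g (inv g x) = x"
  using homeo unfolding homeomorphism_def by auto

lemma fibre_lift_is_lift:
  assumes f: "fibre_lift f"
  shows "is_lift g (\<lambda>(x, w). (g x, f x w)) (circle_map g f)"
proof -
  define G where "G x y = inv (f x) y" for x y
  have fG: "f x (G x y) = y" and Gf: "G x (f x w) = w" for x y w
    unfolding G_def using fibre_lift_bij[OF f, of x]
    by (simp_all add: bij_is_surj surj_f_inv_f bij_is_inj)
  have G: "continuous_on UNIV (\<lambda>(x, y). G x y)"
    using strict_mono_inverse_continuous[of UNIV f G] f fG by (simp add: fibre_lift_def)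
  let ?F = "\<lambda>(x, w). (g x, f x w)" and ?H = "\<lambda>(x, y). (inv g x, G (inv g x) y)"
  have "continuous_on UNIV ?F"
    unfolding case_prod_beta
    by (intro continuous_intros fibre_lift_continuous[OF f] continuous_on_compose2[OF g_continuous]) auto
  moreover have "continuous_on UNIV ?H"
  proof -
    have "continuous_on UNIV (\<lambda>p. case (inv g (fst p), snd p) of (x, y) \<Rightarrow> G x y)"
      by (rule continuous_on_compose2[OF G])
        (auto intro!: continuous_intros continuous_on_compose2[OF inv_g_continuous])
    then show ?thesis
      unfolding case_prod_beta
      by (intro continuous_intros continuous_on_compose2[OF inv_g_continuous]) auto
  qed
  ultimately have hom: "homeomorphism UNIV UNIV ?F ?H"
    by (intro homeomorphismI) (auto simp: fG Gf)
  have inv_F: "inv ?F = ?H"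
    using hom unfolding homeomorphism_def by (intro inv_unique_comp) auto
  have "homeomorphism UNIV UNIV (f x) (inv (f x))" for x
  proof (intro homeomorphismI)
    show "continuous_on UNIV (f x)" by (intro fibre_lift_continuous[OF f] continuous_intros)
    have "continuous_on UNIV (\<lambda>y. case (x, y) of (x, y) \<Rightarrow> G x y)"
      by (rule continuous_on_compose2[OF G]) (auto intro!: continuous_intros)
    then show "continuous_on UNIV (inv (f x))" by (simp add: G_def)
  qed (use fG Gf in \<open>auto simp: G_def\<close>)
  with hom f show ?thesis
    unfolding is_lift_def inv_F
    by (auto simp: fibre_liftD circle_map_to_circle fun_eq_iff)
qed

lemma fibre_lift_forced_circle_homeo:
  assumes f: "fibre_lift f"
  shows "forced_circle_homeo g (circle_map g f)"
proof -
  let ?f = "circle_map g f"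
  have cont: "continuous_on UNIV ?f"
  proof -
    have "continuous_on UNIV (\<lambda>z. to_circle (f (fst z) (rep_circle (snd z))))"
    proof (rule periodic_descends_continuous[where k = "\<lambda>x w. to_circle (f x w)"])
      show "continuous_on UNIV (\<lambda>(x, w). to_circle (f x w))"
        unfolding case_prod_beta
        by (intro continuous_to_circle fibre_lift_continuous[OF f] continuous_intros)
      show "to_circle (f x w) = to_circle (f x v)" if "w - v \<in> \<int>" for x w v
      proof -
        obtain k where "w = v + of_int k" using \<open>w - v \<in> \<int>\<close> by (metis Ints_cases add.commute diff_add_cancel)
        then show ?thesis by (simp add: fibre_lift_int[OF f] to_circle_eq_iff)
      qed
    qed (auto intro!: continuous_intros)
    then show ?thesis
      unfolding circle_map_def case_prod_beta
      by (intro continuous_intros continuous_on_compose2[OF g_continuous]) auto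
  qed
  have inj: "inj ?f"
  proof (rule injI, clarify)
    fix x \<theta> x' \<theta>'
    assume eq: "?f (x, \<theta>) = ?f (x', \<theta>')"
    then have x: "x = x'" by (metis (no_types, lifting) circle_map_def case_prod_conv inv_g(1) prod.inject)
    with eq have "f x (rep_circle \<theta>) - f x (rep_circle \<theta>') \<in> \<int>"
      by (simp add: circle_map_def to_circle_eq_iff)
    then obtain k where "f x (rep_circle \<theta>) = f x (rep_circle \<theta>') + of_int k"
      by (metis Ints_cases add.commute diff_add_cancel)
    then have "f x (rep_circle \<theta>) = f x (rep_circle \<theta>' + of_int k)" by (simp add: fibre_lift_int[OF f])
    then have "rep_circle \<theta> = rep_circle \<theta>' + of_int k"
      using strict_mono_eq[OF fibre_liftD(2)[OF f]] by blast
    then have "rep_circle \<theta> - rep_circle \<theta>' \<in> \<int>" by simp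
    then have "to_circle (rep_circle \<theta>) = to_circle (rep_circle \<theta>')" by (simp only: to_circle_eq_iff)
    with x show "x = x' \<and> \<theta> = \<theta>'" by simp
  qed
  have surj: "range ?f = UNIV"
  proof -
    have "(y, \<theta>) \<in> range ?f" for y \<theta>
    proof -
      have "?f (inv g y, to_circle (inv (f (inv g y)) (rep_circle \<theta>))) = (y, \<theta>)"
        using fibre_lift_bij[OF f, of "inv g y"]
        by (simp add: circle_map_to_circle[OF f] bij_is_surj surj_f_inv_f)
      then show ?thesis by (metis rangeI)
    qed
    then show ?thesis by auto
  qed
  have "compact (UNIV :: ('a \<times> circle) set)"
    using compact_Times[OF compact_space compact_circle] by simp
  then obtain h where h: "homeomorphism UNIV UNIV ?f h"
    using homeomorphism_compact[OF _ cont surj inj] by blast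
  then have "inv ?f = h"
    unfolding homeomorphism_def by (intro inv_unique_comp) auto
  with h fibre_lift_is_lift[OF f] show ?thesis by (auto simp: forced_circle_homeo_def)
qed

lemma round_small_iff: "\<bar>x - of_int k\<bar> < 1 / 2 \<Longrightarrow> round x = k" for x :: real
  by (rule round_unique') simp

text \<open>The difference between a lift of a map close to \<open>f\<close> and \<open>f\<close> itself is everywhere close to an
integer. The nearest integer is continuous, hence independent of the fibre coordinate, but it may
vary over a disconnected base. Subtracting it leaves fibre maps close to \<open>f\<close>.\<close>

lemma forced_circle_homeo_near_fibre_lift:
  assumes f: "fibre_lift f" and F': "is_lift g F' f'"
    and near: "\<And>z. dist (f' z) (circle_map g f z) < e" and e: "e \<le> 1 / 4"
  obtains k :: "'a \<Rightarrow> int" and f1 where "continuous_on UNIV (\<lambda>x. real_of_int (k x))" "fibre_lift f1"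
    "\<And>x w. \<bar>f1 x w - f x w\<bar> < e" "F' = (\<lambda>(x, w). (g x, f1 x w + of_int (k x)))" "f' = circle_map g f1"
proof -
  define a where "a x w = snd (F' (x, w))" for x w
  have F'_eq: "F' (x, w) = (g x, a x w)" for x w
    using F' by (simp add: is_lift_def a_def prod_eq_iff)
  have a_cont: "continuous_on UNIV (\<lambda>(x, w). a x w)"
    using F' unfolding is_lift_def homeomorphism_def a_def case_prod_beta
    by (auto intro!: continuous_intros)
  have a_mono: "strict_mono (a x)" for x using F' by (simp add: is_lift_def a_def[abs_def])
  have a_proj: "f' (x, to_circle w) = (g x, to_circle (a x w))" for x w
    using F' F'_eq by (simp add: is_lift_def fun_eq_iff)
  have close: "\<bar>(a x w - f x w) - of_int (round (a x w - f x w))\<bar> < e" for x w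
  proof -
    have "dist (to_circle (a x w)) (to_circle (f x w)) < e"
      using near[of "(x, to_circle w)"] by (simp add: a_proj circle_map_to_circle[OF f] dist_Pair_Pair)
    then show ?thesis by (simp add: dist_circle.abs_eq)
  qed
  define \<kappa> where "\<kappa> x w = round (a x w - f x w)" for x w
  have \<kappa>_cont: "continuous_on UNIV (\<lambda>(x, w). real_of_int (\<kappa> x w))"
    unfolding continuous_on_iff
  proof (intro ballI allI impI)
    fix z and e' :: real assume "e' > 0"
    have "continuous_on UNIV (\<lambda>z. a (fst z) (snd z) - f (fst z) (snd z))"
      using a_cont fibre_liftD(1)[OF f] by (auto simp: case_prod_beta intro!: continuous_intros)
    then obtain d where d: "d > 0" "\<And>z'. dist z' z < d \<Longrightarrow>
        dist (a (fst z') (snd z') - f (fst z') (snd z')) (a (fst z) (snd z) - f (fst z) (snd z)) < 1 / 4"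
      unfolding continuous_on_iff by (metis UNIV_I zero_less_divide_1_iff zero_less_numeral)
    have "\<kappa> (fst z') (snd z') = \<kappa> (fst z) (snd z)" if "dist z' z < d" for z'
    proof -
      have "\<bar>(a (fst z') (snd z') - f (fst z') (snd z')) - of_int (\<kappa> (fst z) (snd z))\<bar> < 1 / 2"
        using d(2)[OF that] close[of "fst z" "snd z"] e unfolding dist_real_def \<kappa>_def by linarith
      then show ?thesis unfolding \<kappa>_def[of "fst z'"] by (rule round_small_iff)
    qed
    with \<open>e' > 0\<close> have "dist z' z < d \<longrightarrow>
        dist (case z' of (x, w) \<Rightarrow> real_of_int (\<kappa> x w)) (case z of (x, w) \<Rightarrow> real_of_int (\<kappa> x w)) < e'" for z'
      by (simp add: case_prod_beta)
    with d(1) show "\<exists>d>0. \<forall>z'\<in>UNIV. dist z' z < d \<longrightarrow>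
        dist (case z' of (x, w) \<Rightarrow> real_of_int (\<kappa> x w)) (case z of (x, w) \<Rightarrow> real_of_int (\<kappa> x w)) < e'"
      by blast
  qed
  have slice: "continuous_on UNIV (\<lambda>z. real_of_int (\<kappa> (b z) (c z)))"
    if "continuous_on UNIV b" "continuous_on UNIV c" for b :: "'c::topological_space \<Rightarrow> 'a" and c
    using continuous_on_compose2[OF \<kappa>_cont continuous_on_Pair[OF that]] by simp
  define k where "k x = \<kappa> x 0" for x
  have \<kappa>: "\<kappa> x w = k x" for x w
  proof -
    have "(\<lambda>w. real_of_int (\<kappa> x w)) constant_on UNIV"
    proof (rule continuous_discrete_range_constant)
      show "continuous_on UNIV (\<lambda>w. real_of_int (\<kappa> x w))" by (intro slice continuous_intros)
      show "\<exists>e>0. \<forall>y. y \<in> UNIV \<and> real_of_int (\<kappa> x y) \<noteq> real_of_int (\<kappa> x w) \<longrightarrow>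
          e \<le> norm (real_of_int (\<kappa> x y) - real_of_int (\<kappa> x w))" for w
      proof (intro exI[of _ 1] conjI allI impI)
        fix y assume "y \<in> UNIV \<and> real_of_int (\<kappa> x y) \<noteq> real_of_int (\<kappa> x w)"
        then have "1 \<le> \<bar>\<kappa> x y - \<kappa> x w\<bar>" by auto
        then show "1 \<le> norm (real_of_int (\<kappa> x y) - real_of_int (\<kappa> x w))"
          by (metis (mono_tags) of_int_1_le_iff of_int_abs of_int_diff real_norm_def)
      qed simp
    qed auto
    then show ?thesis unfolding constant_on_def k_def by (metis UNIV_I of_int_eq_iff)
  qed
  define f1 where "f1 x w = a x w - of_int (k x)" for x w
  have f1_near: "\<bar>f1 x w - f x w\<bar> < e" for x w
    using close[of x w] \<kappa>[of x w] unfolding f1_def \<kappa>_def by (simp add: algebra_simps)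
  have k_cont: "continuous_on UNIV (\<lambda>x. real_of_int (k x))"
    unfolding k_def by (intro slice continuous_intros)
  have "fibre_lift f1"
    unfolding fibre_lift_def
  proof (intro conjI allI)
    show "continuous_on UNIV (\<lambda>(x, w). f1 x w)"
      using a_cont unfolding f1_def case_prod_beta
      by (intro continuous_intros continuous_on_compose2[OF k_cont]) auto
    show "strict_mono (f1 x)" for x using a_mono[of x] by (auto simp: strict_mono_def f1_def)
    show "f1 x (w + 1) = f1 x w + 1" for x w
    proof -
      have "to_circle (w + 1) = to_circle w" by (simp add: to_circle_eq_iff)
      then have "to_circle (a x (w + 1)) = to_circle (a x w)"
        using a_proj[of x "w + 1"] a_proj[of x w] by simp
      then have "f1 x (w + 1) - f1 x w - 1 \<in> \<int>"
        by (simp add: to_circle_eq_iff f1_def)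
      then obtain m where m: "f1 x (w + 1) - f1 x w - 1 = of_int m" by (rule Ints_cases)
      moreover have "\<bar>f1 x (w + 1) - f1 x w - 1\<bar> < 1"
        using f1_near[of x "w + 1"] f1_near[of x w] e fibre_liftD(3)[OF f, of x w] by linarith
      ultimately have "m = 0" by simp
      with m show ?thesis by simp
    qed
  qed
  moreover have "f' = circle_map g f1"
  proof
    fix z :: "'a \<times> circle"
    obtain x \<theta> where z: "z = (x, \<theta>)" by (cases z)
    show "f' z = circle_map g f1 z"
      using a_proj[of x "rep_circle \<theta>"] by (simp add: z circle_map_def f1_def to_circle_eq_iff)
  qed
  moreover have "F' = (\<lambda>(x, w). (g x, f1 x w + of_int (k x)))"
    by (auto simp: fun_eq_iff F'_eq f1_def)
  ultimately show thesis using that k_cont f1_near by blast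
qed

end

section \<open>A criterion for mode-locking\<close>

context compact_homeo
begin

lemma is_lift_circle_map_iff:
  assumes f: "fibre_lift f"
  shows "is_lift g F (circle_map g f) \<longleftrightarrow>
    (\<exists>k :: 'a \<Rightarrow> int. continuous_on UNIV (\<lambda>x. real_of_int (k x)) \<and> F = (\<lambda>(x, w). (g x, f x w + of_int (k x))))"
proof
  assume "is_lift g F (circle_map g f)"
  then obtain k :: "'a \<Rightarrow> int" and f1 where k: "continuous_on UNIV (\<lambda>x. real_of_int (k x))"
      and f1: "fibre_lift f1" "\<And>x w. \<bar>f1 x w - f x w\<bar> < 1 / 4" "F = (\<lambda>(x, w). (g x, f1 x w + of_int (k x)))"
        "circle_map g f = circle_map g f1"
    by (rule forced_circle_homeo_near_fibre_lift[OF f, where e = "1 / 4"]) auto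
  have "f1 x w = f x w" for x w
  proof -
    have "to_circle (f1 x w) = to_circle (f x w)"
      using f1(4) circle_map_to_circle[OF f1(1), of g x w] circle_map_to_circle[OF f, of g x w] by simp
    then obtain m where m: "f1 x w - f x w = of_int m" by (auto simp: to_circle_eq_iff elim: Ints_cases)
    with f1(2)[of x w] have "m = 0" by simp
    with m show ?thesis by simp
  qed
  with k f1(3) show "\<exists>k :: 'a \<Rightarrow> int. continuous_on UNIV (\<lambda>x. real_of_int (k x)) \<and>
      F = (\<lambda>(x, w). (g x, f x w + of_int (k x)))"
    by auto
next
  assume "\<exists>k :: 'a \<Rightarrow> int. continuous_on UNIV (\<lambda>x. real_of_int (k x)) \<and> F = (\<lambda>(x, w). (g x, f x w + of_int (k x)))"
  then obtain k :: "'a \<Rightarrow> int" where k: "continuous_on UNIV (\<lambda>x. real_of_int (k x))"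
    and F: "F = (\<lambda>(x, w). (g x, f x w + of_int (k x)))" by blast
  show "is_lift g F (circle_map g f)"
    using fibre_lift_is_lift[OF fibre_lift_shift[OF f k]] unfolding F circle_map_cong_int .
qed

text \<open>Over a disconnected base the lifts of one map may differ by a non-constant integer-valued \<open>k\<close>, and
their rotation numbers may differ modulo one. The description then need not single out a value,
so equality of two rotation numbers is obtained by matching lifts with the same \<open>k\<close>, which makes
the two described properties coincide.\<close>

lemma rotation_number_circle_map:
  assumes f: "fibre_lift f"
  shows "rotation_number g (circle_map g f) = (THE \<theta>. \<exists>k :: 'a \<Rightarrow> int. continuous_on UNIV (\<lambda>x. real_of_int (k x)) \<and>
    \<theta> = to_circle (lift_rotation (\<lambda>(x, w). (g x, f x w + of_int (k x)))))"
  unfolding rotation_number_def is_lift_circle_map_iff[OF f] by (rule arg_cong[where f = The]) auto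

lemma lift_rotation_cong:
  assumes f: "fibre_lift f" "fibre_lift f1"
    and conv: "\<And>x w. (\<lambda>n. (orbit g f1 n x w - orbit g f n x w) / real n) \<longlonglongrightarrow> 0"
  shows "lift_rotation (\<lambda>(x, w). (g x, f1 x w + of_int (k x))) = lift_rotation (\<lambda>(x, w). (g x, f x w + of_int (k x)))"
proof -
  have "(\<lambda>n. snd (((\<lambda>(x, w). (g x, f1 x w + of_int (k x))) ^^ n) z) / real n) \<longlonglongrightarrow> \<rho> \<longleftrightarrow>
        (\<lambda>n. snd (((\<lambda>(x, w). (g x, f x w + of_int (k x))) ^^ n) z) / real n) \<longlonglongrightarrow> \<rho>" for z \<rho>
  proof -
    obtain x w where z: "z = (x, w)" by (cases z)
    have "(\<lambda>n. snd (((\<lambda>(x, w). (g x, f1 x w + of_int (k x))) ^^ n) z) / real n -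
        snd (((\<lambda>(x, w). (g x, f x w + of_int (k x))) ^^ n) z) / real n) \<longlonglongrightarrow> 0"
      using conv[of x w] by (simp add: z funpow_skew orbit_shift_int[OF f(1)] orbit_shift_int[OF f(2)] flip: diff_divide_distrib)
    then show ?thesis by (rule Lim_transform_eq)
  qed
  then show ?thesis unfolding lift_rotation_def by simp
qed

text \<open>Adding the same \<open>k\<close> to two lifts adds the same Birkhoff sum of \<open>k\<close> to both orbits, so a sublinear
distance between the orbits of \<open>f1\<close> and \<open>f\<close> passes to all pairs of matching lifts.\<close>

lemma mode_lockedI:
  assumes f: "fibre_lift f" and e: "e > 0"
    and conv: "\<And>f1 x w. fibre_lift f1 \<Longrightarrow> (\<And>x w. \<bar>f1 x w - f x w\<bar> < e) \<Longrightarrow>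
      (\<lambda>n. (orbit g f1 n x w - orbit g f n x w) / real n) \<longlonglongrightarrow> 0"
  shows "mode_locked g (circle_map g f)"
  unfolding mode_locked_def
proof (intro conjI exI[of _ "min e (1 / 4)"] allI impI)
  show "forced_circle_homeo g (circle_map g f)" by (rule fibre_lift_forced_circle_homeo[OF f])
  fix f' assume f': "forced_circle_homeo g f' \<and> (\<forall>z. dist (f' z) (circle_map g f z) < min e (1 / 4))"
  then obtain F' where "is_lift g F' f'" by (auto simp: forced_circle_homeo_def)
  then obtain k :: "'a \<Rightarrow> int" and f1 where f1: "fibre_lift f1" "\<And>x w. \<bar>f1 x w - f x w\<bar> < min e (1 / 4)"
      and f'_eq: "f' = circle_map g f1"
    by (rule forced_circle_homeo_near_fibre_lift[OF f, where e = "min e (1 / 4)"]) (use f' in auto)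
  have "lift_rotation (\<lambda>(x, w). (g x, f1 x w + of_int (k x))) = lift_rotation (\<lambda>(x, w). (g x, f x w + of_int (k x)))" for k
    using f1 by (intro lift_rotation_cong[OF f f1(1)] conv[OF f1(1)]) auto
  then show "rotation_number g f' = rotation_number g (circle_map g f)"
    unfolding f'_eq rotation_number_circle_map[OF f] rotation_number_circle_map[OF f1(1)] by simp
qed (use e in auto)

definition has_rotation :: "('a \<Rightarrow> real \<Rightarrow> real) \<Rightarrow> real \<Rightarrow> bool"
  where "has_rotation f \<rho> \<longleftrightarrow>
    (\<forall>e>0. \<exists>N. \<forall>n\<ge>N. \<forall>x w. \<bar>orbit g f n x w - w - real n * \<rho>\<bar> \<le> e * real n)"

text \<open>Orbits of nearby lifts are squeezed between those of \<open>f - e\<close> and \<open>f + e\<close>.\<close>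

lemma equal_rotation_mode_locked:
  assumes f: "fibre_lift f" and e: "e > 0"
    and rot: "has_rotation (\<lambda>x w. f x w - e) \<rho>" "has_rotation (\<lambda>x w. f x w + e) \<rho>"
  shows "mode_locked g (circle_map g f)"
proof (rule mode_lockedI[OF f e])
  fix f1 x w assume f1: "fibre_lift f1" and near: "\<And>x w. \<bar>f1 x w - f x w\<bar> < e"
  have fm: "fibre_lift (\<lambda>x w. f x w - e)" using fibre_lift_shift[OF f, of "\<lambda>_. - e"] by simp
  show "(\<lambda>n. (orbit g f1 n x w - orbit g f n x w) / real n) \<longlonglongrightarrow> 0"
  proof (rule LIMSEQ_I)
    fix r :: real assume r: "r > 0"
    obtain N where N: "\<And>n. n \<ge> N \<Longrightarrow> \<bar>orbit g (\<lambda>x w. f x w - e) n x w - w - real n * \<rho>\<bar> \<le> r / 4 * real n"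
      using rot(1) r unfolding has_rotation_def by (metis divide_pos_pos zero_less_numeral)
    obtain N' where N': "\<And>n. n \<ge> N' \<Longrightarrow> \<bar>orbit g (\<lambda>x w. f x w + e) n x w - w - real n * \<rho>\<bar> \<le> r / 4 * real n"
      using rot(2) r unfolding has_rotation_def by (metis divide_pos_pos zero_less_numeral)
    have "\<bar>(orbit g f1 n x w - orbit g f n x w) / real n\<bar> < r" if n: "n \<ge> Suc (max N N')" for n
    proof -
      have le: "f1 x w \<le> f x w + e" "f x w - e \<le> f1 x w" for x w using near[of x w] by auto
      have "orbit g f1 n x w \<le> orbit g (\<lambda>x w. f x w + e) n x w" "orbit g f n x w \<le> orbit g (\<lambda>x w. f x w + e) n x w"
        "orbit g (\<lambda>x w. f x w - e) n x w \<le> orbit g f1 n x w" "orbit g (\<lambda>x w. f x w - e) n x w \<le> orbit g f n x w"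
        using e le by (auto intro!: orbit_mono_map f f1 fm)
      moreover have "\<bar>orbit g (\<lambda>x w. f x w - e) n x w - w - real n * \<rho>\<bar> \<le> r / 4 * real n"
        "\<bar>orbit g (\<lambda>x w. f x w + e) n x w - w - real n * \<rho>\<bar> \<le> r / 4 * real n"
        using N[of n] N'[of n] n by auto
      ultimately have "\<bar>orbit g f1 n x w - orbit g f n x w\<bar> \<le> r / 2 * real n" by linarith
      moreover have "r / 2 * real n < r * real n" using r n by simp
      ultimately show ?thesis using n by (simp add: abs_divide divide_less_eq)
    qed
    then show "\<exists>no. \<forall>n\<ge>no. norm ((orbit g f1 n x w - orbit g f n x w) / real n - 0) < r" by auto
  qed
qed

lemma continuous_real_bounded:
  fixes b :: "'a \<Rightarrow> real"
  assumes "continuous_on UNIV b"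
  obtains B where "B \<ge> 0" "\<And>x. \<bar>b x\<bar> \<le> B"
proof -
  have "bounded (range b)"
    by (rule compact_imp_bounded[OF compact_continuous_image[OF assms compact_space]])
  then obtain B where "\<And>x. \<bar>b x\<bar> \<le> B" by (auto simp: bounded_iff)
  moreover from this have "B \<ge> 0" by (meson abs_ge_zero order_trans)
  ultimately show thesis using that by blast
qed

lemma finite_minimum_continuous:
  fixes c :: "nat \<Rightarrow> 'b::topological_space \<Rightarrow> real"
  assumes "\<And>n. continuous_on UNIV (c n)"
  shows "\<exists>u. continuous_on UNIV u \<and> (\<forall>x. \<forall>n\<le>K. u x \<le> c n x) \<and> (\<forall>x. \<exists>n\<le>K. u x = c n x)"
proof (induction K)
  case 0
  show ?case using assms[of 0] by auto
next
  case (Suc K)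
  then obtain u where u: "continuous_on UNIV u" "\<And>x n. n \<le> K \<Longrightarrow> u x \<le> c n x" "\<And>x. \<exists>n\<le>K. u x = c n x"
    by blast
  let ?u = "\<lambda>x. min (u x) (c (Suc K) x)"
  have "continuous_on UNIV ?u" by (intro continuous_intros u(1) assms)
  moreover have "?u x \<le> c n x" if "n \<le> Suc K" for x n
    using that u(2)[of n x] by (auto simp: le_Suc_eq min_le_iff_disj)
  moreover have "\<exists>n\<le>Suc K. ?u x = c n x" for x
    using u(3)[of x] by (auto simp: min_def intro: le_SucI)
  ultimately show ?case by blast
qed

text \<open>With the admissible sequences of the opening text, \<open>a n x\<close> and \<open>b n x\<close> below are the present
values of the largest admissible sequences that vanish \<open>n\<close> steps ago and \<open>n\<close> steps ahead. One step of \<open>fp\<close> turns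
\<open>a n\<close> into \<open>a (Suc n)\<close>, and one step of \<open>fm\<close> turns \<open>b (Suc n)\<close> into \<open>b n\<close>, so the pointwise
minimum \<open>u\<close> of all of them satisfies both inequalities. This is the counterpart of McShane's
extension of Lipschitz functions, with the pair \<open>fm \<le> fp\<close> in the role of the Lipschitz condition.\<close>

lemma pseudo_invariant_section:
  assumes fm: "fibre_lift fm" and fp: "fibre_lift fp" and le: "\<And>x w. fm x w \<le> fp x w"
    and \<kappa>: "\<kappa> > 0" and up: "\<And>n x. n \<ge> N \<Longrightarrow> \<kappa> * real n \<le> orbit g fp n x 0"
    and down: "\<And>n x. n \<ge> N \<Longrightarrow> orbit g fm n x 0 \<le> - (\<kappa> * real n)"
  obtains u where "continuous_on UNIV u" "\<And>x. fm x (u x) \<le> u (g x)" "\<And>x. u (g x) \<le> fp x (u x)"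
proof -
  define a where "a n x = orbit g fp n ((inv g ^^ n) x) 0" for n x
  define b where "b n x = inv (orbit g fm n x) 0" for n x
  have lift_orbit: "fibre_lift (\<lambda>x. orbit g fm n x)" for n
    unfolding fibre_lift_def
  proof (intro conjI allI)
    show "continuous_on UNIV (\<lambda>(x, w). orbit g fm n x w)"
      unfolding case_prod_beta by (intro orbit_continuous[OF fm g_continuous] continuous_intros)
  qed (auto simp: orbit_strict_mono[OF fm] orbit_step[OF fm])
  have b: "orbit g fm n x (b n x) = 0" for n x
    unfolding b_def using fibre_lift_bij[OF lift_orbit, of n x] by (simp add: bij_is_surj surj_f_inv_f)
  have a_cont: "continuous_on UNIV (a n)" for n
    unfolding a_def
    by (intro orbit_continuous[OF fp g_continuous] continuous_on_const continuous_on_funpow inv_g_continuous)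
  have b_cont: "continuous_on UNIV (b n)" for n
  proof -
    have "continuous_on (UNIV \<times> UNIV) (\<lambda>(x, y). inv (orbit g fm n x) y)"
    proof (rule strict_mono_inverse_continuous)
      show "continuous_on (UNIV \<times> UNIV) (\<lambda>(x, w). orbit g fm n x w)"
        using fibre_liftD(1)[OF lift_orbit] by simp
      show "orbit g fm n x (inv (orbit g fm n x) y) = y" for x y
        using fibre_lift_bij[OF lift_orbit, of n x] by (simp add: bij_is_surj surj_f_inv_f)
    qed (rule orbit_strict_mono[OF fm])
    from continuous_on_compose2[OF this, of UNIV "\<lambda>x. (x, 0)"]
    show ?thesis unfolding b_def by (simp add: continuous_on_Pair continuous_on_id)
  qed
  have zero: "a 0 x = 0" "b 0 x = 0" for x using b[of 0 x] by (auto simp: a_def)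
  have inv_funpow: "(g ^^ n) ((inv g ^^ n) x) = x" for n x
  proof (induction n)
    case (Suc n)
    have "(g ^^ Suc n) ((inv g ^^ Suc n) x) = (g ^^ n) (g ((inv g ^^ Suc n) x))"
      by (simp only: funpow_Suc_right comp_apply)
    with Suc show ?case by simp
  qed simp
  have a_step: "fp x (a n x) = a (Suc n) (g x)" for n x
  proof -
    have "(inv g ^^ Suc n) (g x) = (inv g ^^ n) x" by (simp only: funpow_Suc_right comp_apply inv_g)
    then show ?thesis by (simp add: a_def inv_funpow)
  qed
  have b_step: "fm x (b (Suc n) x) = b n (g x)" for n x
  proof -
    have "orbit g fm (n + 1) x (b (Suc n) x) = 0" using b[of "Suc n" x] by simp
    then have "orbit g fm n (g x) (fm x (b (Suc n) x)) = orbit g fm n (g x) (b n (g x))"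
      unfolding orbit_add by (simp add: b)
    then show ?thesis using strict_mono_eq[OF orbit_strict_mono[OF fm]] by blast
  qed
  \<comment> \<open>Beyond time \<open>K\<close> all values exceed \<open>a 0 x = 0\<close> and do not affect the minimum. The bound \<open>1\<close> absorbs
    the variation of the displacement along a fibre.\<close>
  obtain K0 where "1 < real K0 * \<kappa>" using \<kappa> reals_Archimedean3 by blast
  define K where "K = max K0 N"
  have large: "1 < \<kappa> * real n" if "n \<ge> K" for n
  proof -
    have "real K0 * \<kappa> \<le> real n * \<kappa>" using that \<kappa> by (intro mult_right_mono) (auto simp: K_def)
    with \<open>1 < real K0 * \<kappa>\<close> show ?thesis by (simp add: mult.commute)
  qed
  have pos: "0 < a n x" "0 < b n x" if "n \<ge> K" for n x
  proof -
    show "0 < a n x" using large[OF that] up[of n "(inv g ^^ n) x"] that by (simp add: a_def K_def)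
    have "\<bar>(orbit g fm n x (b n x) - b n x) - (orbit g fm n x 0 - 0)\<bar> \<le> 1"
      by (rule orbit_displacement[OF fm])
    then show "0 < b n x" using large[OF that] down[of n x] that by (simp add: b K_def)
  qed
  have "continuous_on UNIV (\<lambda>x. min (a n x) (b n x))" for n
    by (rule continuous_on_min[OF a_cont b_cont])
  from finite_minimum_continuous[OF this, of K]
  obtain u where u: "continuous_on UNIV u \<and> (\<forall>x. \<forall>n\<le>K. u x \<le> min (a n x) (b n x)) \<and>
      (\<forall>x. \<exists>n\<le>K. u x = min (a n x) (b n x))" ..
  then have u_cont: "continuous_on UNIV u" and u_le: "\<And>x n. n \<le> K \<Longrightarrow> u x \<le> min (a n x) (b n x)"
      and u_att: "\<And>x. \<exists>n\<le>K. u x = min (a n x) (b n x)"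
    by simp_all
  have u_le_all: "u x \<le> a n x" "u x \<le> b n x" for x n
  proof -
    have "u x \<le> 0" using u_le[of 0 x] by (simp add: zero)
    then show "u x \<le> a n x" "u x \<le> b n x"
      using u_le[of n x] pos[of n x] by (cases "n \<le> K"; simp)+
  qed
  have u_cases: "(\<exists>n. u x = a n x) \<or> (\<exists>n. u x = b (Suc n) x)" for x
  proof -
    obtain n where "u x = min (a n x) (b n x)" using u_att[of x] by blast
    then have "u x = a n x \<or> u x = b n x" by (simp add: min_def)
    then show ?thesis using zero[of x] by (cases n) metis+
  qed
  have mono: "fp x v \<le> fp x w \<longleftrightarrow> v \<le> w" "fm x v \<le> fm x w \<longleftrightarrow> v \<le> w" for x v w
    using strict_mono_less_eq[OF fibre_liftD(2)[OF fp, of x], of v w]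
      strict_mono_less_eq[OF fibre_liftD(2)[OF fm, of x], of v w] by blast+
  show thesis
  proof (rule that[OF u_cont])
    fix x
    from u_cases[of x] show "u (g x) \<le> fp x (u x)"
    proof (elim disjE exE)
      fix n assume "u x = a n x"
      then show ?thesis using u_le_all(1)[of "g x" "Suc n"] by (simp add: a_step)
    next
      fix n assume "u x = b (Suc n) x"
      then show ?thesis using u_le_all(2)[of "g x" n] le[of x "b (Suc n) x"] by (simp add: b_step)
    qed
    from u_cases[of "g x"] show "fm x (u x) \<le> u (g x)"
    proof (elim disjE exE)
      fix n assume n: "u (g x) = a n (g x)"
      show ?thesis
      proof (cases n)
        case 0
        have "fm x (u x) \<le> fm x (b 1 x)" using u_le_all(2) by (simp add: mono)
        with n 0 show ?thesis using b_step[of x 0] by (simp add: zero)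
      next
        case (Suc m)
        have "fm x (u x) \<le> fp x (u x)" by (rule le)
        also have "\<dots> \<le> fp x (a m x)" using u_le_all(1) by (simp add: mono)
        finally show ?thesis using n Suc by (simp add: a_step)
      qed
    next
      fix n assume n: "u (g x) = b (Suc n) (g x)"
      have "fm x (u x) \<le> fm x (b (Suc (Suc n)) x)" using u_le_all(2) by (simp add: mono)
      with n show ?thesis by (simp add: b_step)
    qed
  qed
qed

end

section \<open>Rotation numbers over a uniquely ergodic base\<close>

locale unique_ergodic = compact_homeo g for g :: "'a::metric_space \<Rightarrow> 'a" +
  fixes \<nu> :: "'a measure"
  assumes invariant: "invariant_prob g \<nu>"
    and unique: "\<And>\<mu>. invariant_prob g \<mu> \<Longrightarrow> \<mu> = \<nu>"
begin

sublocale prob_space \<nu> using invariant by (simp add: invariant_prob_def)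

lemma birkhoff:
  fixes \<phi> :: "'a \<Rightarrow> real"
  assumes "continuous_on UNIV \<phi>" and "e > 0"
  obtains N where "\<And>n x. n \<ge> N \<Longrightarrow> \<bar>(\<Sum>j<n. \<phi> ((g ^^ j) x)) - real n * (\<integral>y. \<phi> y \<partial>\<nu>)\<bar> \<le> e * real n"
  using uniform_birkhoff[OF compact_space g_continuous unique assms] by blast

lemma sum_telescope_window:
  fixes b :: "nat \<Rightarrow> real"
  shows "(\<Sum>j<N. b (n + j) - b j) = (\<Sum>i<n. b (N + i) - b i)"
proof (induction N)
  case (Suc N)
  have "(\<Sum>i<n. b (Suc N + i) - b i) - (\<Sum>i<n. b (N + i) - b i) = (\<Sum>i<n. b (N + Suc i) - b (N + i))"
    by (simp flip: sum_subtractf)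
  also have "\<dots> = b (N + n) - b (N + 0)"
    by (rule sum_lessThan_telescope[of "\<lambda>i. b (N + i)" n])
  finally show ?case using Suc by (simp add: add.commute)
qed simp

text \<open>The displacement over time \<open>n\<close> is a cocycle up to an error of one. Hence \<open>n\<close> times the
displacement over a long time \<open>m\<close> agrees, up to \<open>m\<close> and a constant, with the Birkhoff sum of the
displacement over time \<open>n\<close>, whose growth is governed by the invariant measure.\<close>

lemma orbit_average:
  assumes f: "fibre_lift f" and n: "n > 0" and e: "e > 0"
  defines "\<alpha> \<equiv> (\<integral>x. orbit g f n x 0 \<partial>\<nu>) / real n"
  obtains N where "\<And>m x. m \<ge> N \<Longrightarrow> \<bar>orbit g f m x 0 - real m * \<alpha>\<bar> \<le> (1 / real n + e) * real m"
proof -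
  let ?a = "\<lambda>m x. orbit g f m x 0"
  have cont: "continuous_on UNIV (?a m)" for m
    by (intro orbit_continuous[OF f g_continuous] continuous_on_id continuous_on_const)
  have quasi: "\<bar>?a (i + j) x - ?a j x - ?a i ((g ^^ j) x)\<bar> \<le> 1" for i j x
    using orbit_displacement[OF f, of g i "(g ^^ j) x" "?a j x" 0] by (simp add: orbit_add)
  have "\<exists>C. \<forall>i<n. \<forall>x. \<bar>?a i x\<bar> \<le> C"
  proof -
    have "\<exists>C. \<forall>x. \<bar>?a i x\<bar> \<le> C" for i by (rule continuous_real_bounded[OF cont[of i]]) blast
    then obtain C where C: "\<And>i x. \<bar>?a i x\<bar> \<le> C i" by metis
    have "C i \<le> Max (C ` {..<n})" if "i < n" for i using that by (intro Max_ge) auto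
    with C show ?thesis by (meson order_trans)
  qed
  then obtain C where C: "\<And>i x. i < n \<Longrightarrow> \<bar>?a i x\<bar> \<le> C" by blast
  have est: "\<bar>real n * ?a m x - (\<Sum>j<m. ?a n ((g ^^ j) x))\<bar> \<le> real m + real n * (1 + 2 * C)" for m x
  proof -
    have "\<bar>(\<Sum>j<m. ?a (n + j) x - ?a j x) - (\<Sum>j<m. ?a n ((g ^^ j) x))\<bar> \<le> (\<Sum>j<m. 1)"
      unfolding sum_subtractf[symmetric] using quasi by (intro order_trans[OF sum_abs] sum_mono) auto
    moreover have "\<bar>(\<Sum>i<n. ?a (m + i) x - ?a i x) - (\<Sum>i<n. ?a m x)\<bar> \<le> (\<Sum>i<n. 1 + 2 * C)"
      unfolding sum_subtractf[symmetric]
    proof (intro order_trans[OF sum_abs] sum_mono)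
      fix i assume "i \<in> {..<n}"
      then have "i < n" by simp
      then show "\<bar>?a (m + i) x - ?a i x - ?a m x\<bar> \<le> 1 + 2 * C"
        using quasi[of i m x] C[of i x] C[of i "(g ^^ m) x"] unfolding add.commute[of m i] by linarith
    qed
    moreover have "(\<Sum>j<m. ?a (n + j) x - ?a j x) = (\<Sum>i<n. ?a (m + i) x - ?a i x)"
      by (rule sum_telescope_window[of "\<lambda>j. ?a j x"])
    ultimately show ?thesis by simp
  qed
  define e' where "e' = real n * e / 2"
  have e': "e' > 0" using n e by (simp add: e'_def)
  obtain N where N: "\<And>m x. m \<ge> N \<Longrightarrow> \<bar>(\<Sum>j<m. ?a n ((g ^^ j) x)) - real m * (\<integral>x. ?a n x \<partial>\<nu>)\<bar> \<le> e' * real m"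
    using birkhoff[OF cont[of n] e'] by blast
  obtain N' where N': "real n * (1 + 2 * C) < real N' * e'" using reals_Archimedean3[OF e'] by blast
  show thesis
  proof (rule that[of "max N N'"])
    fix m x assume m: "m \<ge> max N N'"
    have "real N' * e' \<le> real m * e'" using m e' by (intro mult_right_mono) auto
    with N' N[of m x] m est[of m x]
    have "\<bar>real n * ?a m x - real m * (\<integral>x. ?a n x \<partial>\<nu>)\<bar> \<le> real m + 2 * (e' * real m)"
      by (simp add: mult.commute[of "real m" e'])
    then have "\<bar>real n * (?a m x - real m * \<alpha>)\<bar> \<le> real n * ((1 / real n + e) * real m)"
      using n by (simp add: \<alpha>_def e'_def right_diff_distrib) (simp add: algebra_simps)
    then show "\<bar>?a m x - real m * \<alpha>\<bar> \<le> (1 / real n + e) * real m"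
      using n by (simp only: abs_mult abs_of_nat) simp
  qed
qed

lemma has_rotation_exists:
  assumes f: "fibre_lift f"
  shows "\<exists>\<rho>. has_rotation f \<rho>"
proof -
  define \<alpha> where "\<alpha> n = (\<integral>x. orbit g f n x 0 \<partial>\<nu>) / real n" for n
  have close: "\<bar>\<alpha> n - \<alpha> m\<bar> \<le> 1 / real n + 1 / real m" if nm: "n > 0" "m > 0" for n m
  proof (rule field_le_epsilon)
    fix e :: real assume e: "e > 0"
    obtain N where N: "\<And>k x. k \<ge> N \<Longrightarrow> \<bar>orbit g f k x 0 - real k * \<alpha> n\<bar> \<le> (1 / real n + e / 2) * real k"
      using orbit_average[OF f nm(1), of "e / 2"] e unfolding \<alpha>_def by auto
    obtain N' where N': "\<And>k x. k \<ge> N' \<Longrightarrow> \<bar>orbit g f k x 0 - real k * \<alpha> m\<bar> \<le> (1 / real m + e / 2) * real k"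
      using orbit_average[OF f nm(2), of "e / 2"] e unfolding \<alpha>_def by auto
    define k where "k = Suc (max N N')"
    have "\<bar>real k * \<alpha> n - real k * \<alpha> m\<bar> \<le> (1 / real n + e / 2) * real k + (1 / real m + e / 2) * real k"
    proof -
      have "N \<le> k" "N' \<le> k" by (auto simp: k_def)
      from N[OF this(1), of undefined] N'[OF this(2), of undefined] show ?thesis by linarith
    qed
    then have "real k * \<bar>\<alpha> n - \<alpha> m\<bar> \<le> real k * (1 / real n + 1 / real m + e)"
      by (simp add: abs_mult flip: right_diff_distrib) (simp add: algebra_simps)
    then show "\<bar>\<alpha> n - \<alpha> m\<bar> \<le> 1 / real n + 1 / real m + e" by (simp add: k_def)
  qed
  have "Cauchy \<alpha>"
  proof (rule metric_CauchyI)
    fix e :: real assume "e > 0"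
    then obtain M where M: "1 / real (Suc M) < e / 2" using reals_Archimedean[of "e / 2"] by (auto simp: field_simps)
    have "dist (\<alpha> m) (\<alpha> n) < e" if "m \<ge> Suc M" "n \<ge> Suc M" for m n
    proof -
      have "1 / real m \<le> 1 / real (Suc M)" "1 / real n \<le> 1 / real (Suc M)"
        using that by (auto simp: frac_le)
      with close[of m n] M that show ?thesis unfolding dist_real_def by auto
    qed
    then show "\<exists>M. \<forall>m\<ge>M. \<forall>n\<ge>M. dist (\<alpha> m) (\<alpha> n) < e" by blast
  qed
  then obtain \<rho> where \<rho>: "\<alpha> \<longlonglongrightarrow> \<rho>" using Cauchy_convergent convergent_def by blast
  have "has_rotation f \<rho>"
    unfolding has_rotation_def
  proof (intro allI impI)
    fix e :: real assume e: "e > 0"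
    obtain n where n: "n > 0" "1 / real n < e / 4" "\<bar>\<alpha> n - \<rho>\<bar> < e / 4"
    proof -
      obtain M where M: "1 / real (Suc M) < e / 4" using reals_Archimedean[of "e / 4"] e by (auto simp: field_simps)
      obtain M' where M': "\<And>n. n \<ge> M' \<Longrightarrow> \<bar>\<alpha> n - \<rho>\<bar> < e / 4"
        using LIMSEQ_D[OF \<rho>, of "e / 4"] e by auto
      have "1 / real (Suc (max M M')) \<le> 1 / real (Suc M)" by (auto simp: frac_le)
      with M show thesis by (intro that[of "Suc (max M M')"] M') auto
    qed
    obtain N where N: "\<And>k x. k \<ge> N \<Longrightarrow> \<bar>orbit g f k x 0 - real k * \<alpha> n\<bar> \<le> (1 / real n + e / 4) * real k"
      using orbit_average[OF f n(1), of "e / 4"] e unfolding \<alpha>_def by auto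
    have "e / 4 > 0" using e by simp
    from reals_Archimedean3[OF this] obtain N' where N': "1 < real N' * (e / 4)" by blast
    show "\<exists>N. \<forall>n\<ge>N. \<forall>x w. \<bar>orbit g f n x w - w - real n * \<rho>\<bar> \<le> e * real n"
    proof (intro exI[of _ "max N N'"] allI impI)
      fix k x w assume k: "k \<ge> max N N'"
      have "real N' * (e / 4) \<le> real k * (e / 4)" using k e by (intro mult_right_mono) auto
      with N' have "1 \<le> real k * (e / 4)" by linarith
      moreover have "\<bar>real k * \<alpha> n - real k * \<rho>\<bar> \<le> real k * (e / 4)"
        using n(3) by (simp only: abs_mult abs_of_nat flip: right_diff_distrib) (intro mult_left_mono, auto)
      moreover have "\<bar>orbit g f k x 0 - real k * \<alpha> n\<bar> \<le> real k * (e / 4) + real k * (e / 4)"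
      proof -
        have "(1 / real n + e / 4) * real k \<le> (e / 4 + e / 4) * real k"
          using n(2) by (intro mult_right_mono) auto
        with N[of k x] k show ?thesis by (simp add: algebra_simps)
      qed
      moreover have "\<bar>(orbit g f k x w - w) - (orbit g f k x 0 - 0)\<bar> \<le> 1"
        by (rule orbit_displacement[OF f])
      ultimately have "\<bar>orbit g f k x w - w - real k * \<rho>\<bar> \<le> 4 * (real k * (e / 4))" by linarith
      then show "\<bar>orbit g f k x w - w - real k * \<rho>\<bar> \<le> e * real k" by (simp add: mult.commute)
    qed
  qed
  then show ?thesis by blast
qed

lemma has_rotation_mono:
  assumes "has_rotation f \<rho>" "has_rotation f' \<rho>'" and f: "fibre_lift f" and le: "\<And>x w. f x w \<le> f' x w"
  shows "\<rho> \<le> \<rho>'"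
proof (rule field_le_epsilon)
  fix e :: real assume e: "e > 0"
  obtain N where N: "\<And>n x w. n \<ge> N \<Longrightarrow> \<bar>orbit g f n x w - w - real n * \<rho>\<bar> \<le> e / 2 * real n"
    using assms(1) e unfolding has_rotation_def by (metis half_gt_zero)
  obtain N' where N': "\<And>n x w. n \<ge> N' \<Longrightarrow> \<bar>orbit g f' n x w - w - real n * \<rho>'\<bar> \<le> e / 2 * real n"
    using assms(2) e unfolding has_rotation_def by (metis half_gt_zero)
  define n where "n = Suc (max N N')"
  have "\<bar>orbit g f n undefined 0 - 0 - real n * \<rho>\<bar> \<le> e / 2 * real n"
      "\<bar>orbit g f' n undefined 0 - 0 - real n * \<rho>'\<bar> \<le> e / 2 * real n"
    by (rule N N', simp add: n_def)+
  moreover have "orbit g f n undefined 0 \<le> orbit g f' n undefined 0"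
    by (rule orbit_mono_map[OF f le])
  ultimately have "real n * \<rho> \<le> real n * \<rho>' + 2 * (e / 2 * real n)" by linarith
  then have "real n * \<rho> \<le> real n * (\<rho>' + e)" by (simp add: algebra_simps)
  then show "\<rho> \<le> \<rho>' + e" by (simp add: n_def)
qed

end

section \<open>Twisting by a circle-valued function\<close>

text \<open>If \<open>\<psi> (g x) - \<psi> x = \<phi> x\<close> modulo one, then this is, up to an integer depending on \<open>x\<close>, the conjugate
of \<open>f\<close> by the fibrewise rotation \<open>w \<mapsto> w + \<psi> x\<close>. It is continuous in \<open>x\<close> although \<open>rep_circle (\<psi> x)\<close> is
not, because \<open>f x w - w\<close> is periodic in \<open>w\<close>.\<close>

definition twist :: "('a \<Rightarrow> circle) \<Rightarrow> ('a \<Rightarrow> real) \<Rightarrow> ('a \<Rightarrow> real \<Rightarrow> real) \<Rightarrow> 'a \<Rightarrow> real \<Rightarrow> real"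
  where "twist \<psi> \<phi> f x w = f x (w + rep_circle (\<psi> x)) - rep_circle (\<psi> x) - \<phi> x"

lemma continuous_circle_add:
  fixes a b :: "'b::metric_space \<Rightarrow> circle"
  assumes ab: "continuous_on S a" "continuous_on S b"
  shows "continuous_on S (\<lambda>z. a z + b z)"
  unfolding continuous_on_iff
proof (intro ballI allI impI)
  fix z and e :: real assume z: "z \<in> S" and e: "e > 0"
  obtain d where d: "d > 0" "\<And>z'. z' \<in> S \<Longrightarrow> dist z' z < d \<Longrightarrow> dist (a z') (a z) < e / 2"
    using ab(1) z e unfolding continuous_on_iff by (metis half_gt_zero)
  obtain d' where d': "d' > 0" "\<And>z'. z' \<in> S \<Longrightarrow> dist z' z < d' \<Longrightarrow> dist (b z') (b z) < e / 2"
    using ab(2) z e unfolding continuous_on_iff by (metis half_gt_zero)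
  have "dist (p + q) (p' + q') \<le> dist p p' + dist q q'" for p p' q q' :: circle
  proof -
    obtain y where y: "to_circle y = p'" "dist (to_circle (rep_circle p)) p' = \<bar>rep_circle p - y\<bar>"
      by (rule dist_to_circle_attained)
    obtain v where v: "to_circle v = q'" "dist (to_circle (rep_circle q)) q' = \<bar>rep_circle q - v\<bar>"
      by (rule dist_to_circle_attained)
    have "dist (to_circle (rep_circle p + rep_circle q)) (to_circle (y + v)) \<le> \<bar>(rep_circle p + rep_circle q) - (y + v)\<bar>"
      by (rule dist_to_circle_le)
    then have "dist (p + q) (p' + q') \<le> \<bar>(rep_circle p + rep_circle q) - (y + v)\<bar>"
      unfolding plus_circle.abs_eq[symmetric] y(1) v(1) to_circle_rep .
    with y(2) v(2) show ?thesis by simp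
  qed
  then have sub: "dist (a z' + b z') (a z + b z) \<le> dist (a z') (a z) + dist (b z') (b z)" for z' .
  have "dist (a z' + b z') (a z + b z) < e" if "z' \<in> S" "dist z' z < min d d'" for z'
  proof -
    have "dist z' z < d" "dist z' z < d'" using that(2) by auto
    from d(2)[OF that(1) this(1)] d'(2)[OF that(1) this(2)] sub[of z'] show ?thesis by linarith
  qed
  with d(1) d'(1) show "\<exists>d>0. \<forall>z'\<in>S. dist z' z < d \<longrightarrow> dist (a z' + b z') (a z + b z) < e"
    by (intro exI[of _ "min d d'"]) auto
qed

lemma periodic_twist_continuous:
  fixes k :: "'a::metric_space \<Rightarrow> real \<Rightarrow> real"
  assumes k: "continuous_on UNIV (\<lambda>(x, w). k x w)" and per: "\<And>x w v. w - v \<in> \<int> \<Longrightarrow> k x w = k x v"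
    and \<psi>: "continuous_on UNIV \<psi>"
  shows "continuous_on UNIV (\<lambda>(x, w). k x (w + rep_circle (\<psi> x)))"
proof -
  have eq: "k x (w + rep_circle (\<psi> x)) = k x (rep_circle (to_circle w + \<psi> x))" for x w
  proof -
    have "to_circle (w + rep_circle (\<psi> x)) = to_circle (rep_circle (to_circle w + \<psi> x))"
      by (simp only: plus_circle.abs_eq[symmetric] to_circle_rep)
    then show ?thesis by (intro per) (simp only: to_circle_eq_iff)
  qed
  show ?thesis
    unfolding eq case_prod_beta
    by (intro periodic_descends_continuous[OF k per] continuous_circle_add continuous_to_circle continuous_intros
        continuous_on_compose2[OF \<psi>]) auto
qed

lemma fibre_lift_twist:
  assumes f: "fibre_lift f" and \<psi>: "continuous_on UNIV \<psi>" and \<phi>: "continuous_on UNIV \<phi>"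
  shows "fibre_lift (twist \<psi> \<phi> f)"
  unfolding fibre_lift_def
proof (intro conjI allI)
  define k where "k x w = f x w - w" for x w
  have per: "k x w = k x v" if "w - v \<in> \<int>" for x w v
  proof -
    obtain m where "w - v = of_int m" using \<open>w - v \<in> \<int>\<close> by (rule Ints_cases)
    then have w: "w = v + of_int m" by simp
    show ?thesis unfolding k_def w fibre_lift_int[OF f] by simp
  qed
  have "continuous_on UNIV (\<lambda>(x, w). k x w)"
    unfolding k_def case_prod_beta by (intro continuous_intros fibre_lift_continuous[OF f])
  note cont = periodic_twist_continuous[OF this per \<psi>]
  have eq: "twist \<psi> \<phi> f x w = k x (w + rep_circle (\<psi> x)) + (w - \<phi> x)" for x w
    by (simp add: twist_def k_def)
  show "continuous_on UNIV (\<lambda>(x, w). twist \<psi> \<phi> f x w)"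
    using cont unfolding eq case_prod_beta
    by (intro continuous_intros continuous_on_compose2[OF \<phi>]) auto
  show "strict_mono (twist \<psi> \<phi> f x)" for x
    using fibre_liftD(2)[OF f, of x] by (auto simp: strict_mono_def twist_def)
  show "twist \<psi> \<phi> f x (w + 1) = twist \<psi> \<phi> f x w + 1" for x w
    using fibre_liftD(3)[OF f, of x "w + rep_circle (\<psi> x)"] by (simp add: twist_def algebra_simps)
qed

lemma orbit_twist:
  assumes f: "fibre_lift f" and cocycle: "\<And>x. \<psi> (g x) - \<psi> x = to_circle (\<phi> x)"
  shows "orbit g (twist \<psi> \<phi> f) n x w =
    orbit g f n x (w + rep_circle (\<psi> x)) - rep_circle (\<psi> x) - (\<Sum>j<n. \<phi> ((g ^^ j) x))"
proof (induction n)
  case (Suc n)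
  let ?s = "\<Sum>j<n. \<phi> ((g ^^ j) x)" and ?y = "(g ^^ n) x" and ?O = "orbit g f n x (w + rep_circle (\<psi> x))"
  have \<psi>: "\<psi> ((g ^^ n) x) - \<psi> x = to_circle (\<Sum>j<n. \<phi> ((g ^^ j) x))"
  proof (induction n)
    case (Suc n)
    have "\<psi> ((g ^^ Suc n) x) - \<psi> x = to_circle (\<phi> ((g ^^ n) x)) + to_circle (\<Sum>j<n. \<phi> ((g ^^ j) x))"
      unfolding Suc[symmetric] cocycle[symmetric] by simp
    then show ?case by (simp add: plus_circle.abs_eq add.commute)
  qed (simp add: zero_circle_def)
  then have "\<psi> ?y = to_circle (?s + rep_circle (\<psi> x))"
    by (simp only: plus_circle.abs_eq[symmetric] to_circle_rep diff_eq_eq)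
  then have "rep_circle (\<psi> ?y) - (?s + rep_circle (\<psi> x)) \<in> \<int>"
    by (metis to_circle_eq_iff to_circle_rep)
  then obtain m where m: "rep_circle (\<psi> ?y) = ?s + rep_circle (\<psi> x) + of_int m"
    by (metis Ints_cases add.commute diff_add_cancel)
  have eq: "?O - rep_circle (\<psi> x) - ?s + rep_circle (\<psi> ?y) = ?O + of_int m" using m by simp
  then have "orbit g (twist \<psi> \<phi> f) (Suc n) x w = f ?y (?O + of_int m) - rep_circle (\<psi> ?y) - \<phi> ?y"
    by (simp only: orbit.simps Suc twist_def eq)
  also have "\<dots> = f ?y ?O + of_int m - rep_circle (\<psi> ?y) - \<phi> ?y" by (simp only: fibre_lift_int[OF f])
  finally show ?case using m by simp
qed simp

context compact_homeo
begin

lemma trapped_orbit_bounded: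
  assumes f: "fibre_lift f" and le: "\<And>x. p x \<le> q x"
    and p: "\<And>x. p (g x) \<le> f x (p x)" and q: "\<And>x. f x (q x) \<le> q (g x)"
    and C: "\<And>x. \<bar>p x\<bar> \<le> C" "\<And>x. \<bar>q x\<bar> \<le> C"
  shows "\<bar>orbit g f n x w - w\<bar> \<le> 2 * C + 1"
proof -
  have mono: "v \<le> w \<Longrightarrow> f x v \<le> f x w" for x v w
    using strict_mono_less_eq[OF fibre_liftD(2)[OF f]] by blast
  have "p ((g ^^ n) x) \<le> orbit g f n x (p x) \<and> orbit g f n x (p x) \<le> q ((g ^^ n) x)"
  proof (induction n)
    case (Suc n)
    then show ?case
      using p[of "(g ^^ n) x"] q[of "(g ^^ n) x"]
        mono[of "p ((g ^^ n) x)" "orbit g f n x (p x)" "(g ^^ n) x"]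
        mono[of "orbit g f n x (p x)" "q ((g ^^ n) x)" "(g ^^ n) x"]
      by auto
  qed (use le in auto)
  then show ?thesis
    using C[of "(g ^^ n) x"] C(1)[of x] orbit_displacement[OF f, of g n x w "p x"] by linarith
qed

text \<open>The strip between \<open>p\<close> and \<open>q\<close> is mapped into itself with room to spare, hence by all nearby maps
too. Their twisted orbits stay bounded, so orbits of nearby maps stay at a bounded distance from
those of \<open>f\<close>.\<close>

lemma trapped_mode_locked:
  assumes f: "fibre_lift f" and \<psi>: "continuous_on UNIV \<psi>" and \<phi>: "continuous_on UNIV \<phi>"
    and cocycle: "\<And>x. \<psi> (g x) - \<psi> x = to_circle (\<phi> x)"
    and p: "continuous_on UNIV p" and q: "continuous_on UNIV q" and le: "\<And>x. p x \<le> q x" and d: "d > 0"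
    and trap: "\<And>x. p (g x) + d \<le> twist \<psi> \<phi> f x (p x)" "\<And>x. twist \<psi> \<phi> f x (q x) \<le> q (g x) - d"
  shows "mode_locked g (circle_map g f)"
proof (rule mode_lockedI[OF f d])
  fix f1 x w assume f1: "fibre_lift f1" and near: "\<And>x w. \<bar>f1 x w - f x w\<bar> < d"
  obtain P where P: "P \<ge> 0" "\<And>x. \<bar>p x\<bar> \<le> P" using continuous_real_bounded[OF p] by blast
  obtain Q where Q: "Q \<ge> 0" "\<And>x. \<bar>q x\<bar> \<le> Q" using continuous_real_bounded[OF q] by blast
  let ?v = "w - rep_circle (\<psi> x)"
  have bound: "\<bar>p x\<bar> \<le> P + Q" "\<bar>q x\<bar> \<le> P + Q" for x
    using P(2)[of x] Q(2)[of x] P(1) Q(1) by auto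
  have A: "\<bar>orbit g (twist \<psi> \<phi> f) n x ?v - ?v\<bar> \<le> 2 * (P + Q) + 1" for n
  proof (rule trapped_orbit_bounded[OF fibre_lift_twist[OF f \<psi> \<phi>] le _ _ bound])
    show "p (g x) \<le> twist \<psi> \<phi> f x (p x)" "twist \<psi> \<phi> f x (q x) \<le> q (g x)" for x
      using trap(1)[of x] trap(2)[of x] d by linarith+
  qed
  have B: "\<bar>orbit g (twist \<psi> \<phi> f1) n x ?v - ?v\<bar> \<le> 2 * (P + Q) + 1" for n
  proof (rule trapped_orbit_bounded[OF fibre_lift_twist[OF f1 \<psi> \<phi>] le _ _ bound])
    fix x
    have "\<bar>twist \<psi> \<phi> f1 x w - twist \<psi> \<phi> f x w\<bar> < d" for w
      using near[of x "w + rep_circle (\<psi> x)"] by (simp add: twist_def)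
    from this[of "p x"] this[of "q x"]
    show "p (g x) \<le> twist \<psi> \<phi> f1 x (p x)" "twist \<psi> \<phi> f1 x (q x) \<le> q (g x)"
      using trap(1)[of x] trap(2)[of x] by linarith+
  qed
  have "\<bar>orbit g f1 n x w - orbit g f n x w\<bar> \<le> 4 * (P + Q) + 2" for n
    using A[of n] B[of n] unfolding orbit_twist[where g = g and \<psi> = \<psi> and \<phi> = \<phi>, OF f cocycle]
      orbit_twist[where g = g and \<psi> = \<psi> and \<phi> = \<phi>, OF f1 cocycle] by simp
  then have bound: "norm ((orbit g f1 n x w - orbit g f n x w) / real n) \<le> norm ((4 * (P + Q) + 2) / real n) * 1" for n
    using P(1) Q(1) by (simp add: divide_right_mono abs_divide)
  show "(\<lambda>n. (orbit g f1 n x w - orbit g f n x w) / real n) \<longlonglongrightarrow> 0"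
  proof (rule tendsto_0_le[OF lim_const_over_n])
    show "\<forall>\<^sub>F n in sequentially. norm ((orbit g f1 n x w - orbit g f n x w) / real n) \<le> norm ((4 * (P + Q) + 2) / real n) * 1"
      by (intro always_eventually allI bound)
  qed
qed

end

context unique_ergodic
begin

text \<open>This is how the Schwartzman range enters: the elements of the range are exactly the amounts by
which twisting can change the rotation number.\<close>

lemma has_rotation_twist:
  assumes f: "fibre_lift f" and \<phi>: "continuous_on UNIV \<phi>"
    and cocycle: "\<And>x. \<psi> (g x) - \<psi> x = to_circle (\<phi> x)" and rot: "has_rotation f \<rho>"
  shows "has_rotation (twist \<psi> \<phi> f) (\<rho> - (\<integral>x. \<phi> x \<partial>\<nu>))"
  unfolding has_rotation_def
proof (intro allI impI)
  fix e :: real assume e: "e > 0"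
  obtain N where N: "\<And>n x w. n \<ge> N \<Longrightarrow> \<bar>orbit g f n x w - w - real n * \<rho>\<bar> \<le> e / 2 * real n"
    using rot e unfolding has_rotation_def by (metis half_gt_zero)
  obtain N' where N': "\<And>n x. n \<ge> N' \<Longrightarrow> \<bar>(\<Sum>j<n. \<phi> ((g ^^ j) x)) - real n * (\<integral>x. \<phi> x \<partial>\<nu>)\<bar> \<le> e / 2 * real n"
    using birkhoff[OF \<phi>, of "e / 2"] e by auto
  show "\<exists>N. \<forall>n\<ge>N. \<forall>x w. \<bar>orbit g (twist \<psi> \<phi> f) n x w - w - real n * (\<rho> - (\<integral>x. \<phi> x \<partial>\<nu>))\<bar> \<le> e * real n"
  proof (intro exI[of _ "max N N'"] allI impI)
    fix n x w assume n: "n \<ge> max N N'"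
    have "\<bar>orbit g f n x (w + rep_circle (\<psi> x)) - (w + rep_circle (\<psi> x)) - real n * \<rho>\<bar> \<le> e / 2 * real n"
      by (rule N) (use n in simp)
    moreover have "\<bar>(\<Sum>j<n. \<phi> ((g ^^ j) x)) - real n * (\<integral>x. \<phi> x \<partial>\<nu>)\<bar> \<le> e / 2 * real n"
      by (rule N') (use n in simp)
    ultimately show "\<bar>orbit g (twist \<psi> \<phi> f) n x w - w - real n * (\<rho> - (\<integral>x. \<phi> x \<partial>\<nu>))\<bar> \<le> e * real n"
      unfolding orbit_twist[where g = g and \<psi> = \<psi> and \<phi> = \<phi>, OF f cocycle] right_diff_distrib by linarith
  qed
qed

lemma mode_locked_or_almost_invariant_section:
  assumes dense: "closure (schwartzman_range g \<nu>) = UNIV" and f: "fibre_lift f" and e: "e > 0"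
  obtains "mode_locked g (circle_map g f)"
  | \<psi> \<phi> u where "continuous_on UNIV \<psi>" "continuous_on UNIV \<phi>" "\<And>x. \<psi> (g x) - \<psi> x = to_circle (\<phi> x)"
      "continuous_on UNIV u" "\<And>x. \<bar>twist \<psi> \<phi> f x (u x) - u (g x)\<bar> \<le> e"
proof -
  let ?m = "\<lambda>x w. f x w - e" and ?p = "\<lambda>x w. f x w + e"
  have m: "fibre_lift ?m" and p: "fibre_lift ?p"
    using fibre_lift_shift[OF f, of "\<lambda>_. - e"] fibre_lift_shift[OF f, of "\<lambda>_. e"] by auto
  obtain \<rho> \<rho>' where \<rho>: "has_rotation ?m \<rho>" and \<rho>': "has_rotation ?p \<rho>'"
    using has_rotation_exists[OF m] has_rotation_exists[OF p] by blast
  have "\<rho> \<le> \<rho>'" by (rule has_rotation_mono[OF \<rho> \<rho>' m]) (use e in simp)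
  show thesis
  proof (cases "\<rho> = \<rho>'")
    case True
    then show thesis using equal_rotation_mode_locked[OF f e] \<rho> \<rho>' that(1) by blast
  next
    case False
    then have "\<rho> < \<rho>'" using \<open>\<rho> \<le> \<rho>'\<close> by simp
    have "(\<rho> + \<rho>') / 2 \<in> closure (schwartzman_range g \<nu>)" using dense by simp
    then obtain c where c: "c \<in> schwartzman_range g \<nu>" "dist c ((\<rho> + \<rho>') / 2) < (\<rho>' - \<rho>) / 2"
      unfolding closure_approachable using \<open>\<rho> < \<rho>'\<close> by (metis diff_gt_0_iff_gt half_gt_zero)
    have "\<rho> < c \<and> c < \<rho>'" using c(2) \<open>\<rho> < \<rho>'\<close> unfolding dist_real_def abs_less_iff by (simp add: field_simps)
    then have between: "\<rho> < c" "c < \<rho>'" by auto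
    obtain \<phi> \<psi> where \<phi>: "continuous_on UNIV \<phi>" and \<psi>: "continuous_on UNIV \<psi>"
        and c_eq: "c = (\<integral>x. \<phi> x \<partial>\<nu>)" and cocycle: "\<And>x. \<psi> (g x) - \<psi> x = to_circle (\<phi> x)"
      using c(1) unfolding schwartzman_range_def by blast
    define \<kappa> where "\<kappa> = min (\<rho>' - c) (c - \<rho>) / 2"
    have \<kappa>: "\<kappa> > 0" "2 * \<kappa> \<le> \<rho>' - c" "2 * \<kappa> \<le> c - \<rho>" using between by (auto simp: \<kappa>_def)
    note rot = has_rotation_twist[OF m \<phi> cocycle \<rho>] has_rotation_twist[OF p \<phi> cocycle \<rho>']
    obtain N where N: "\<And>n x w. n \<ge> N \<Longrightarrow> \<bar>orbit g (twist \<psi> \<phi> ?m) n x w - w - real n * (\<rho> - c)\<bar> \<le> \<kappa> * real n"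
      using rot(1) \<kappa>(1) unfolding has_rotation_def c_eq by metis
    obtain N' where N': "\<And>n x w. n \<ge> N' \<Longrightarrow> \<bar>orbit g (twist \<psi> \<phi> ?p) n x w - w - real n * (\<rho>' - c)\<bar> \<le> \<kappa> * real n"
      using rot(2) \<kappa>(1) unfolding has_rotation_def c_eq by metis
    have up: "\<kappa> * real n \<le> orbit g (twist \<psi> \<phi> ?p) n x 0" if "n \<ge> max N N'" for n x
    proof -
      have "real n * (2 * \<kappa>) \<le> real n * (\<rho>' - c)" by (intro mult_left_mono \<kappa>) auto
      moreover have "\<bar>orbit g (twist \<psi> \<phi> ?p) n x 0 - 0 - real n * (\<rho>' - c)\<bar> \<le> \<kappa> * real n"
        by (rule N') (use that in simp)
      moreover have "real n * (2 * \<kappa>) = 2 * (\<kappa> * real n)" by simp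
      ultimately show ?thesis by linarith
    qed
    have down: "orbit g (twist \<psi> \<phi> ?m) n x 0 \<le> - (\<kappa> * real n)" if "n \<ge> max N N'" for n x
    proof -
      have "real n * (2 * \<kappa>) \<le> real n * (c - \<rho>)" by (intro mult_left_mono \<kappa>) auto
      moreover have "\<bar>orbit g (twist \<psi> \<phi> ?m) n x 0 - 0 - real n * (\<rho> - c)\<bar> \<le> \<kappa> * real n"
        by (rule N) (use that in simp)
      moreover have "real n * (2 * \<kappa>) = 2 * (\<kappa> * real n)" by simp
      moreover have "real n * (c - \<rho>) = - (real n * (\<rho> - c))" by (simp add: algebra_simps)
      ultimately show ?thesis by linarith
    qed
    have le: "twist \<psi> \<phi> ?m x w \<le> twist \<psi> \<phi> ?p x w" for x w using e by (simp add: twist_def)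
    obtain u where u: "continuous_on UNIV u" "\<And>x. twist \<psi> \<phi> ?m x (u x) \<le> u (g x)"
        "\<And>x. u (g x) \<le> twist \<psi> \<phi> ?p x (u x)"
      using pseudo_invariant_section[OF fibre_lift_twist[OF m \<psi> \<phi>] fibre_lift_twist[OF p \<psi> \<phi>] le \<kappa>(1) up down]
      by blast
    have "\<bar>twist \<psi> \<phi> f x (u x) - u (g x)\<bar> \<le> e" for x
      using u(2,3)[of x] by (simp add: twist_def abs_le_iff)
    with \<psi> \<phi> cocycle u(1) show thesis by (rule that(2))
  qed
qed

end

section \<open>Hyperbolic invariant sections are locked\<close>

context unique_ergodic
begin

text \<open>The Birkhoff average of \<open>D\<close> over a long time is uniformly close to its integral, and it differs
from \<open>D\<close> by the coboundary of an average of partial Birkhoff sums.\<close>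

lemma cohomologous_to_almost_constant:
  fixes D :: "'a \<Rightarrow> real"
  assumes D: "continuous_on UNIV D" and e: "e > 0"
  obtains B where "continuous_on UNIV B" "\<And>x. \<bar>D x + B (g x) - B x - (\<integral>x. D x \<partial>\<nu>)\<bar> \<le> e"
proof -
  obtain N where N: "\<And>n x. n \<ge> N \<Longrightarrow> \<bar>(\<Sum>j<n. D ((g ^^ j) x)) - real n * (\<integral>y. D y \<partial>\<nu>)\<bar> \<le> e * real n"
    using birkhoff[OF D e] by blast
  define n where "n = Suc N"
  define B where "B x = (\<Sum>j<n. \<Sum>i<j. D ((g ^^ i) x)) / real n" for x
  have "continuous_on UNIV (\<lambda>x. D ((g ^^ i) x))" for i
    by (rule continuous_on_compose2[OF D continuous_on_funpow[OF g_continuous]]) auto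
  then have "continuous_on UNIV B"
    unfolding B_def n_def by (intro continuous_intros) auto
  moreover have "\<bar>D x + B (g x) - B x - (\<integral>x. D x \<partial>\<nu>)\<bar> \<le> e" for x
  proof -
    let ?d = "\<lambda>i. D ((g ^^ i) x)"
    have "(\<Sum>i<j. D ((g ^^ i) (g x))) - (\<Sum>i<j. ?d i) = ?d j - D x" for j
    proof -
      have "(\<Sum>i<j. D ((g ^^ i) (g x))) - (\<Sum>i<j. ?d i) = (\<Sum>i<j. ?d (Suc i) - ?d i)"
        by (simp add: sum_subtractf funpow_swap1)
      also have "\<dots> = ?d j - ?d 0" by (rule sum_lessThan_telescope[of ?d j])
      finally show ?thesis by simp
    qed
    then have "B (g x) - B x = (\<Sum>j<n. ?d j - D x) / real n"
      unfolding B_def by (simp flip: diff_divide_distrib sum_subtractf)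
    then have "D x + B (g x) - B x - (\<integral>x. D x \<partial>\<nu>) = ((\<Sum>j<n. ?d j) - real n * (\<integral>x. D x \<partial>\<nu>)) / real n"
      by (simp add: sum_subtractf n_def field_simps)
    moreover have "\<bar>(\<Sum>j<n. ?d j) - real n * (\<integral>x. D x \<partial>\<nu>)\<bar> / real n \<le> e"
      using N[of n x] by (simp add: n_def divide_le_eq)
    ultimately show ?thesis by (simp add: n_def)
  qed
  ultimately show thesis by (rule that)
qed

text \<open>After a change of scale in the fibres by the factor \<open>r = exp (- B)\<close>, with \<open>B\<close> from the previous
lemma, the map stretches short intervals at the section by a factor close to
\<open>exp \<Lambda>\<close>. If \<open>\<Lambda> < 0\<close>, a thin strip around the section is mapped into its interior. If \<open>\<Lambda> > 0\<close>, the
strip expands, and the complementary strip, from just above \<open>u\<close> to just below \<open>u + 1\<close>, is mapped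
into its interior.\<close>

lemma hyperbolic_section_trap:
  assumes F': "\<And>x w. (F x has_field_derivative F' x w) (at w)"
      "continuous_on UNIV (\<lambda>(x, w). F' x w)" "\<And>x w. F' x w > 0"
    and step: "\<And>x w. F x (w + 1) = F x w + 1"
    and u: "continuous_on UNIV u" and invariant: "\<And>x. F x (u x) = u (g x)"
    and hyperbolic: "(\<integral>x. ln (F' x (u x)) \<partial>\<nu>) \<noteq> 0"
  obtains p q and d :: real where "continuous_on UNIV p" "continuous_on UNIV q" "\<And>x. p x \<le> q x" "d > 0"
    "\<And>x. p (g x) + d \<le> F x (p x)" "\<And>x. F x (q x) \<le> q (g x) - d"
proof -
  define \<Lambda> where "\<Lambda> = (\<integral>x. ln (F' x (u x)) \<partial>\<nu>)"
  define e where "e = \<bar>\<Lambda>\<bar> / 4"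
  have e: "e > 0" using hyperbolic by (simp add: e_def \<Lambda>_def)
  have L_cont: "continuous_on S (\<lambda>z. ln (F' (a z) (b z)))" if "continuous_on S a" "continuous_on S b"
    for S and a :: "'b::topological_space \<Rightarrow> 'a" and b
  proof -
    have "continuous_on S (\<lambda>z. case (a z, b z) of (x, w) \<Rightarrow> F' x w)"
      by (rule continuous_on_compose2[OF F'(2) continuous_on_Pair[OF that]]) auto
    then show ?thesis using F'(3) by (intro continuous_on_ln) (auto simp: less_imp_neq[symmetric])
  qed
  have "continuous_on UNIV (\<lambda>x. ln (F' x (u x)))" by (rule L_cont[OF continuous_on_id u])
  then obtain B where B: "continuous_on UNIV B" "\<And>x. \<bar>ln (F' x (u x)) + B (g x) - B x - \<Lambda>\<bar> \<le> e"
    unfolding \<Lambda>_def using cohomologous_to_almost_constant e by blast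
  obtain Bmax where Bmax: "\<And>x. \<bar>B x\<bar> \<le> Bmax" using continuous_real_bounded[OF B(1)] by blast
  define r where "r x = exp (- B x)" for x
  have r: "continuous_on UNIV r" "r x > 0" "exp (- Bmax) \<le> r x" "r x \<le> exp Bmax" for x
    using Bmax[of x] unfolding r_def by (auto intro!: continuous_intros B(1) simp: abs_le_iff)
  obtain s0 where s0: "s0 > 0" "s0 \<le> 1"
    "\<And>x h. \<bar>h\<bar> < s0 \<Longrightarrow> \<bar>ln (F' x (u x + h)) - ln (F' x (u x))\<bar> \<le> e"
  proof -
    have "continuous_on (UNIV \<times> {-1..1}) (\<lambda>z. ln (F' (fst z) (u (fst z) + snd z)))"
      by (intro L_cont continuous_intros continuous_on_compose2[OF u]) auto
    moreover have "compact ((UNIV :: 'a set) \<times> {-1..1::real})"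
      by (intro compact_Times compact_space) simp
    ultimately have "uniformly_continuous_on (UNIV \<times> {-1..1}) (\<lambda>z. ln (F' (fst z) (u (fst z) + snd z)))"
      by (rule compact_uniformly_continuous)
    then obtain s where s: "s > 0" "\<And>z z'. z \<in> UNIV \<times> {-1..1} \<Longrightarrow> z' \<in> UNIV \<times> {-1..1} \<Longrightarrow> dist z' z < s \<Longrightarrow>
        dist (ln (F' (fst z') (u (fst z') + snd z'))) (ln (F' (fst z) (u (fst z) + snd z))) < e"
      using e unfolding uniformly_continuous_on_def by metis
    show thesis
    proof (rule that[of "min s 1"])
      fix x h assume h: "\<bar>h\<bar> < min s 1"
      then have "-1 \<le> h" "h \<le> 1" by linarith+
      then show "\<bar>ln (F' x (u x + h)) - ln (F' x (u x))\<bar> \<le> e"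
        using s(2)[of "(x, 0)" "(x, h)"] h by (simp add: dist_Pair_Pair dist_real_def)
    qed (use s(1) in auto)
  qed
  define s where "s = s0 / 2 * exp (- Bmax)"
  have s: "s > 0" "s * r x < s0" "2 * (s * r x) \<le> 1" for x
  proof -
    show "s > 0" using s0(1) by (simp add: s_def)
    have "exp (- Bmax) * r x \<le> exp (- Bmax) * exp Bmax" using r(4) by (intro mult_left_mono) auto
    also have "\<dots> = 1" by (simp flip: exp_add)
    finally have "s0 / 2 * (exp (- Bmax) * r x) \<le> s0 / 2 * 1" using s0(1) by (intro mult_left_mono) auto
    then have "s * r x \<le> s0 / 2" by (simp add: s_def mult.assoc)
    then show "s * r x < s0" "2 * (s * r x) \<le> 1" using s0(1,2) by linarith+
  qed
  \<comment> \<open>By the mean value theorem; \<open>\<kappa>\<close> is the logarithm of the stretching factor measured in the new scale.\<close>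
  have displace: "\<exists>\<kappa>. \<bar>\<kappa> - \<Lambda>\<bar> \<le> 2 * e \<and> F x (u x + \<sigma> * (s * r x)) = u (g x) + \<sigma> * (s * r (g x) * exp \<kappa>)"
    if \<sigma>: "\<bar>\<sigma>\<bar> = 1" for x \<sigma>
  proof -
    let ?h = "\<sigma> * (s * r x)"
    have h: "\<bar>?h\<bar> < s0" "?h \<noteq> 0" using s(1) s(2)[of x] r(2)[of x] \<sigma> by (auto simp: abs_mult)
    obtain \<xi> where \<xi>: "\<bar>\<xi>\<bar> \<le> \<bar>?h\<bar>" "F x (u x + ?h) - F x (u x) = ?h * F' x (u x + \<xi>)"
    proof (cases "?h > 0")
      case True
      obtain z where z: "z > u x" "z < u x + ?h" "F x (u x + ?h) - F x (u x) = (u x + ?h - u x) * F' x z"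
        using MVT2[of "u x" "u x + ?h" "F x" "F' x"] True F'(1) by auto
      show thesis by (rule that[of "z - u x"]) (use z True in auto)
    next
      case False
      then have neg: "?h < 0" using h(2) by linarith
      obtain z where z: "z > u x + ?h" "z < u x" "F x (u x) - F x (u x + ?h) = (u x - (u x + ?h)) * F' x z"
        using MVT2[of "u x + ?h" "u x" "F x" "F' x"] neg F'(1) by auto
      show thesis by (rule that[of "z - u x"]) (use z neg in auto)
    qed
    define \<kappa> where "\<kappa> = ln (F' x (u x + \<xi>)) - B x + B (g x)"
    have "\<bar>ln (F' x (u x + \<xi>)) - ln (F' x (u x))\<bar> \<le> e" using \<xi>(1) h(1) by (intro s0(3)) linarith
    then have "\<bar>\<kappa> - \<Lambda>\<bar> \<le> 2 * e" using B(2)[of x] unfolding \<kappa>_def by linarith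
    moreover have "r x * F' x (u x + \<xi>) = r (g x) * exp \<kappa>"
    proof -
      have "r (g x) * exp \<kappa> = exp (- B x + ln (F' x (u x + \<xi>)))" by (simp add: r_def \<kappa>_def flip: exp_add)
      also have "\<dots> = r x * F' x (u x + \<xi>)" unfolding exp_add r_def using F'(3) by simp
      finally show ?thesis by simp
    qed
    then have "?h * F' x (u x + \<xi>) = \<sigma> * (s * r (g x) * exp \<kappa>)" by (simp only: mult.assoc)
    ultimately show ?thesis using \<xi>(2) invariant[of x] by (intro exI[of _ \<kappa>] conjI) linarith+
  qed
  have cont: "continuous_on UNIV (\<lambda>x. u x + \<sigma> * (s * r x))" for \<sigma>
    by (intro continuous_intros u r(1))
  show thesis
  proof (cases "\<Lambda> < 0")
    case True
    define d where "d = s * exp (- Bmax) * (1 - exp (\<Lambda> / 2))"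
    have "s * r (g x) * exp \<kappa> \<le> s * r (g x) - d" if "\<bar>\<kappa> - \<Lambda>\<bar> \<le> 2 * e" for x \<kappa>
    proof -
      have "\<kappa> \<le> \<Lambda> / 2" using that True by (simp add: e_def)
      then have "s * r (g x) * exp \<kappa> \<le> s * r (g x) * exp (\<Lambda> / 2)"
        using s(1) r(2)[of "g x"] by (intro mult_left_mono) auto
      moreover have "d \<le> s * r (g x) * (1 - exp (\<Lambda> / 2))"
        unfolding d_def using s(1) r(3)[of "g x"] True by (intro mult_right_mono mult_left_mono) auto
      ultimately show ?thesis by (simp add: right_diff_distrib)
    qed
    note contract = this
    show thesis
    proof (rule that[of "\<lambda>x. u x + (- 1) * (s * r x)" "\<lambda>x. u x + 1 * (s * r x)" d, OF cont cont])
      show "d > 0" using s(1) True by (simp add: d_def)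
      show "u x + (- 1) * (s * r x) \<le> u x + 1 * (s * r x)" for x using s(1) r(2)[of x] by simp
      show "u (g x) + (- 1) * (s * r (g x)) + d \<le> F x (u x + (- 1) * (s * r x))" for x
      proof -
        obtain \<kappa> where \<kappa>: "\<bar>\<kappa> - \<Lambda>\<bar> \<le> 2 * e"
            "F x (u x + (- 1) * (s * r x)) = u (g x) + (- 1) * (s * r (g x) * exp \<kappa>)"
          using displace[of "-1" x] by auto
        show ?thesis unfolding \<kappa>(2) using contract[OF \<kappa>(1), of x] by linarith
      qed
      show "F x (u x + 1 * (s * r x)) \<le> u (g x) + 1 * (s * r (g x)) - d" for x
      proof -
        obtain \<kappa> where \<kappa>: "\<bar>\<kappa> - \<Lambda>\<bar> \<le> 2 * e"
            "F x (u x + 1 * (s * r x)) = u (g x) + 1 * (s * r (g x) * exp \<kappa>)"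
          using displace[of 1 x] by auto
        show ?thesis unfolding \<kappa>(2) using contract[OF \<kappa>(1), of x] by linarith
      qed
    qed
  next
    case False
    then have pos: "\<Lambda> > 0" using hyperbolic by (simp add: \<Lambda>_def)
    define d where "d = s * exp (- Bmax) * (exp (\<Lambda> / 2) - 1)"
    have "s * r (g x) + d \<le> s * r (g x) * exp \<kappa>" if "\<bar>\<kappa> - \<Lambda>\<bar> \<le> 2 * e" for x \<kappa>
    proof -
      have "\<Lambda> / 2 \<le> \<kappa>" using that pos unfolding e_def by linarith
      then have "s * r (g x) * exp (\<Lambda> / 2) \<le> s * r (g x) * exp \<kappa>"
        using s(1) r(2)[of "g x"] by (intro mult_left_mono) auto
      moreover have "d \<le> s * r (g x) * (exp (\<Lambda> / 2) - 1)"
        unfolding d_def using s(1) r(3)[of "g x"] pos by (intro mult_right_mono mult_left_mono) auto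
      ultimately show ?thesis by (simp add: right_diff_distrib)
    qed
    note expand = this
    show thesis
    proof (rule that[of "\<lambda>x. u x + 1 * (s * r x)" "\<lambda>x. u x + (- 1) * (s * r x) + 1" d, OF cont])
      show "continuous_on UNIV (\<lambda>x. u x + (- 1) * (s * r x) + 1)" by (intro continuous_on_add cont continuous_on_const)
      show "d > 0" using s(1) pos by (simp add: d_def)
      show "u x + 1 * (s * r x) \<le> u x + (- 1) * (s * r x) + 1" for x using s(3)[of x] by simp
      show "u (g x) + 1 * (s * r (g x)) + d \<le> F x (u x + 1 * (s * r x))" for x
      proof -
        obtain \<kappa> where \<kappa>: "\<bar>\<kappa> - \<Lambda>\<bar> \<le> 2 * e"
            "F x (u x + 1 * (s * r x)) = u (g x) + 1 * (s * r (g x) * exp \<kappa>)"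
          using displace[of 1 x] by auto
        show ?thesis unfolding \<kappa>(2) using expand[OF \<kappa>(1), of x] by linarith
      qed
      show "F x (u x + (- 1) * (s * r x) + 1) \<le> u (g x) + (- 1) * (s * r (g x)) + 1 - d" for x
      proof -
        obtain \<kappa> where \<kappa>: "\<bar>\<kappa> - \<Lambda>\<bar> \<le> 2 * e"
            "F x (u x + (- 1) * (s * r x)) = u (g x) + (- 1) * (s * r (g x) * exp \<kappa>)"
          using displace[of "-1" x] by auto
        show ?thesis unfolding step \<kappa>(2) using expand[OF \<kappa>(1), of x] by linarith
      qed
    qed
  qed
qed

lemma hyperbolic_section_mode_locked:
  assumes f: "fibre_lift f" and f': "\<And>x w. (f x has_field_derivative f' x w) (at w)"
      "continuous_on UNIV (\<lambda>(x, w). f' x w)" "\<And>x w. f' x w > 0"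
    and \<psi>: "continuous_on UNIV \<psi>" and \<phi>: "continuous_on UNIV \<phi>"
    and cocycle: "\<And>x. \<psi> (g x) - \<psi> x = to_circle (\<phi> x)"
    and u: "continuous_on UNIV u" and invariant: "\<And>x. twist \<psi> \<phi> f x (u x) = u (g x)"
    and hyperbolic: "(\<integral>x. ln (f' x (u x + rep_circle (\<psi> x))) \<partial>\<nu>) \<noteq> 0"
  shows "mode_locked g (circle_map g f)"
proof -
  let ?F = "twist \<psi> \<phi> f" and ?F' = "\<lambda>x w. f' x (w + rep_circle (\<psi> x))"
  have per: "f' x w = f' x v" if "w - v \<in> \<int>" for x w v
  proof -
    obtain m where "w - v = of_int m" using \<open>w - v \<in> \<int>\<close> by (rule Ints_cases)
    then have w: "w = v + of_int m" by simp
    have "((\<lambda>w. f x (w + of_int m)) has_field_derivative f' x w) (at v)"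
      using f'(1)[of x w] unfolding w DERIV_shift .
    moreover have "((\<lambda>w. f x w + of_int m) has_field_derivative f' x v) (at v)"
      using f'(1)[of x v] by (auto intro!: derivative_eq_intros)
    ultimately show ?thesis unfolding fibre_lift_int[OF f] by (rule DERIV_unique)
  qed
  have der: "(?F x has_field_derivative ?F' x w) (at w)" for x w
  proof -
    have "((\<lambda>w. f x (w + rep_circle (\<psi> x))) has_field_derivative ?F' x w) (at w)"
      using f'(1)[of x "w + rep_circle (\<psi> x)"] unfolding DERIV_shift .
    then have "((\<lambda>w. f x (w + rep_circle (\<psi> x)) - rep_circle (\<psi> x) - \<phi> x) has_field_derivative ?F' x w) (at w)"
      by (auto intro!: derivative_eq_intros)
    then show ?thesis by (simp add: twist_def[abs_def])
  qed
  obtain p q and d :: real where "continuous_on UNIV p" "continuous_on UNIV q" "\<And>x. p x \<le> q x" "d > 0"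
    "\<And>x. p (g x) + d \<le> ?F x (p x)" "\<And>x. ?F x (q x) \<le> q (g x) - d"
    using hyperbolic_section_trap[OF der periodic_twist_continuous[OF f'(2) per \<psi>] f'(3)
        fibre_liftD(3)[OF fibre_lift_twist[OF f \<psi> \<phi>]] u invariant hyperbolic] by metis
  then show ?thesis by (rule trapped_mode_locked[OF f \<psi> \<phi> cocycle])
qed

end

section \<open>Families of smooth fibre maps\<close>

text \<open>The functions \<open>f z\<close> have \<open>k\<close> derivatives which are jointly continuous in the parameter and the
variable. For periodic functions over a compact parameter space this is continuity into the \<open>C^k\<close>
topology. The recursive
form lets closure properties, in particular under passing to inverse functions, be proved by
induction without formulas for higher derivatives.\<close>

fun smooth_family :: "nat \<Rightarrow> 'z::metric_space set \<Rightarrow> ('z \<Rightarrow> real \<Rightarrow> real) \<Rightarrow> bool"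
  where
    "smooth_family 0 S f = continuous_on (S \<times> UNIV) (\<lambda>(z, w). f z w)"
  | "smooth_family (Suc k) S f = (continuous_on (S \<times> UNIV) (\<lambda>(z, w). f z w) \<and>
      (\<exists>f'. (\<forall>z\<in>S. \<forall>w. (f z has_field_derivative f' z w) (at w)) \<and> smooth_family k S f'))"

lemma smooth_family_continuous: "smooth_family k S f \<Longrightarrow> continuous_on (S \<times> UNIV) (\<lambda>(z, w). f z w)"
  by (cases k) auto

lemma smooth_family_SucI:
  "continuous_on (S \<times> UNIV) (\<lambda>(z, w). f z w) \<Longrightarrow>
    (\<And>z w. z \<in> S \<Longrightarrow> (f z has_field_derivative f' z w) (at w)) \<Longrightarrow>
    smooth_family k S f' \<Longrightarrow> smooth_family (Suc k) S f"
  by auto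

lemma smooth_family_SucD: "smooth_family (Suc k) S f \<Longrightarrow> smooth_family k S f"
proof (induction k arbitrary: f)
  case (Suc k)
  from Suc.prems obtain f' where "\<forall>z\<in>S. \<forall>w. (f z has_field_derivative f' z w) (at w)" "smooth_family (Suc k) S f'"
    by auto
  with Suc.IH[of f'] Suc.prems show ?case by auto
qed simp

lemma smooth_family_cong:
  assumes "smooth_family k S f" "\<And>z w. z \<in> S \<Longrightarrow> f z w = f' z w"
  shows "smooth_family k S f'"
proof -
  have cont: "continuous_on (S \<times> UNIV) (\<lambda>(z, w). f' z w)"
    using smooth_family_continuous[OF assms(1)]
    by (rule continuous_on_eq) (use assms(2) in auto)
  have "f z = f' z" if "z \<in> S" for z using assms(2)[OF that] by auto
  with cont assms(1) show ?thesis by (cases k) auto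
qed

lemma smooth_family_base: "continuous_on S c \<Longrightarrow> smooth_family k S (\<lambda>z w. c z)"
proof (induction k arbitrary: c)
  case 0
  then show ?case by (auto simp: case_prod_beta intro!: continuous_on_compose2[of S c] continuous_intros)
next
  case (Suc k)
  have "smooth_family k S (\<lambda>z w. 0 :: real)" by (rule Suc.IH) simp
  moreover have "continuous_on (S \<times> UNIV) (\<lambda>(z, w :: real). c z)"
    using Suc.prems by (auto simp: case_prod_beta intro!: continuous_on_compose2[of S c] continuous_intros)
  ultimately show ?case by (auto intro!: exI[of _ "\<lambda>z w. 0"])
qed

lemma smooth_family_add:
  "smooth_family k S f \<Longrightarrow> smooth_family k S h \<Longrightarrow> smooth_family k S (\<lambda>z w. f z w + h z w)"
proof (induction k arbitrary: f h)
  case 0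
  then show ?case by (auto simp: case_prod_beta intro!: continuous_intros)
next
  case (Suc k)
  from Suc.prems obtain f' h' where d: "\<forall>z\<in>S. \<forall>w. (f z has_field_derivative f' z w) (at w)" "smooth_family k S f'"
      "\<forall>z\<in>S. \<forall>w. (h z has_field_derivative h' z w) (at w)" "smooth_family k S h'"
    by auto
  show ?case
  proof (rule smooth_family_SucI)
    show "((\<lambda>w. f z w + h z w) has_field_derivative f' z w + h' z w) (at w)" if "z \<in> S" for z w
      using d(1,3) that by (auto intro!: derivative_intros)
    show "continuous_on (S \<times> UNIV) (\<lambda>(z, w). f z w + h z w)"
      using Suc.prems by (auto simp: case_prod_beta intro!: continuous_intros)
    show "smooth_family k S (\<lambda>z w. f' z w + h' z w)" by (rule Suc.IH[OF d(2,4)])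
  qed
qed

lemma smooth_family_mult:
  "smooth_family k S f \<Longrightarrow> smooth_family k S h \<Longrightarrow> smooth_family k S (\<lambda>z w. f z w * h z w)"
proof (induction k arbitrary: f h)
  case 0
  then show ?case by (auto simp: case_prod_beta intro!: continuous_intros)
next
  case (Suc k)
  from Suc.prems obtain f' h' where d: "\<forall>z\<in>S. \<forall>w. (f z has_field_derivative f' z w) (at w)" "smooth_family k S f'"
      "\<forall>z\<in>S. \<forall>w. (h z has_field_derivative h' z w) (at w)" "smooth_family k S h'"
    by auto
  show ?case
  proof (rule smooth_family_SucI)
    show "((\<lambda>w. f z w * h z w) has_field_derivative f' z w * h z w + f z w * h' z w) (at w)" if "z \<in> S" for z w
      using d(1,3) that by (auto intro!: derivative_eq_intros)
    show "continuous_on (S \<times> UNIV) (\<lambda>(z, w). f z w * h z w)"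
      using Suc.prems by (auto simp: case_prod_beta intro!: continuous_intros)
    show "smooth_family k S (\<lambda>z w. f' z w * h z w + f z w * h' z w)"
      by (rule smooth_family_add[OF Suc.IH[OF d(2) smooth_family_SucD[OF Suc.prems(2)]]
            Suc.IH[OF smooth_family_SucD[OF Suc.prems(1)] d(4)]])
  qed
qed

lemma smooth_family_inverse:
  "smooth_family k S f \<Longrightarrow> (\<And>z w. z \<in> S \<Longrightarrow> f z w \<noteq> 0) \<Longrightarrow> smooth_family k S (\<lambda>z w. inverse (f z w))"
proof (induction k arbitrary: f)
  case 0
  then show ?case by (auto simp: case_prod_beta intro!: continuous_intros)
next
  case (Suc k)
  from Suc.prems obtain f' where d: "\<forall>z\<in>S. \<forall>w. (f z has_field_derivative f' z w) (at w)" "smooth_family k S f'"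
    by auto
  show ?case
  proof (rule smooth_family_SucI)
    show "((\<lambda>w. inverse (f z w)) has_field_derivative - 1 * (inverse (f z w) * (f' z w * inverse (f z w)))) (at w)"
      if "z \<in> S" for z w
      using d(1) Suc.prems(2) that by (auto intro!: derivative_eq_intros)
    show "continuous_on (S \<times> UNIV) (\<lambda>(z, w). inverse (f z w))"
      using Suc.prems by (auto simp: case_prod_beta intro!: continuous_intros)
    have inv: "smooth_family k S (\<lambda>z w. inverse (f z w))"
      by (rule Suc.IH[OF smooth_family_SucD[OF Suc.prems(1)] Suc.prems(2)])
    show "smooth_family k S (\<lambda>z w. - 1 * (inverse (f z w) * (f' z w * inverse (f z w))))"
      by (rule smooth_family_mult[OF smooth_family_base[OF continuous_on_const]
            smooth_family_mult[OF inv smooth_family_mult[OF d(2) inv]]])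
  qed
qed

lemma smooth_family_compose:
  "smooth_family k S f \<Longrightarrow> smooth_family k S h \<Longrightarrow> smooth_family k S (\<lambda>z w. f z (h z w))"
proof -
  have cont: "continuous_on (S \<times> UNIV) (\<lambda>(z, w). f z (h z w))"
    if "continuous_on (S \<times> UNIV) (\<lambda>(z, w). f z w)" "continuous_on (S \<times> UNIV) (\<lambda>(z, w). h z w)"
    for f h :: "'a \<Rightarrow> real \<Rightarrow> real"
  proof -
    have "continuous_on (S \<times> UNIV) (\<lambda>p. case (fst p, h (fst p) (snd p)) of (z, w) \<Rightarrow> f z w)"
      using that(2) by (intro continuous_on_compose2[OF that(1)] continuous_intros) (auto simp: case_prod_beta)
    then show ?thesis by (simp add: case_prod_beta)
  qed
  show "smooth_family k S f \<Longrightarrow> smooth_family k S h \<Longrightarrow> smooth_family k S (\<lambda>z w. f z (h z w))"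
  proof (induction k arbitrary: f h)
    case 0
    then show ?case using cont by simp
  next
    case (Suc k)
    from Suc.prems obtain f' h' where d: "\<forall>z\<in>S. \<forall>w. (f z has_field_derivative f' z w) (at w)" "smooth_family k S f'"
        "\<forall>z\<in>S. \<forall>w. (h z has_field_derivative h' z w) (at w)" "smooth_family k S h'"
      by auto
    show ?case
    proof (rule smooth_family_SucI)
      show "continuous_on (S \<times> UNIV) (\<lambda>(z, w). f z (h z w))"
        by (rule cont[OF smooth_family_continuous[OF Suc.prems(1)] smooth_family_continuous[OF Suc.prems(2)]])
      show "((\<lambda>w. f z (h z w)) has_field_derivative f' z (h z w) * h' z w) (at w)" if "z \<in> S" for z w
        by (rule DERIV_chain2[where f = "f z"]) (use d(1,3) that in auto)
      show "smooth_family k S (\<lambda>z w. f' z (h z w) * h' z w)"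
        by (rule smooth_family_mult[OF Suc.IH[OF d(2) smooth_family_SucD[OF Suc.prems(2)]] d(4)])
    qed
  qed
qed

lemma smooth_family_sin_cos:
  fixes c :: real
  shows "smooth_family k S (\<lambda>z w. sin (c * w)) \<and> smooth_family k S (\<lambda>z w. cos (c * w))"
proof -
  have "continuous_on (S \<times> UNIV) (\<lambda>p. c * snd p)" by (intro continuous_intros)
  then have cont: "continuous_on (S \<times> UNIV) (\<lambda>(z, w). sin (c * w))" "continuous_on (S \<times> UNIV) (\<lambda>(z, w). cos (c * w))"
    by (simp_all add: case_prod_beta continuous_on_sin continuous_on_cos)
  show ?thesis
  proof (induction k)
    case (Suc k)
    have "smooth_family (Suc k) S (\<lambda>z w. sin (c * w))"
    proof (rule smooth_family_SucI[OF cont(1)])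
      show "((\<lambda>w. sin (c * w)) has_field_derivative c * cos (c * w)) (at w)" for w
        by (auto intro!: derivative_eq_intros)
      show "smooth_family k S (\<lambda>z w. c * cos (c * w))"
        by (rule smooth_family_mult[OF smooth_family_base[OF continuous_on_const] conjunct2[OF Suc]])
    qed
    moreover have "smooth_family (Suc k) S (\<lambda>z w. cos (c * w))"
    proof (rule smooth_family_SucI[OF cont(2)])
      show "((\<lambda>w. cos (c * w)) has_field_derivative - c * sin (c * w)) (at w)" for w
        by (auto intro!: derivative_eq_intros)
      show "smooth_family k S (\<lambda>z w. - c * sin (c * w))"
        by (rule smooth_family_mult[OF smooth_family_base[OF continuous_on_const] conjunct1[OF Suc]])
    qed
    ultimately show ?case ..
  qed (use cont in simp)
qed

text \<open>The derivative of the inverse is \<open>1 / (f' \<circ> G)\<close>, which by induction is as smooth as \<open>f'\<close> and \<open>G\<close>.\<close>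

lemma smooth_family_inverse_function:
  assumes mono: "\<And>z. z \<in> S \<Longrightarrow> strict_mono (f z)"
    and G: "\<And>z y. z \<in> S \<Longrightarrow> f z (G z y) = y"
    and pos: "\<And>z w. z \<in> S \<Longrightarrow> \<exists>D>0. (f z has_field_derivative D) (at w)"
  shows "smooth_family k S f \<Longrightarrow> smooth_family k S G"
proof (induction k)
  case 0
  then show ?case using strict_mono_inverse_continuous[OF _ mono G] by simp
next
  case (Suc k)
  from Suc.prems obtain f' where d: "\<forall>z\<in>S. \<forall>w. (f z has_field_derivative f' z w) (at w)" "smooth_family k S f'"
    by auto
  have f'_pos: "f' z w > 0" if z: "z \<in> S" for z w
  proof -
    obtain D where "D > 0" "(f z has_field_derivative D) (at w)" using pos[OF z] by blast
    moreover have "(f z has_field_derivative f' z w) (at w)" using d(1) z by blast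
    ultimately show ?thesis using DERIV_unique by blast
  qed
  have IH: "smooth_family k S G" by (rule Suc.IH[OF smooth_family_SucD[OF Suc.prems]])
  have cont: "continuous_on (S \<times> UNIV) (\<lambda>(z, w). G z w)" by (rule smooth_family_continuous[OF IH])
  have inv: "smooth_family k S (\<lambda>z w. inverse (f' z (G z w)))"
  proof (rule smooth_family_inverse)
    show "smooth_family k S (\<lambda>z w. f' z (G z w))" by (rule smooth_family_compose[OF d(2) IH])
    show "f' z (G z w) \<noteq> 0" if "z \<in> S" for z w using f'_pos[OF that, of "G z w"] by simp
  qed
  have "(G z has_field_derivative inverse (f' z (G z w))) (at w)" if z: "z \<in> S" for z w
  proof (rule DERIV_inverse_function[where f = "f z" and a = "w - 1" and b = "w + 1"])
    show "(f z has_field_derivative f' z (G z w)) (at (G z w))" using d(1) z by blast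
    show "f' z (G z w) \<noteq> 0" using f'_pos[OF z, of "G z w"] by simp
    show "f z (G z y) = y" for y by (rule G[OF z])
    have "continuous_on UNIV (\<lambda>w. case (z, w) of (z, w) \<Rightarrow> G z w)"
      by (rule continuous_on_compose2[OF cont]) (use z in \<open>auto intro!: continuous_intros\<close>)
    then show "isCont (G z) w" by (simp add: continuous_on_eq_continuous_at)
  qed auto
  from smooth_family_SucI[OF cont this inv] show ?case .
qed

lemma smooth_family_deriv:
  assumes "smooth_family (Suc k) S f"
  shows "smooth_family k S (\<lambda>z. deriv (f z))" "z \<in> S \<Longrightarrow> (f z has_field_derivative deriv (f z) w) (at w)"
proof -
  from assms obtain f' where d: "\<forall>z\<in>S. \<forall>w. (f z has_field_derivative f' z w) (at w)" "smooth_family k S f'"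
    by auto
  have eq: "deriv (f z) w = f' z w" if "z \<in> S" for z w using d(1) that by (blast intro: DERIV_imp_deriv)
  show "smooth_family k S (\<lambda>z. deriv (f z))" by (rule smooth_family_cong[OF d(2)]) (simp add: eq)
  show "(f z has_field_derivative deriv (f z) w) (at w)" if "z \<in> S" using d(1) that eq[OF that] by simp
qed

lemma smooth_family_higher_deriv:
  "smooth_family (k + j) S f \<Longrightarrow> smooth_family k S (\<lambda>z. (deriv ^^ j) (f z))"
proof (induction j arbitrary: k)
  case (Suc j)
  then have "smooth_family (Suc k) S (\<lambda>z. (deriv ^^ j) (f z))" using Suc.IH[of "Suc k"] by simp
  from smooth_family_deriv(1)[OF this] show ?case by simp
qed simp

lemma smooth_family_continuous_higher_deriv:
  assumes "smooth_family k S f" "j \<le> k"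
  shows "continuous_on (S \<times> UNIV) (\<lambda>(z, w). (deriv ^^ j) (f z) w)"
  using smooth_family_higher_deriv[of "k - j" j S f] assms by (auto intro: smooth_family_continuous)

lemma smooth_family_C_fun:
  assumes "smooth_family k S f" "z \<in> S"
  shows "C_fun k (f z)"
  unfolding C_fun_def
proof (intro conjI allI impI)
  fix j assume "j < k"
  then have "smooth_family (Suc (k - Suc j)) S (\<lambda>z. (deriv ^^ j) (f z))"
    using assms(1) by (intro smooth_family_higher_deriv) (simp add: Suc_diff_Suc)
  from smooth_family_deriv(2)[OF this assms(2)]
  show "(deriv ^^ j) (f z) differentiable_on UNIV"
    unfolding differentiable_on_def by (auto simp: real_differentiable_def)
next
  have "continuous_on UNIV (\<lambda>w. case (z, w) of (z, w) \<Rightarrow> (deriv ^^ k) (f z) w)"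
    by (rule continuous_on_compose2[OF smooth_family_continuous_higher_deriv[OF assms(1) order_refl]])
      (use assms(2) in \<open>auto intro!: continuous_intros\<close>)
  then show "continuous_on UNIV ((deriv ^^ k) (f z))" by simp
qed

lemma C_fun_imp_smooth_family:
  "(\<And>z. z \<in> S \<Longrightarrow> C_fun k (f z)) \<Longrightarrow>
    (\<And>j. j \<le> k \<Longrightarrow> continuous_on (S \<times> UNIV) (\<lambda>(z, w). (deriv ^^ j) (f z) w)) \<Longrightarrow> smooth_family k S f"
proof (induction k arbitrary: f)
  case 0
  then show ?case using 0(2)[of 0] by simp
next
  case (Suc k)
  have d: "smooth_family k S (\<lambda>z. deriv (f z))"
  proof (rule Suc.IH)
    show "C_fun k (deriv (f z))" if "z \<in> S" for z
    proof -
      have C: "C_fun (Suc k) (f z)" by (rule Suc.prems(1)[OF that])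
      have "(deriv ^^ j) (deriv (f z)) differentiable_on UNIV" if "j < k" for j
      proof -
        have "(deriv ^^ Suc j) (f z) differentiable_on UNIV" using C that unfolding C_fun_def by blast
        then show ?thesis by (simp only: funpow_Suc_right comp_apply)
      qed
      moreover have "continuous_on UNIV ((deriv ^^ Suc k) (f z))" using C unfolding C_fun_def by blast
      then have "continuous_on UNIV ((deriv ^^ k) (deriv (f z)))" by (simp only: funpow_Suc_right comp_apply)
      ultimately show ?thesis by (simp add: C_fun_def)
    qed
    show "continuous_on (S \<times> UNIV) (\<lambda>(z, w). (deriv ^^ j) (deriv (f z)) w)" if "j \<le> k" for j
      using Suc.prems(2)[of "Suc j"] that by (simp add: funpow_swap1)
  qed
  have "(f z has_field_derivative deriv (f z) w) (at w)" if "z \<in> S" for z w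
  proof -
    have "f z differentiable_on UNIV" using Suc.prems(1)[OF that] by (auto simp: C_fun_def)
    then have "f z differentiable (at w)" by (simp add: differentiable_on_def)
    then show ?thesis by (simp add: DERIV_deriv_iff_real_differentiable)
  qed
  then show ?case
    using Suc.prems(2)[of 0] by (intro smooth_family_SucI[OF _ _ d]) auto
qed


lemma higher_deriv_diff_bound:
  fixes f h :: "real \<Rightarrow> real"
  assumes f: "\<And>y. f (y + 1) = f y + 1" and h: "\<And>y. h (y + 1) = h y + 1"
    and le: "\<And>y. 0 \<le> y \<Longrightarrow> y \<le> 1 \<Longrightarrow> \<bar>(deriv ^^ j) f y - (deriv ^^ j) h y\<bar> \<le> e"
  shows "(SUP y. \<bar>(deriv ^^ j) f y - (deriv ^^ j) h y\<bar>) \<le> e"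
proof (rule cSUP_least)
  fix y
  let ?d = "\<lambda>y. (deriv ^^ j) f y - (deriv ^^ j) h y"
  have "?d (y + 1) = ?d y" for y
    by (simp add: higher_deriv_shift1[of f, OF f] higher_deriv_shift1[of h, OF h])
  then have "?d y = ?d (frac y)" by (rule step_zero_imp_periodic[where h = ?d, OF _ frac_diff_Ints])
  then show "\<bar>?d y\<bar> \<le> e" using le[of "frac y"] frac_lt_1[of y] by simp
qed simp

text \<open>By periodicity only the compact unit interval matters, and on the product with the compact
parameter space the derivatives are uniformly continuous.\<close>

lemma dist_C_uniformly_small:
  fixes S :: "'z::metric_space set"
  assumes S: "compact S" and smooth: "smooth_family k S F"
    and step: "\<And>z y. z \<in> S \<Longrightarrow> F z (y + 1) = F z y + 1" and e: "e > 0"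
  shows "\<exists>d>0. \<forall>z\<in>S. \<forall>z'\<in>S. dist z z' < d \<longrightarrow> dist_C k (F z) (F z') < e"
proof -
  define e' where "e' = e / (2 * real (Suc k))"
  have e': "e' > 0" using e by (simp add: e'_def)
  have "\<exists>d>0. \<forall>z\<in>S. \<forall>z'\<in>S. dist z z' < d \<longrightarrow> (SUP y. \<bar>(deriv ^^ j) (F z) y - (deriv ^^ j) (F z') y\<bar>) \<le> e'"
    if j: "j \<le> k" for j
  proof -
    have "continuous_on (S \<times> {0..1}) (\<lambda>p. (deriv ^^ j) (F (fst p)) (snd p))"
      using smooth_family_continuous_higher_deriv[OF smooth j] unfolding case_prod_beta
      by (rule continuous_on_subset) auto
    then have "uniformly_continuous_on (S \<times> {0..1}) (\<lambda>p. (deriv ^^ j) (F (fst p)) (snd p))"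
      by (rule compact_uniformly_continuous) (intro compact_Times S compact_Icc)
    then obtain d where d: "d > 0" "\<forall>p\<in>S \<times> {0..1}. \<forall>p'\<in>S \<times> {0..1}. dist p' p < d \<longrightarrow>
        dist ((deriv ^^ j) (F (fst p')) (snd p')) ((deriv ^^ j) (F (fst p)) (snd p)) < e'"
      using e' unfolding uniformly_continuous_on_def by metis
    have "(SUP y. \<bar>(deriv ^^ j) (F z) y - (deriv ^^ j) (F z') y\<bar>) \<le> e'" if z: "z \<in> S" "z' \<in> S" "dist z z' < d" for z z'
    proof (rule higher_deriv_diff_bound)
      fix y :: real assume y: "0 \<le> y" "y \<le> 1"
      have "dist ((deriv ^^ j) (F (fst (z, y))) (snd (z, y))) ((deriv ^^ j) (F (fst (z', y))) (snd (z', y))) < e'"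
        by (rule d(2)[rule_format]) (use z y in \<open>auto simp: dist_Pair_Pair dist_commute\<close>)
      then show "\<bar>(deriv ^^ j) (F z) y - (deriv ^^ j) (F z') y\<bar> \<le> e'" by (simp add: dist_real_def)
    qed (use step z in auto)
    with d(1) show ?thesis by blast
  qed
  then obtain d where d: "\<And>j. j \<le> k \<Longrightarrow> d j > 0" "\<And>j z z'. j \<le> k \<Longrightarrow> z \<in> S \<Longrightarrow> z' \<in> S \<Longrightarrow> dist z z' < d j \<Longrightarrow>
      (SUP y. \<bar>(deriv ^^ j) (F z) y - (deriv ^^ j) (F z') y\<bar>) \<le> e'"
    by metis
  define \<delta> where "\<delta> = Min (d ` {..k})"
  have \<delta>: "\<delta> > 0" "\<And>j. j \<le> k \<Longrightarrow> \<delta> \<le> d j" using d(1) by (auto simp: \<delta>_def)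
  have "dist_C k (F z) (F z') < e" if z: "z \<in> S" "z' \<in> S" "dist z z' < \<delta>" for z z'
  proof -
    have "dist_C k (F z) (F z') \<le> (\<Sum>j\<le>k. e')"
      unfolding dist_C_def
    proof (rule sum_mono)
      fix j assume "j \<in> {..k}"
      then have "j \<le> k" by simp
      then show "(SUP y. \<bar>(deriv ^^ j) (F z) y - (deriv ^^ j) (F z') y\<bar>) \<le> e'"
        using \<delta>(2)[of j] z by (intro d(2)) auto
    qed
    also have "\<dots> = e / 2" by (simp add: e'_def field_simps)
    finally show ?thesis using e by simp
  qed
  with \<delta>(1) show ?thesis by blast
qed

text \<open>For \<open>r = \<infinity>\<close> the tail of the weighted series is small whatever the maps are, so finitely many of
the distances have to be controlled.\<close>

lemma dist_Diff_uniformly_small: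
  fixes S :: "'z::metric_space set"
  assumes S: "compact S" and F: "\<And>z. z \<in> S \<Longrightarrow> F z \<in> lifted_Diff r"
    and smooth: "\<And>k. enat k \<le> r \<Longrightarrow> smooth_family k S F"
      "\<And>k. enat k \<le> r \<Longrightarrow> smooth_family k S (\<lambda>z. inv (F z))"
    and e: "e > 0"
  shows "\<exists>d>0. \<forall>z\<in>S. \<forall>z'\<in>S. dist z z' < d \<longrightarrow> dist_Diff r (F z) (F z') < e"
proof -
  have step: "F z (y + 1) = F z y + 1" "inv (F z) (y + 1) = inv (F z) y + 1" if "z \<in> S" for z y
  proof -
    have b: "bij (F z)" and s: "F z (y + 1) = F z y + 1" for y
      using F[OF that] by (auto simp: lifted_Diff_def Diff_real_def)
    show "F z (y + 1) = F z y + 1" by (rule s)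
    have "F z (inv (F z) y + 1) = y + 1" unfolding s using b by (simp add: bij_is_surj surj_f_inv_f)
    then show "inv (F z) (y + 1) = inv (F z) y + 1" using b by (metis bij_inv_eq_iff)
  qed
  have fin: "\<exists>d>0. \<forall>z\<in>S. \<forall>z'\<in>S. dist z z' < d \<longrightarrow> dist_Diff_fin k (F z) (F z') < e"
    if k: "enat k \<le> r" and e: "e > 0" for k e
  proof -
    obtain d where d: "d > 0" "\<And>z z'. z \<in> S \<Longrightarrow> z' \<in> S \<Longrightarrow> dist z z' < d \<Longrightarrow> dist_C k (F z) (F z') < e / 2"
      using dist_C_uniformly_small[OF S smooth(1)[OF k] step(1), of "e / 2"] e by auto
    obtain d' where d': "d' > 0" "\<And>z z'. z \<in> S \<Longrightarrow> z' \<in> S \<Longrightarrow> dist z z' < d' \<Longrightarrow> dist_C k (inv (F z)) (inv (F z')) < e / 2"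
      using dist_C_uniformly_small[OF S smooth(2)[OF k] step(2), of "e / 2"] e by auto
    have "dist_Diff_fin k (F z) (F z') < e" if "z \<in> S" "z' \<in> S" "dist z z' < min d d'" for z z'
      using d(2)[of z z'] d'(2)[of z z'] that unfolding dist_Diff_fin_def by simp
    with d(1) d'(1) show ?thesis by (intro exI[of _ "min d d'"]) auto
  qed
  show ?thesis
  proof (cases r)
    case (enat k)
    then show ?thesis using fin[of k e] e by (simp add: dist_Diff_def)
  next
    case infinity
    then have le: "enat k \<le> r" for k by simp
    obtain K where K: "(1 / 2 :: real) ^ K < e / 2"
      using real_arch_pow_inv[of "e / 2" "1 / 2"] e by auto
    define e' where "e' = e / (2 * real (Suc K))"
    have e': "e' > 0" using e by (simp add: e'_def)
    have "\<forall>i. \<exists>d>0. \<forall>z\<in>S. \<forall>z'\<in>S. dist z z' < d \<longrightarrow> dist_Diff_fin (Suc i) (F z) (F z') < e'"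
      using fin[OF le e'] by blast
    then obtain d where d: "\<And>i. d i > 0" "\<And>i z z'. z \<in> S \<Longrightarrow> z' \<in> S \<Longrightarrow> dist z z' < d i \<Longrightarrow>
        dist_Diff_fin (Suc i) (F z) (F z') < e'"
      by metis
    define \<delta> where "\<delta> = Min (d ` {..K})"
    have \<delta>: "\<delta> > 0" "\<And>i. i \<le> K \<Longrightarrow> \<delta> \<le> d i" using d(1) by (auto simp: \<delta>_def)
    have "dist_Diff r (F z) (F z') < e" if z: "z \<in> S" "z' \<in> S" "dist z z' < \<delta>" for z z'
    proof -
      let ?x = "\<lambda>i. dist_Diff_fin (Suc i) (F z) (F z')"
      define t where "t i = (1 / 2) ^ Suc i * (?x i / (?x i + 1))" for i
      have x: "?x i \<ge> 0" for i by (rule dist_Diff_fin(1)[OF F[OF z(1)] F[OF z(2)] le])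
      have half: "(\<lambda>i. (1 / 2 :: real) ^ K * (1 / 2) ^ Suc i) sums ((1 / 2) ^ K * 1)"
        by (intro sums_mult power_half_series)
      have q: "0 \<le> ?x i / (?x i + 1)" "?x i / (?x i + 1) \<le> 1" "?x i / (?x i + 1) \<le> ?x i" for i
        using x[of i] by (auto simp: divide_le_eq mult_le_cancel_left1)
      have t: "0 \<le> t i" "t i \<le> (1 / 2) ^ Suc i" "t i \<le> ?x i" for i
      proof -
        show "0 \<le> t i" unfolding t_def by (intro mult_nonneg_nonneg q) simp
        show "t i \<le> (1 / 2) ^ Suc i" unfolding t_def by (intro mult_left_le q) simp
        have "t i \<le> 1 * (?x i / (?x i + 1))" unfolding t_def by (intro mult_right_mono q power_le_one) auto
        with q(3)[of i] show "t i \<le> ?x i" by simp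
      qed
      have summ: "summable t"
        by (rule summable_comparison_test'[OF sums_summable[OF power_half_series], of 0])
          (simp only: real_norm_def abs_of_nonneg[OF t(1)] t(2))
      have "dist_Diff r (F z) (F z') = suminf t"
        by (simp add: dist_Diff_def infinity t_def[abs_def])
      also have "\<dots> = (\<Sum>i. t (i + K)) + (\<Sum>i<K. t i)" by (rule suminf_split_initial_segment[OF summ])
      also have "(\<Sum>i<K. t i) \<le> (\<Sum>i<K. e')"
      proof (rule sum_mono)
        fix i assume "i \<in> {..<K}"
        then have "?x i < e'" using \<delta>(2)[of i] z by (intro d(2)) auto
        with t(3)[of i] show "t i \<le> e'" by linarith
      qed
      also have "(\<Sum>i<K. e') \<le> e / 2"
        using e by (simp add: e'_def field_simps)
      also have "(\<Sum>i. t (i + K)) \<le> (\<Sum>i. (1 / 2) ^ K * (1 / 2) ^ Suc i)"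
      proof (rule suminf_le)
        have "(1 / 2 :: real) ^ Suc (i + K) = (1 / 2) ^ K * (1 / 2) ^ Suc i" for i
          by (simp only: add_Suc[symmetric] power_add mult.commute)
        then show "t (i + K) \<le> (1 / 2) ^ K * (1 / 2) ^ Suc i" for i using t(2)[of "i + K"] by simp
      qed (intro summable_ignore_initial_segment[OF summ] sums_summable[OF half])+
      also have "(\<Sum>i. (1 / 2 :: real) ^ K * (1 / 2) ^ Suc i) = (1 / 2) ^ K" using sums_unique[OF half] by simp
      finally show ?thesis using K by linarith
    qed
    with \<delta>(1) show ?thesis by blast
  qed
qed

lemma dist_C_mono:
  assumes "f \<in> lift_like m" "h \<in> lift_like m" "k \<le> m"
  shows "dist_C k f h \<le> dist_C m f h"
  unfolding dist_C_def
proof (rule sum_mono2)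
  fix j assume "j \<in> {..m} - {..k}"
  then have "bdd_above (range (\<lambda>y. \<bar>(deriv ^^ j) f y - (deriv ^^ j) h y\<bar>))"
    using assms by (intro bdd_above_deriv_diff[of _ m]) auto
  from cSUP_upper2[OF this, of 0 0] show "0 \<le> (SUP y. \<bar>(deriv ^^ j) f y - (deriv ^^ j) h y\<bar>)" by simp
qed (use assms in auto)

lemma dist_C_le_dist_Diff_fin:
  assumes "f \<in> lifted_Diff r" "h \<in> lifted_Diff r" "enat k \<le> r"
  shows "dist_C k f h \<le> dist_Diff_fin k f h"
  using dist_C_nonneg[OF lifted_DiffD(2)[OF assms(1,3)] lifted_DiffD(2)[OF assms(2,3)]]
  by (simp add: dist_Diff_fin_def)

text \<open>For \<open>r = \<infinity>\<close> a single term of the series already bounds the \<open>C^k\<close> distance, since \<open>x / (x + 1)\<close> small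
forces \<open>x\<close> small.\<close>

lemma dist_Diff_controls_dist_C:
  assumes k: "enat k \<le> r" and e: "e > 0"
  shows "\<exists>e'>0. \<forall>f\<in>lifted_Diff r. \<forall>h\<in>lifted_Diff r. dist_Diff r f h < e' \<longrightarrow> dist_C k f h < e"
proof (cases r)
  case (enat m)
  have "dist_C k f h \<le> dist_Diff r f h" if "f \<in> lifted_Diff r" "h \<in> lifted_Diff r" for f h
  proof -
    have m: "enat m \<le> r" by (simp add: enat)
    have "dist_C k f h \<le> dist_C m f h"
      using k enat by (intro dist_C_mono lifted_DiffD(1)[OF _ m] that) auto
    also have "\<dots> \<le> dist_Diff_fin m f h" by (rule dist_C_le_dist_Diff_fin[OF that m])
    finally show ?thesis by (simp add: dist_Diff_def enat)
  qed
  with e show ?thesis by (intro exI[of _ e]) force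
next
  case infinity
  then have le: "enat k \<le> r" for k by simp
  define e' where "e' = (1 / 2) ^ Suc k * (e / (e + 1))"
  have "dist_C k f h < e" if fh: "f \<in> lifted_Diff r" "h \<in> lifted_Diff r" and close: "dist_Diff r f h < e'" for f h
  proof -
    let ?x = "\<lambda>i. dist_Diff_fin (Suc i) f h"
    define t where "t i = (1 / 2) ^ Suc i * (?x i / (?x i + 1))" for i
    have x: "?x i \<ge> 0" for i by (rule dist_Diff_fin(1)[OF fh le])
    have q: "0 \<le> ?x i / (?x i + 1)" "?x i / (?x i + 1) \<le> 1" for i
      using x[of i] by auto
    have t: "0 \<le> t i" "t i \<le> (1 / 2) ^ Suc i" for i
    proof -
      show "0 \<le> t i" unfolding t_def by (intro mult_nonneg_nonneg q) simp
      show "t i \<le> (1 / 2) ^ Suc i" unfolding t_def by (intro mult_left_le q) simp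
    qed
    have summ: "summable t"
      by (rule summable_comparison_test'[OF sums_summable[OF power_half_series], of 0])
        (simp only: real_norm_def abs_of_nonneg[OF t(1)] t(2))
    have "t k \<le> suminf t" using sum_le_suminf[OF summ, of "{k}"] t(1) by simp
    also have "\<dots> = dist_Diff r f h" by (simp add: dist_Diff_def infinity t_def[abs_def])
    also note close
    finally have "(1 / 2) ^ Suc k * (?x k / (?x k + 1)) < (1 / 2) ^ Suc k * (e / (e + 1))"
      by (simp only: t_def e'_def)
    then have "?x k / (?x k + 1) < e / (e + 1)" by (rule mult_left_less_imp_less) simp
    then have "?x k < e" using x[of k] e by (simp add: divide_less_eq less_divide_eq) (simp add: field_simps)
    moreover have "dist_C k f h \<le> dist_C (Suc k) f h"
      by (intro dist_C_mono lifted_DiffD(1)[OF _ le] fh) simp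
    moreover have "dist_C (Suc k) f h \<le> ?x k" by (rule dist_C_le_dist_Diff_fin[OF fh le])
    ultimately show ?thesis by linarith
  qed
  moreover have "e' > 0" using e by (simp add: e'_def)
  ultimately show ?thesis by blast
qed

lemma continuous_map_into_metric_iff:
  fixes H :: "'a::metric_space \<Rightarrow> 'b"
  shows "continuous_map euclidean (mtopology_of m) H \<longleftrightarrow>
    (\<forall>x. H x \<in> mspace m) \<and> (\<forall>x. \<forall>e>0. \<exists>d>0. \<forall>y. dist y x < d \<longrightarrow> mdist m (H x) (H y) < e)"
proof -
  have "continuous_map euclidean (mtopology_of m) H \<longleftrightarrow>
      (\<forall>x. \<forall>e>0. \<exists>U. open U \<and> x \<in> U \<and> (\<forall>y\<in>U. H x \<in> mspace m \<and> H y \<in> mspace m \<and> mdist m (H x) (H y) < e))"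
    unfolding mtopology_of_def Metric_space.continuous_map_to_metric[OF Metric_space_mspace_mdist]
      Metric_space.in_mball[OF Metric_space_mspace_mdist] by simp
  also have "\<dots> \<longleftrightarrow> (\<forall>x. H x \<in> mspace m) \<and> (\<forall>x. \<forall>e>0. \<exists>d>0. \<forall>y. dist y x < d \<longrightarrow> mdist m (H x) (H y) < e)"
    (is "?L \<longleftrightarrow> ?R")
  proof
    assume L: ?L
    have "H x \<in> mspace m" for x using L[rule_format, of 1 x] by auto
    moreover have "\<exists>d>0. \<forall>y. dist y x < d \<longrightarrow> mdist m (H x) (H y) < e" if "e > 0" for x e
      using L[rule_format, OF that, of x] unfolding open_dist by blast
    ultimately show ?R by blast
  next
    assume R: ?R
    show ?L
    proof (intro allI impI)
      fix x and e :: real assume "e > 0"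
      then obtain d where "d > 0" "\<And>y. dist y x < d \<Longrightarrow> mdist m (H x) (H y) < e" using R by blast
      with R show "\<exists>U. open U \<and> x \<in> U \<and> (\<forall>y\<in>U. H x \<in> mspace m \<and> H y \<in> mspace m \<and> mdist m (H x) (H y) < e)"
        by (intro exI[of _ "ball x d"]) (auto simp: dist_commute)
    qed
  qed
  finally show ?thesis .
qed

lemma continuous_map_type1_smooth_family:
  fixes H :: "'a::metric_space \<Rightarrow> real \<Rightarrow> real"
  assumes H: "continuous_map euclidean (mtopology_of (type1_metric r)) H" and k: "enat k \<le> r"
  shows "smooth_family k UNIV H"
proof (rule C_fun_imp_smooth_family)
  have H_in: "H x \<in> lifted_Diff r" for x
    using H by (simp add: continuous_map_into_metric_iff)
  then have lift_like: "H x \<in> lift_like k" for x by (rule lifted_DiffD(1)[OF _ k])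
  then show C: "C_fun k (H z)" for z by (simp add: lift_like_def)
  fix j assume j: "j \<le> k"
  show "continuous_on (UNIV \<times> UNIV) (\<lambda>(z, w). (deriv ^^ j) (H z) w)"
    unfolding continuous_on_iff
  proof (intro ballI allI impI)
    fix p :: "'a \<times> real" and e :: real assume e: "e > 0"
    obtain x w where p: "p = (x, w)" by (cases p)
    obtain e' where e': "e' > 0" "\<And>f h. f \<in> lifted_Diff r \<Longrightarrow> h \<in> lifted_Diff r \<Longrightarrow> dist_Diff r f h < e' \<Longrightarrow> dist_C k f h < e / 2"
      using dist_Diff_controls_dist_C[OF k, of "e / 2"] e by auto
    obtain d where d: "d > 0" "\<And>y. dist y x < d \<Longrightarrow> mdist (type1_metric r) (H x) (H y) < e'"
      using H e'(1) unfolding continuous_map_into_metric_iff by blast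
    have cont: "continuous_on UNIV ((deriv ^^ j) (H x))" by (rule C_fun_continuous[OF C j])
    obtain d' where d': "d' > 0" "\<And>v. dist v w < d' \<Longrightarrow> dist ((deriv ^^ j) (H x) v) ((deriv ^^ j) (H x) w) < e / 2"
      using cont e unfolding continuous_on_iff by (metis UNIV_I half_gt_zero)
    have "dist ((deriv ^^ j) (H y) v) ((deriv ^^ j) (H x) w) < e" if "dist (y, v) (x, w) < min d d'" for y v
    proof -
      have yv: "dist y x < d" "dist v w < d'"
        using that dist_fst_le[of "(y, v)" "(x, w)"] dist_snd_le[of "(y, v)" "(x, w)"] by auto
      have bdd: "bdd_above (range (\<lambda>y'. \<bar>(deriv ^^ i) (H x) y' - (deriv ^^ i) (H y) y'\<bar>))" if "i \<le> k" for i
        by (rule bdd_above_deriv_diff[OF lift_like lift_like that])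
      have "\<bar>(deriv ^^ j) (H x) v - (deriv ^^ j) (H y) v\<bar> \<le> (SUP y'. \<bar>(deriv ^^ j) (H x) y' - (deriv ^^ j) (H y) y'\<bar>)"
        by (rule cSUP_upper[OF _ bdd[OF j]]) simp
      also have "\<dots> \<le> dist_C k (H x) (H y)"
        unfolding dist_C_def
      proof (rule member_le_sum)
        fix i assume "i \<in> {..k} - {j}"
        then show "0 \<le> (SUP y'. \<bar>(deriv ^^ i) (H x) y' - (deriv ^^ i) (H y) y'\<bar>)"
          using cSUP_upper2[OF bdd[of i], of 0 0] by simp
      qed (use j in auto)
      also have "\<dots> < e / 2"
        using d(2)[OF yv(1)] H_in by (intro e'(2)) (auto simp: mdist_type1_metric)
      finally show ?thesis using d'(2)[OF yv(2)] unfolding dist_real_def by linarith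
    qed
    then have "\<forall>p'\<in>UNIV \<times> UNIV. dist p' p < min d d' \<longrightarrow>
        dist (case p' of (z, w) \<Rightarrow> (deriv ^^ j) (H z) w) (case p of (z, w) \<Rightarrow> (deriv ^^ j) (H z) w) < e"
      by (auto simp: p)
    moreover have "min d d' > 0" using d(1) d'(1) by simp
    ultimately show "\<exists>d>0. \<forall>p'\<in>UNIV \<times> UNIV. dist p' p < d \<longrightarrow>
        dist (case p' of (z, w) \<Rightarrow> (deriv ^^ j) (H z) w) (case p of (z, w) \<Rightarrow> (deriv ^^ j) (H z) w) < e"
      by blast
  qed
qed

section \<open>Openness\<close>

context compact_homeo
begin

text \<open>Mode-locking of \<open>H\<close> with tolerance \<open>e\<close> gives mode-locking with tolerance \<open>e / 2\<close> of every \<open>H'\<close> whose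
circle map is \<open>e / 2\<close>-close to that of \<open>H\<close>, because both are compared with the rotation number of \<open>H\<close>.\<close>

lemma open_dense_mode_locked_setI:
  fixes m :: "'h metric" and \<iota> :: "'h \<Rightarrow> circle \<Rightarrow> circle"
  defines "M \<equiv> cfunspace (euclidean :: 'a topology) m"
  assumes forced: "\<And>H. H \<in> mspace M \<Longrightarrow> forced_circle_homeo g (skew_product g \<iota> H)"
    and control: "\<And>e. e > 0 \<Longrightarrow> \<exists>d>0. \<forall>a\<in>mspace m. \<forall>b\<in>mspace m. mdist m a b < d \<longrightarrow> (\<forall>\<theta>. dist (\<iota> a \<theta>) (\<iota> b \<theta>) < e)"
    and dense: "\<And>H e. H \<in> mspace M \<Longrightarrow> e > 0 \<Longrightarrow>
      \<exists>H'\<in>mspace M. mode_locked g (skew_product g \<iota> H') \<and> mdist M H H' < e"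
  shows "open_dense_in M (mode_locked_set g m \<iota>)"
proof -
  interpret M: Metric_space "mspace M" "mdist M" by (rule Metric_space_mspace_mdist)
  have top: "mtopology_of M = M.mtopology" by (simp add: mtopology_of_def)
  let ?L = "mode_locked_set g m \<iota>"
  have mem: "H \<in> ?L \<longleftrightarrow> H \<in> mspace M \<and> mode_locked g (skew_product g \<iota> H)" for H
    by (simp add: mode_locked_set_def M_def)
  have "\<exists>r>0. M.mball H r \<subseteq> ?L" if H: "H \<in> ?L" for H
  proof -
    obtain e where e: "e > 0" "\<And>f'. forced_circle_homeo g f' \<Longrightarrow> (\<forall>z. dist (f' z) (skew_product g \<iota> H z) < e) \<Longrightarrow>
        rotation_number g f' = rotation_number g (skew_product g \<iota> H)"
      using H unfolding mem mode_locked_def by blast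
    obtain d where d: "d > 0" "\<And>a b \<theta>. a \<in> mspace m \<Longrightarrow> b \<in> mspace m \<Longrightarrow> mdist m a b < d \<Longrightarrow> dist (\<iota> a \<theta>) (\<iota> b \<theta>) < e / 2"
      using control[of "e / 2"] e(1) by auto
    have "M.mball H (d / 2) \<subseteq> ?L"
    proof
      fix H' assume "H' \<in> M.mball H (d / 2)"
      then have HH': "H \<in> mspace M" "H' \<in> mspace M" "mdist M H H' < d / 2" by simp_all
      have close: "dist (skew_product g \<iota> H' z) (skew_product g \<iota> H z) < e / 2" for z
      proof -
        obtain x \<theta> where z: "z = (x, \<theta>)" by (cases z)
        have "mdist m (H x) (H' x) \<le> d / 2"
          using HH' unfolding M_def by (intro mdist_cfunspace_imp_mdist_le[where X = euclidean and f = H and g = H']) auto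
        moreover have "H x \<in> mspace m" "H' x \<in> mspace m"
          using HH'(1,2) unfolding M_def mspace_cfunspace_compact[OF compact_space]
          by (auto simp: continuous_map_into_metric_iff)
        ultimately have "dist (\<iota> (H x) \<theta>) (\<iota> (H' x) \<theta>) < e / 2" using d(1) by (intro d(2)) auto
        then show ?thesis by (simp add: z skew_product_def dist_Pair_Pair dist_commute)
      qed
      have "rotation_number g f' = rotation_number g (skew_product g \<iota> H')"
        if f': "forced_circle_homeo g f'" "\<forall>z. dist (f' z) (skew_product g \<iota> H' z) < e / 2" for f'
      proof -
        have "dist (f' z) (skew_product g \<iota> H z) < e" for z
          using f'(2)[rule_format, of z] close[of z] dist_triangle[of "f' z" "skew_product g \<iota> H z" "skew_product g \<iota> H' z"]
          by linarith
        then have "rotation_number g f' = rotation_number g (skew_product g \<iota> H)" by (intro e(2) f') blast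
        moreover have "dist (skew_product g \<iota> H' z) (skew_product g \<iota> H z) < e" for z
          using close[of z] e(1) by linarith
        then have "rotation_number g (skew_product g \<iota> H') = rotation_number g (skew_product g \<iota> H)"
          by (intro e(2) forced HH') blast
        ultimately show ?thesis by simp
      qed
      moreover have "e / 2 > 0" using e(1) by simp
      ultimately have "mode_locked g (skew_product g \<iota> H')"
        using forced[OF HH'(2)] unfolding mode_locked_def by blast
      with HH'(2) show "H' \<in> ?L" by (simp add: mem)
    qed
    with d(1) show ?thesis by (intro exI[of _ "d / 2"]) simp
  qed
  then have "openin M.mtopology ?L"
    unfolding M.openin_mtopology using mem by blast
  moreover have "M.mtopology closure_of ?L = mspace M"
    unfolding M.metric_closure_of
  proof (intro Collect_eqI[THEN trans, OF _ Collect_mem_eq] iffI conjI allI impI)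
    fix H and r :: real assume H: "H \<in> mspace M" and "r > 0"
    then obtain H' where "H' \<in> mspace M" "mode_locked g (skew_product g \<iota> H')" "mdist M H H' < r"
      using dense by blast
    with H show "\<exists>y\<in>?L. y \<in> M.mball H r" by (auto simp: mem)
  qed auto
  ultimately show ?thesis by (simp add: open_dense_in_def top)
qed

end

section \<open>Density for spaces of diffeomorphisms\<close>

lemma smooth_family_pullback:
  "smooth_family k S f \<Longrightarrow> continuous_on T p \<Longrightarrow> p ` T \<subseteq> S \<Longrightarrow> smooth_family k T (\<lambda>z. f (p z))"
proof -
  assume p: "continuous_on T p" "p ` T \<subseteq> S"
  have cont: "continuous_on (T \<times> UNIV) (\<lambda>(z, w). f (p z) w)" if "continuous_on (S \<times> UNIV) (\<lambda>(z, w). f z w)" for f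
  proof -
    have "continuous_on (T \<times> UNIV) (\<lambda>q. (p (fst q), snd q))"
      by (intro continuous_intros continuous_on_compose2[OF p(1)]) auto
    then have "continuous_on (T \<times> UNIV) (\<lambda>q. case (p (fst q), snd q) of (z, w) \<Rightarrow> f z w)"
      by (rule continuous_on_compose2[OF that]) (use p(2) in auto)
    then show ?thesis by (simp add: case_prod_beta)
  qed
  show "smooth_family k S f \<Longrightarrow> smooth_family k T (\<lambda>z. f (p z))"
  proof (induction k arbitrary: f)
    case 0
    then show ?case using cont by simp
  next
    case (Suc k)
    then obtain f' where d: "\<forall>z\<in>S. \<forall>w. (f z has_field_derivative f' z w) (at w)" "smooth_family k S f'" by auto
    show ?case
    proof (rule smooth_family_SucI)
      show "continuous_on (T \<times> UNIV) (\<lambda>(z, w). f (p z) w)" by (rule cont[OF smooth_family_continuous[OF Suc.prems]])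
      show "(f (p z) has_field_derivative f' (p z) w) (at w)" if "z \<in> T" for z w using d(1) p(2) that by blast
      show "smooth_family k T (\<lambda>z. f' (p z))" by (rule Suc.IH[OF d(2)])
    qed
  qed
qed

text \<open>The derivative cannot vanish because the inverse is differentiable too.\<close>

lemma lifted_Diff_deriv_pos:
  assumes h: "h \<in> lifted_Diff r" and r: "r \<ge> 1"
  shows "(h has_field_derivative deriv h w) (at w)" "deriv h w > 0"
proof -
  have one: "enat 1 \<le> r" using r by (simp add: one_enat_def)
  have C: "C_fun 1 h" "C_fun 1 (inv h)" "bij h" "strict_mono h"
    using h one by (auto simp: lifted_Diff_def Diff_real_def)
  have der: "(k has_field_derivative deriv k w) (at w)" if "C_fun 1 k" for k w
  proof -
    have "k differentiable_on UNIV" using that by (auto simp: C_fun_def)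
    then have "k differentiable (at w)" by (simp add: differentiable_on_def)
    then show ?thesis by (simp add: DERIV_deriv_iff_real_differentiable)
  qed
  show d: "(h has_field_derivative deriv h w) (at w)" by (rule der[OF C(1)])
  have "((\<lambda>w. inv h (h w)) has_field_derivative deriv (inv h) (h w) * deriv h w) (at w)"
    by (rule DERIV_chain2[OF der[OF C(2)] d])
  moreover have "(\<lambda>w. inv h (h w)) = (\<lambda>w. w)" using C(3) by (simp add: bij_is_inj)
  ultimately have "deriv (inv h) (h w) * deriv h w = 1" using DERIV_unique[OF _ DERIV_ident] by simp
  then have "deriv h w \<noteq> 0" by auto
  moreover have "\<not> deriv h w < 0"
  proof
    assume "deriv h w < 0"
    from DERIV_neg_dec_right[OF d this] obtain e where "e > 0" "\<forall>k>0. k < e \<longrightarrow> h (w + k) < h w" by blast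
    then have "h (w + e / 2) < h w" by simp
    moreover have "h w < h (w + e / 2)" using \<open>e > 0\<close> by (intro strict_monoD[OF C(4)]) simp
    ultimately show False by simp
  qed
  ultimately show "deriv h w > 0" by simp
qed

context compact_homeo
begin

lemma type1_derivative_bounded_below:
  assumes H: "continuous_map euclidean (mtopology_of (type1_metric r)) (H :: 'a \<Rightarrow> real \<Rightarrow> real)" and r: "r \<ge> 1"
  obtains c where "c > 0" "\<And>x w. c \<le> deriv (H x) w"
proof -
  have H_in: "H x \<in> lifted_Diff r" for x using H by (simp add: continuous_map_into_metric_iff)
  have one: "enat 1 \<le> r" using r by (simp add: one_enat_def)
  have "continuous_on (UNIV \<times> UNIV) (\<lambda>(x, w). (deriv ^^ 1) (H x) w)"
    by (rule smooth_family_continuous_higher_deriv[OF continuous_map_type1_smooth_family[OF H one]]) simp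
  then have cont: "continuous_on (UNIV \<times> {0..1}) (\<lambda>p. deriv (H (fst p)) (snd p))"
    unfolding case_prod_beta by (auto intro: continuous_on_subset)
  have "compact ((UNIV :: 'a set) \<times> {0..1::real})" by (intro compact_Times compact_space compact_Icc)
  moreover have "(UNIV :: 'a set) \<times> {0..1::real} \<noteq> {}" by auto
  ultimately obtain p where p: "\<And>q. q \<in> UNIV \<times> {0..1} \<Longrightarrow> deriv (H (fst p)) (snd p) \<le> deriv (H (fst q)) (snd q)"
    using continuous_attains_inf[OF _ _ cont] by blast
  show thesis
  proof (rule that)
    show "deriv (H (fst p)) (snd p) > 0" by (rule lifted_Diff_deriv_pos(2)[OF H_in r])
    fix x w
    have step: "H x (y + 1) = H x y + 1" for y using H_in[of x] by (simp add: lifted_Diff_def)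
    have "deriv (H x) (y + 1) = deriv (H x) y" for y
      using higher_deriv_shift1[of "H x", OF step, of 1 y] by simp
    then have "deriv (H x) w = deriv (H x) (frac w)" by (rule step_zero_imp_periodic[OF _ frac_diff_Ints])
    moreover have "(x, frac w) \<in> UNIV \<times> {0..1}" using frac_lt_1[of w] by simp
    ultimately show "deriv (H (fst p)) (snd p) \<le> deriv (H x) w" using p[of "(x, frac w)"] by simp
  qed
qed

text \<open>All perturbations with small coefficients form one smooth family over a compact parameter space,
in which the inverses are again a smooth family. Uniform continuity of this family then provides
an \<open>\<eta>\<close> that does not depend on the coefficient functions. A phase-shifted sine is written as a
combination of a sine and a cosine so that the parameters are real-valued functions on the base.\<close>

lemma type1_trigonometric_perturbation:
  assumes H: "continuous_map euclidean (mtopology_of (type1_metric r)) (H :: 'a \<Rightarrow> real \<Rightarrow> real)" and r: "r \<ge> 1"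
    and e: "e > 0"
  shows "\<exists>\<eta>>0. \<forall>t a b. continuous_on UNIV t \<and> continuous_on UNIV a \<and> continuous_on UNIV b \<and>
      (\<forall>x. \<bar>t x\<bar> \<le> \<eta> \<and> \<bar>a x\<bar> \<le> \<eta> \<and> \<bar>b x\<bar> \<le> \<eta>) \<longrightarrow>
      continuous_map euclidean (mtopology_of (type1_metric r))
        (\<lambda>x w. H x w + t x + a x * sin (2 * pi * w) + b x * cos (2 * pi * w)) \<and>
      (\<forall>x. mdist (type1_metric r) (H x) (\<lambda>w. H x w + t x + a x * sin (2 * pi * w) + b x * cos (2 * pi * w)) < e)"
proof -
  have H_in: "H x \<in> lifted_Diff r" for x using H by (simp add: continuous_map_into_metric_iff)
  obtain c where c: "c > 0" "\<And>x w. c \<le> deriv (H x) w"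
    using type1_derivative_bounded_below[OF H r] by blast
  \<comment> \<open>The derivative of the perturbation is then at most \<open>4 * pi * \<rho> = c / 2\<close>, half the lower bound for the derivative.\<close>
  define \<rho> where "\<rho> = c / (8 * pi)"
  have \<rho>: "\<rho> > 0" "4 * pi * \<rho> = c / 2" using c(1) by (auto simp: \<rho>_def)
  define S where "S = (UNIV :: 'a set) \<times> {-1..1::real} \<times> {-\<rho>..\<rho>} \<times> {-\<rho>..\<rho>}"
  define F where "F = (\<lambda>(x, t, a, b) w. H x w + t + a * sin (2 * pi * w) + b * cos (2 * pi * w))"
  have F_simp: "F (x, t, a, b) = (\<lambda>w. H x w + t + a * sin (2 * pi * w) + b * cos (2 * pi * w))" for x t a b
    by (simp add: F_def)
  have S: "compact S" unfolding S_def by (intro compact_Times compact_space compact_Icc)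
  have smooth: "smooth_family k S F" if k: "enat k \<le> r" for k
  proof -
    have "smooth_family k S (\<lambda>z w. H (fst z) w + fst (snd z) + fst (snd (snd z)) * sin (2 * pi * w)
        + snd (snd (snd z)) * cos (2 * pi * w))"
    proof (intro smooth_family_add smooth_family_mult)
      show "smooth_family k S (\<lambda>z. H (fst z))"
        by (rule smooth_family_pullback[OF continuous_map_type1_smooth_family[OF H k]]) (auto intro!: continuous_intros)
    qed (auto intro!: smooth_family_base continuous_intros
        conjunct1[OF smooth_family_sin_cos] conjunct2[OF smooth_family_sin_cos])
    then show ?thesis by (rule smooth_family_cong) (auto simp: F_def)
  qed
  have der: "\<exists>D>0. (F z has_field_derivative D) (at w)" if z: "z \<in> S" for z w
  proof -
    obtain x t a b where z_eq: "z = (x, t, a, b)" by (cases z)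
    let ?D = "deriv (H x) w + a * (cos (2 * pi * w) * (2 * pi)) - b * (sin (2 * pi * w) * (2 * pi))"
    have "(F z has_field_derivative ?D) (at w)"
      unfolding z_eq F_simp using lifted_Diff_deriv_pos(1)[OF H_in r, of x w] by (auto intro!: derivative_eq_intros)
    moreover have "?D > 0"
    proof -
      have ab: "\<bar>a\<bar> \<le> \<rho>" "\<bar>b\<bar> \<le> \<rho>" using z by (auto simp: z_eq S_def abs_le_iff)
      have "\<bar>a * (cos (2 * pi * w) * (2 * pi))\<bar> \<le> \<rho> * (1 * (2 * pi))"
        unfolding abs_mult using \<rho>(1) by (intro mult_mono ab abs_cos_le_one) auto
      moreover have "\<bar>b * (sin (2 * pi * w) * (2 * pi))\<bar> \<le> \<rho> * (1 * (2 * pi))"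
        unfolding abs_mult using \<rho>(1) by (intro mult_mono ab abs_sin_le_one) auto
      moreover have "\<rho> * (1 * (2 * pi)) = c / 4" using \<rho>(2) by (simp add: mult.commute)
      ultimately show ?thesis using c(1) c(2)[of x w] by linarith
    qed
    ultimately show ?thesis by blast
  qed
  have mono: "strict_mono (F z)" if "z \<in> S" for z
    unfolding strict_mono_def
  proof (intro allI impI)
    fix v w :: real assume "v < w"
    show "F z v < F z w"
    proof (rule DERIV_pos_imp_increasing[OF \<open>v < w\<close>])
      show "\<exists>D. (F z has_field_derivative D) (at y) \<and> D > 0" for y using der[OF that, of y] by blast
    qed
  qed
  have step: "F z (w + 1) = F z w + 1" for z w
  proof -
    obtain x t a b where z_eq: "z = (x, t, a, b)" by (cases z)
    have "2 * pi * (w + 1) = 2 * pi * w + 2 * pi" by (simp add: algebra_simps)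
    moreover have "H x (w + 1) = H x w + 1" using H_in[of x] by (simp add: lifted_Diff_def)
    ultimately show ?thesis unfolding z_eq F_simp by (simp only: sin_periodic cos_periodic)
  qed
  have bij: "bij (F z)" if z: "z \<in> S" for z
  proof -
    have cont: "continuous_on UNIV (F z)"
      unfolding continuous_on_eq_continuous_at[OF open_UNIV] using der[OF z] DERIV_isCont by blast
    have "continuous_on (UNIV :: (real \<times> real) set) (\<lambda>p. F z (snd p))"
      by (rule continuous_on_compose2[OF cont]) (auto intro!: continuous_intros)
    then have "fibre_lift (\<lambda>_ :: real. F z)"
      using mono[OF z] step by (simp add: fibre_lift_def case_prod_beta)
    then show ?thesis by (rule fibre_lift_bij)
  qed
  have smooth_inv: "smooth_family k S (\<lambda>z. inv (F z))" if k: "enat k \<le> r" for k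
  proof (rule smooth_family_inverse_function[OF _ _ _ smooth[OF k]])
    show "F z (inv (F z) y) = y" if "z \<in> S" for z y using bij[OF that] by (simp add: bij_is_surj surj_f_inv_f)
  qed (use mono der in auto)
  have F_in: "F z \<in> lifted_Diff r" if z: "z \<in> S" for z
    unfolding lifted_Diff_def Diff_real_def
    using bij[OF z] mono[OF z] step smooth_family_C_fun[OF smooth z] smooth_family_C_fun[OF smooth_inv z] by auto
  obtain d where d: "d > 0" "\<And>z z'. z \<in> S \<Longrightarrow> z' \<in> S \<Longrightarrow> dist z z' < d \<Longrightarrow> dist_Diff r (F z) (F z') < e"
    using dist_Diff_uniformly_small[OF S F_in smooth smooth_inv e] by blast
  define \<eta> where "\<eta> = min (min 1 \<rho>) (d / 4)"
  have \<eta>: "\<eta> > 0" "\<eta> \<le> 1" "\<eta> \<le> \<rho>" "\<eta> \<le> d / 4" using d(1) \<rho>(1) by (auto simp: \<eta>_def)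
  have dist4: "dist (x, t, a, b) (x, 0, 0, 0) \<le> \<bar>t\<bar> + \<bar>a\<bar> + \<bar>b\<bar>" for x :: 'a and t a b :: real
  proof -
    have pair: "dist (p, q) (p', q') \<le> dist p p' + dist q q'"
      for p p' :: "'p::metric_space" and q q' :: "'q::metric_space"
      unfolding dist_Pair_Pair by (rule sqrt_sum_squares_le_sum) auto
    have "dist (a, b) (0, 0) \<le> \<bar>a\<bar> + \<bar>b\<bar>" using pair[of a b 0 0] by (simp add: dist_real_def)
    moreover have "dist (t, a, b) (0, 0, 0) \<le> \<bar>t\<bar> + dist (a, b) (0, 0)"
      using pair[of t "(a, b)" 0 "(0, 0)"] by (simp add: dist_real_def)
    moreover have "dist (x, t, a, b) (x, 0, 0, 0) \<le> dist (t, a, b) (0, 0, 0)"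
      using pair[of x "(t, a, b)" x "(0, 0, 0)"] by simp
    ultimately show ?thesis by linarith
  qed
  show ?thesis
  proof (intro exI[of _ \<eta>] conjI[OF \<eta>(1)] allI impI, elim conjE)
    fix t a b :: "'a \<Rightarrow> real"
    assume cont: "continuous_on UNIV t" "continuous_on UNIV a" "continuous_on UNIV b"
      and "\<forall>x. \<bar>t x\<bar> \<le> \<eta> \<and> \<bar>a x\<bar> \<le> \<eta> \<and> \<bar>b x\<bar> \<le> \<eta>"
    then have small: "\<bar>t x\<bar> \<le> \<eta>" "\<bar>a x\<bar> \<le> \<eta>" "\<bar>b x\<bar> \<le> \<eta>" for x by auto
    define p where "p x = (x, t x, a x, b x)" for x
    have "\<bar>t x\<bar> \<le> 1" "\<bar>a x\<bar> \<le> \<rho>" "\<bar>b x\<bar> \<le> \<rho>" for x using small[of x] \<eta>(2,3) by auto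
    then have p_in: "p x \<in> S" for x unfolding p_def S_def by (auto simp: abs_le_iff) (smt (verit))+
    have Fp: "F (p x) = (\<lambda>w. H x w + t x + a x * sin (2 * pi * w) + b x * cos (2 * pi * w))" for x
      by (simp add: p_def F_simp)
    have p_cont: "continuous_on UNIV p" unfolding p_def by (intro continuous_intros cont)
    have "continuous_map euclidean (mtopology_of (type1_metric r)) (\<lambda>x. F (p x))"
      unfolding continuous_map_into_metric_iff
    proof (intro conjI allI impI)
      show "F (p x) \<in> mspace (type1_metric r)" for x using F_in[OF p_in] by simp
      fix x and e' :: real assume e': "e' > 0"
      obtain d' where d': "d' > 0" "\<And>z z'. z \<in> S \<Longrightarrow> z' \<in> S \<Longrightarrow> dist z z' < d' \<Longrightarrow> dist_Diff r (F z) (F z') < e'"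
        using dist_Diff_uniformly_small[OF S F_in smooth smooth_inv e'] by blast
      obtain s where "s > 0" "\<And>y. dist y x < s \<Longrightarrow> dist (p y) (p x) < d'"
        using p_cont d'(1) unfolding continuous_on_iff by (metis UNIV_I)
      then show "\<exists>s>0. \<forall>y. dist y x < s \<longrightarrow> mdist (type1_metric r) (F (p x)) (F (p y)) < e'"
        using d'(2)[OF p_in p_in]
        by (auto simp: mdist_type1_metric[OF F_in[OF p_in] F_in[OF p_in]] dist_commute intro!: exI[of _ s])
    qed
    moreover have "mdist (type1_metric r) (H x) (F (p x)) < e" for x
    proof -
      have z: "(x, 0, 0, 0) \<in> S" using \<rho>(1) by (simp add: S_def)
      have "dist (p x) (x, 0, 0, 0) \<le> \<bar>t x\<bar> + \<bar>a x\<bar> + \<bar>b x\<bar>" unfolding p_def by (rule dist4)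
      then have "dist (x, 0, 0, 0) (p x) < d" using small[of x] \<eta>(4) d(1) dist_commute[of "p x" "(x, 0, 0, 0)"] by linarith
      from d(2)[OF z p_in this] have "dist_Diff r (H x) (F (p x)) < e" by (simp add: F_simp)
      then show ?thesis by (simp add: mdist_type1_metric[OF H_in F_in[OF p_in]])
    qed
    ultimately show "continuous_map euclidean (mtopology_of (type1_metric r))
        (\<lambda>x w. H x w + t x + a x * sin (2 * pi * w) + b x * cos (2 * pi * w)) \<and>
      (\<forall>x. mdist (type1_metric r) (H x) (\<lambda>w. H x w + t x + a x * sin (2 * pi * w) + b x * cos (2 * pi * w)) < e)"
      by (simp add: Fp)
  qed
qed

lemma type1_fibre_lift:
  assumes H: "continuous_map euclidean (mtopology_of (type1_metric r)) (H :: 'a \<Rightarrow> real \<Rightarrow> real)"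
  shows "fibre_lift H" "skew_product g type1_action H = circle_map g H"
proof -
  have H_in: "H x \<in> lifted_Diff r" for x using H by (simp add: continuous_map_into_metric_iff)
  have "continuous_on (UNIV \<times> UNIV) (\<lambda>(x, w). H x w)"
    using continuous_map_type1_smooth_family[OF H, of 0] by (simp add: zero_enat_def[symmetric])
  then show "fibre_lift H" using H_in by (auto simp: fibre_lift_def lifted_Diff_def)
  show "skew_product g type1_action H = circle_map g H"
    by (simp add: skew_product_def circle_map_def type1_action_def fun_eq_iff)
qed

end

context unique_ergodic
begin

lemma integral_continuous_less:
  fixes a b :: "'a \<Rightarrow> real"
  assumes "continuous_on UNIV a" "continuous_on UNIV b" "\<And>x. a x \<le> b x"
    and A: "open A" "emeasure \<nu> A \<noteq> 0" "\<And>x. x \<in> A \<Longrightarrow> a x < b x"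
  shows "(\<integral>x. a x \<partial>\<nu>) < (\<integral>x. b x \<partial>\<nu>)"
proof (rule integral_less_AE[where A = A])
  have sets: "sets \<nu> = sets borel" using invariant by (simp add: invariant_prob_def)
  have int: "integrable \<nu> c" if c: "continuous_on UNIV c" for c :: "'a \<Rightarrow> real"
  proof -
    obtain B where "\<And>x. \<bar>c x\<bar> \<le> B" using continuous_real_bounded[OF c] by blast
    then show ?thesis
      using borel_measurable_continuous_onI[OF c] sets
      by (intro integrable_const_bound[where B = B]) (auto cong: measurable_cong_sets)
  qed
  show "integrable \<nu> a" "integrable \<nu> b" using assms by (auto intro: int)
  show "A \<in> sets \<nu>" using A(1) sets by simp
  show "AE x in \<nu>. x \<in> A \<longrightarrow> a x \<noteq> b x" using A(3) by (intro AE_I2) force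
qed (use assms in auto)

text \<open>With \<open>t\<close> making \<open>u\<close> invariant, the maps \<open>H' c\<close> below add \<open>c * sin (2 * pi * (w - \<theta> x))\<close>, which
vanishes on the section \<open>\<theta>\<close> and increases the derivative there by \<open>2 * pi * c\<close>. The exponents for \<open>c = 0\<close>
and \<open>c = \<eta>\<close> differ, so one of the two is not zero.\<close>

lemma type1_mode_locked_nearby:
  assumes dense: "closure (schwartzman_range g \<nu>) = UNIV"
    and H: "continuous_map euclidean (mtopology_of (type1_metric r)) (H :: 'a \<Rightarrow> real \<Rightarrow> real)" and r: "r \<ge> 1"
    and e: "e > 0"
  shows "\<exists>H'. continuous_map euclidean (mtopology_of (type1_metric r)) H' \<and>
    mode_locked g (skew_product g type1_action H') \<and> (\<forall>x. mdist (type1_metric r) (H x) (H' x) \<le> e)"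
proof -
  have one: "enat 1 \<le> r" using r by (simp add: one_enat_def)
  obtain \<eta> where \<eta>: "\<eta> > 0" "\<forall>t a b. continuous_on UNIV t \<and> continuous_on UNIV a \<and> continuous_on UNIV b \<and>
      (\<forall>x. \<bar>t x\<bar> \<le> \<eta> \<and> \<bar>a x\<bar> \<le> \<eta> \<and> \<bar>b x\<bar> \<le> \<eta>) \<longrightarrow>
      continuous_map euclidean (mtopology_of (type1_metric r))
        (\<lambda>x w. H x w + t x + a x * sin (2 * pi * w) + b x * cos (2 * pi * w)) \<and>
      (\<forall>x. mdist (type1_metric r) (H x) (\<lambda>w. H x w + t x + a x * sin (2 * pi * w) + b x * cos (2 * pi * w)) < e)"
    using type1_trigonometric_perturbation[OF H r e] by blast
  note lift = type1_fibre_lift[OF H]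
  from dense lift(1) \<eta>(1) show ?thesis
  proof (cases rule: mode_locked_or_almost_invariant_section)
    case 1
    moreover have "mdist (type1_metric r) (H x) (H x) = 0" for x
      using H by (intro Metric_space.mdist_zero[OF Metric_space_mspace_mdist]) (simp add: continuous_map_into_metric_iff)
    ultimately show ?thesis using H lift(2) e by (intro exI[of _ H]) auto
  next
    case (2 \<psi> \<phi> u)
    define t where "t x = u (g x) - twist \<psi> \<phi> H x (u x)" for x
    define \<theta> where "\<theta> x = u x + rep_circle (\<psi> x)" for x
    have t_cont: "continuous_on UNIV t"
      unfolding t_def
      by (intro continuous_intros fibre_lift_continuous[OF fibre_lift_twist[OF lift(1) 2(1,2)]] 2(4)
          continuous_on_compose2[OF 2(4) g_continuous]) auto
    have t_small: "\<bar>t x\<bar> \<le> \<eta>" for x using 2(5)[of x] by (simp add: t_def abs_minus_commute)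
    have trig_cont: "continuous_on UNIV (\<lambda>x. k (\<theta> x))" if k: "continuous_on UNIV k" "\<And>w v. w - v \<in> \<int> \<Longrightarrow> k w = k v"
      for k :: "real \<Rightarrow> real"
    proof -
      have "continuous_on UNIV (\<lambda>(x :: 'a, w). k w)"
        unfolding case_prod_beta by (rule continuous_on_compose2[OF k(1)]) (auto intro!: continuous_intros)
      from periodic_twist_continuous[OF this k(2) 2(1)]
      have "continuous_on UNIV (\<lambda>(x, w). k (w + rep_circle (\<psi> x)))" .
      from continuous_on_compose2[OF this continuous_on_Pair[OF continuous_on_id 2(4)]]
      show ?thesis by (simp add: \<theta>_def)
    qed
    have shift: "2 * pi * (w + 1) = 2 * pi * w + 2 * pi" for w by (simp add: algebra_simps)
    have per: "sin (2 * pi * w) = sin (2 * pi * v)" "cos (2 * pi * w) = cos (2 * pi * v)"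
      if "w - v \<in> \<int>" for w v :: real
      using \<open>w - v \<in> \<int>\<close>
      by (rule step_zero_imp_periodic[rotated]; simp only: shift sin_periodic cos_periodic)+
    have sc: "continuous_on UNIV (\<lambda>x. sin (2 * pi * \<theta> x))" "continuous_on UNIV (\<lambda>x. cos (2 * pi * \<theta> x))"
      by (rule trig_cont; auto intro!: continuous_intros per)+
    define H' where "H' c x w =
        H x w + t x + (c * cos (2 * pi * \<theta> x)) * sin (2 * pi * w) + (- c * sin (2 * pi * \<theta> x)) * cos (2 * pi * w)"
      for c x w
    have H': "continuous_map euclidean (mtopology_of (type1_metric r)) (H' c)"
      "mdist (type1_metric r) (H x) (H' c x) < e" if c: "0 \<le> c" "c \<le> \<eta>" for c x
    proof -
      have bnd: "\<bar>c * cos v\<bar> \<le> \<eta>" "\<bar>- c * sin v\<bar> \<le> \<eta>" for v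
        using mult_mono[OF c(2) abs_cos_le_one[of v]] mult_mono[OF c(2) abs_sin_le_one[of v]] c \<eta>(1)
        by (auto simp: abs_mult)
      have "continuous_map euclidean (mtopology_of (type1_metric r)) (\<lambda>x w. H' c x w) \<and>
          (\<forall>x. mdist (type1_metric r) (H x) (\<lambda>w. H' c x w) < e)"
        unfolding H'_def
        by (rule \<eta>(2)[rule_format], intro conjI allI t_small bnd) (intro continuous_intros t_cont sc)+
      then show "continuous_map euclidean (mtopology_of (type1_metric r)) (H' c)"
        "mdist (type1_metric r) (H x) (H' c x) < e" by auto
    qed
    define D where "D c x = deriv (H' c x) (\<theta> x)" for c x
    have H_in: "H x \<in> lifted_Diff r" for x using H by (simp add: continuous_map_into_metric_iff)
    have D_eq: "D c x = deriv (H x) (\<theta> x) + 2 * pi * c" for c x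
    proof -
      have "(H' c x has_field_derivative deriv (H x) (\<theta> x) + (c * cos (2 * pi * \<theta> x)) * (cos (2 * pi * \<theta> x) * (2 * pi))
          - (- c * sin (2 * pi * \<theta> x)) * (sin (2 * pi * \<theta> x) * (2 * pi))) (at (\<theta> x))"
        unfolding H'_def using lifted_Diff_deriv_pos(1)[OF H_in r, of x "\<theta> x"] by (auto intro!: derivative_eq_intros)
      also have "deriv (H x) (\<theta> x) + (c * cos (2 * pi * \<theta> x)) * (cos (2 * pi * \<theta> x) * (2 * pi))
          - (- c * sin (2 * pi * \<theta> x)) * (sin (2 * pi * \<theta> x) * (2 * pi))
          = deriv (H x) (\<theta> x) + 2 * pi * c * ((sin (2 * pi * \<theta> x))\<^sup>2 + (cos (2 * pi * \<theta> x))\<^sup>2)"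
      proof -
        have "A + (c * C) * (C * (2 * pi)) - (- c * S) * (S * (2 * pi)) = A + 2 * pi * c * (S\<^sup>2 + C\<^sup>2)" for A C S :: real
          by (simp add: power2_eq_square algebra_simps)
        then show ?thesis .
      qed
      also have "\<dots> = deriv (H x) (\<theta> x) + 2 * pi * c" unfolding sin_cos_squared_add by simp
      finally show ?thesis unfolding D_def by (rule DERIV_imp_deriv)
    qed
    have pos: "deriv (H' c x) w > 0" "(H' c x has_field_derivative deriv (H' c x) w) (at w)" if "0 \<le> c" "c \<le> \<eta>" for c x w
    proof -
      have "H' c x \<in> lifted_Diff r" using H'(1)[OF that] by (simp add: continuous_map_into_metric_iff)
      then show "deriv (H' c x) w > 0" "(H' c x has_field_derivative deriv (H' c x) w) (at w)"
        using lifted_Diff_deriv_pos r by blast+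
    qed
    have deriv_cont: "continuous_on UNIV (\<lambda>(x, w). deriv (H' c x) w)" if "0 \<le> c" "c \<le> \<eta>" for c
      using smooth_family_continuous_higher_deriv[OF continuous_map_type1_smooth_family[OF H'(1)[OF that] one], of 1]
      by simp
    have locked: "mode_locked g (skew_product g type1_action (H' c))"
      if c: "0 \<le> c" "c \<le> \<eta>" and nz: "(\<integral>x. ln (D c x) \<partial>\<nu>) \<noteq> 0" for c
      unfolding type1_fibre_lift(2)[OF H'(1)[OF c]]
    proof (rule hyperbolic_section_mode_locked[OF type1_fibre_lift(1)[OF H'(1)[OF c]]
          pos(2)[OF c] deriv_cont[OF c] pos(1)[OF c] 2(1,2,3,4)])
      show "twist \<psi> \<phi> (H' c) x (u x) = u (g x)" for x
      proof -
        have "H' c x (\<theta> x) = H x (\<theta> x) + t x" by (simp add: H'_def)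
        then show ?thesis unfolding twist_def t_def \<theta>_def by simp
      qed
      show "(\<integral>x. ln (deriv (H' c x) (u x + rep_circle (\<psi> x))) \<partial>\<nu>) \<noteq> 0"
        using nz by (simp add: D_def \<theta>_def)
    qed
    have D_pos: "D 0 x > 0" for x unfolding D_def by (rule pos) (use \<eta>(1) in auto)
    have D_cont: "continuous_on UNIV (D 0)"
    proof -
      have c0: "(0::real) \<le> 0" "0 \<le> \<eta>" using \<eta>(1) by auto
      have "deriv (H' 0 x) w = deriv (H' 0 x) v" if "w - v \<in> \<int>" for x w v
        using \<open>w - v \<in> \<int>\<close>
      proof (rule step_zero_imp_periodic[rotated])
        have step: "H' 0 x (y + 1) = H' 0 x y + 1" for y
          by (rule fibre_liftD(3)[OF type1_fibre_lift(1)[OF H'(1)[OF c0]]])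
        show "deriv (H' 0 x) (y + 1) = deriv (H' 0 x) y" for y
          using higher_deriv_shift1[of "H' 0 x", OF step, of 1 y] by simp
      qed
      from periodic_twist_continuous[OF deriv_cont[OF c0] this 2(1)]
      have "continuous_on UNIV (\<lambda>(x, w). deriv (H' 0 x) (w + rep_circle (\<psi> x)))" .
      from continuous_on_compose2[OF this continuous_on_Pair[OF continuous_on_id 2(4)]]
      show ?thesis by (simp add: D_def[abs_def] \<theta>_def)
    qed
    have "(\<integral>x. ln (D 0 x) \<partial>\<nu>) < (\<integral>x. ln (D \<eta> x) \<partial>\<nu>)"
    proof (rule integral_continuous_less[where A = UNIV])
      have D\<eta>: "D \<eta> x = D 0 x + 2 * pi * \<eta>" for x by (simp add: D_eq)
      have "2 * pi * \<eta> > 0" using \<eta>(1) by simp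
      then have lt: "ln (D 0 x) < ln (D \<eta> x)" for x
        unfolding D\<eta> using D_pos[of x] by (subst ln_less_cancel_iff) linarith+
      then show "ln (D 0 x) < ln (D \<eta> x)" "ln (D 0 x) \<le> ln (D \<eta> x)" for x using less_imp_le by blast+
      have nz: "D 0 x \<noteq> 0" "D 0 x + 2 * pi * \<eta> \<noteq> 0" for x
      proof -
        have "2 * pi * \<eta> > 0" using \<eta>(1) by simp
        then show "D 0 x \<noteq> 0" "D 0 x + 2 * pi * \<eta> \<noteq> 0" using D_pos[of x] by linarith+
      qed
      show "continuous_on UNIV (\<lambda>x. ln (D 0 x))" "continuous_on UNIV (\<lambda>x. ln (D \<eta> x))"
        unfolding D\<eta> using nz by (auto intro!: continuous_on_ln continuous_intros D_cont)
      show "emeasure \<nu> UNIV \<noteq> 0"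
        using emeasure_space_1 sets_eq_imp_space_eq[of \<nu> borel] invariant by (auto simp: invariant_prob_def)
    qed simp
    then obtain c where "0 \<le> c" "c \<le> \<eta>" "(\<integral>x. ln (D c x) \<partial>\<nu>) \<noteq> 0"
      using \<eta>(1) by (metis less_irrefl less_imp_le order_refl)
    with H' locked show ?thesis by (intro exI[of _ "H' c"]) (auto intro: less_imp_le)
  qed
qed

end

section \<open>Real analytic functions\<close>

lemma real_analytic_deriv:
  assumes f: "real_analytic f"
  shows "(f has_field_derivative deriv f x) (at x)" "real_analytic (deriv f)"
proof -
  have local: "\<exists>a r. r > 0 \<and> (\<forall>y. \<bar>y - x\<bar> < r \<longrightarrow> (\<lambda>n. a n * (y - x) ^ n) sums f y \<and>
      (f has_field_derivative deriv f y) (at y) \<and> (\<lambda>n. diffs a n * (y - x) ^ n) sums deriv f y)" for x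
  proof -
    obtain a r where r: "r > 0" and a: "\<And>y. \<bar>y - x\<bar> < r \<Longrightarrow> (\<lambda>n. a n * (y - x) ^ n) sums f y"
      using f unfolding real_analytic_def by blast
    define h where "h z = f (z + x)" for z
    have h: "(\<lambda>n. a n * z ^ n) sums h z" if "norm z < r" for z
      using a[of "z + x"] that by (simp add: h_def)
    have der_h: "(h has_field_derivative (\<Sum>n. diffs a n * z ^ n)) (at z)" if z: "norm z < r" for z
    proof -
      have "((\<lambda>z. \<Sum>n. a n * z ^ n) has_field_derivative (\<Sum>n. diffs a n * z ^ n)) (at z)"
        by (rule termdiffs_strong'[of r]) (use h sums_summable z in blast)+
      moreover have "\<forall>\<^sub>F z' in nhds z. h z' = (\<Sum>n. a n * z' ^ n)"
      proof -
        have "open (ball 0 r)" "z \<in> ball 0 r" using z by auto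
        then have "\<forall>\<^sub>F z' in nhds z. z' \<in> ball 0 r" by (rule eventually_nhds_in_open)
        then show ?thesis by eventually_elim (use h sums_unique in auto)
      qed
      ultimately show ?thesis by (subst DERIV_cong_ev[OF refl _ refl])
    qed
    have "(f has_field_derivative deriv f y) (at y) \<and> (\<lambda>n. diffs a n * (y - x) ^ n) sums deriv f y"
      if y: "\<bar>y - x\<bar> < r" for y
    proof -
      have z: "norm (y - x) < r" using y by simp
      have "(f has_field_derivative (\<Sum>n. diffs a n * (y - x) ^ n)) (at ((y - x) + x))"
        using der_h[OF z] unfolding h_def DERIV_shift .
      then have d: "(f has_field_derivative (\<Sum>n. diffs a n * (y - x) ^ n)) (at y)" by simp
      then have eq: "deriv f y = (\<Sum>n. diffs a n * (y - x) ^ n)" by (rule DERIV_imp_deriv)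
      have "(\<lambda>n. diffs a n * (y - x) ^ n) sums (\<Sum>n. diffs a n * (y - x) ^ n)"
        by (rule termdiffs_sums_strong[OF h der_h[OF z] z])
      with d eq show ?thesis by simp
    qed
    with a r show ?thesis by blast
  qed
  from local[of x] show "(f has_field_derivative deriv f x) (at x)" by (metis abs_zero diff_self)
  show "real_analytic (deriv f)"
    unfolding real_analytic_def using local by meson
qed

text \<open>The interior of the zero set is closed: a limit point of it is a non-isolated zero, which forces
all coefficients of the power series there to vanish.\<close>

lemma real_analytic_identity:
  assumes f: "real_analytic f" and d: "d > 0" and zero: "\<And>y. \<bar>y - x0\<bar> < d \<Longrightarrow> f y = 0"
  shows "f x = 0"
proof -
  define Z where "Z = {x. \<exists>d>0. \<forall>y. \<bar>y - x\<bar> < d \<longrightarrow> f y = 0}"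
  have "open Z"
    unfolding open_dist
  proof
    fix x assume "x \<in> Z"
    then obtain d where d: "d > 0" "\<And>y. \<bar>y - x\<bar> < d \<Longrightarrow> f y = 0" by (auto simp: Z_def)
    have "y \<in> Z" if "dist y x < d / 2" for y
      unfolding Z_def
    proof (intro CollectI exI[of _ "d / 2"] conjI allI impI)
      fix v assume "\<bar>v - y\<bar> < d / 2"
      with that show "f v = 0" unfolding dist_real_def by (intro d(2)) linarith
    qed (use d in simp)
    with d(1) show "\<exists>e>0. \<forall>y. dist y x < e \<longrightarrow> y \<in> Z" by (intro exI[of _ "d / 2"]) auto
  qed
  moreover have "closure Z \<subseteq> Z"
  proof
    fix x assume "x \<in> closure Z"
    then have x: "\<forall>e>0. \<exists>y\<in>Z. dist y x < e" by (simp add: closure_approachable)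
    have near: "\<exists>y. y \<noteq> x \<and> \<bar>y - x\<bar> < s \<and> f y = 0" if s: "s > 0" for s
    proof -
      obtain y where y: "y \<in> Z" "dist y x < s / 2" using x s by (metis half_gt_zero)
      obtain d where d: "d > 0" "\<And>v. \<bar>v - y\<bar> < d \<Longrightarrow> f v = 0" using y(1) by (auto simp: Z_def)
      define h where "h = min (d / 2) (s / 4)"
      have h: "h > 0" "h < d" "h < s / 2" using d(1) s by (auto simp: h_def)
      show ?thesis
      proof (cases "y = x")
        case True
        then show ?thesis using h s by (intro exI[of _ "y + h"]) (auto intro!: d(2))
      next
        case False
        then show ?thesis using y(2) d s by (intro exI[of _ y]) (auto simp: dist_real_def)
      qed
    qed
    have fx: "f x = 0"
    proof (rule ccontr)
      assume "f x \<noteq> 0"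
      have "isCont f x" by (rule DERIV_isCont[OF real_analytic_deriv(1)[OF f]])
      then obtain s where s: "s > 0" "\<And>y. dist y x < s \<Longrightarrow> dist (f y) (f x) < \<bar>f x\<bar>"
        using \<open>f x \<noteq> 0\<close> unfolding continuous_at_eps_delta by (metis dist_norm real_norm_def zero_less_abs_iff dist_real_def)
      from near[OF s(1)] obtain y where "dist y x < s" "f y = 0" by (auto simp: dist_real_def)
      with s(2)[of y] show False by (simp add: dist_real_def)
    qed
    obtain a r where r: "r > 0" and a: "\<And>y. \<bar>y - x\<bar> < r \<Longrightarrow> (\<lambda>n. a n * (y - x) ^ n) sums f y"
      using f unfolding real_analytic_def by blast
    have "a m = 0" if m: "m > 0" for m
    proof (rule ccontr)
      assume "a m \<noteq> 0"
      have sm: "(\<lambda>n. a n * (y - x) ^ n) sums f y" if "norm (y - x) < r" for y using a that by simp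
      obtain s where s: "0 < s" "\<And>z. z \<in> cball x s - {x} \<Longrightarrow> f z \<noteq> 0"
        using powser_0_nonzero[OF r sm fx \<open>a m \<noteq> 0\<close> m] by blast
      from near[OF s(1)] obtain y where "y \<noteq> x" "\<bar>y - x\<bar> < s" "f y = 0" by blast
      with s(2)[of y] show False by (simp add: dist_real_def abs_minus_commute)
    qed
    moreover have "a 0 = 0"
    proof -
      have "(\<lambda>n. a n * (x - x) ^ n) sums f x" by (rule a) (use r in simp)
      then have "a 0 = f x" by (simp add: powser_sums_zero_iff)
      with fx show ?thesis by simp
    qed
    ultimately have az: "a m = 0" for m by (cases m) auto
    have "f y = 0" if "\<bar>y - x\<bar> < r" for y
      using sums_unique2[OF a[OF that], of 0] by (simp add: az)
    with r show "x \<in> Z" by (auto simp: Z_def)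
  qed
  then have "closed Z" by (simp add: closure_subset_eq)
  moreover have "x0 \<in> Z" using d zero by (auto simp: Z_def)
  ultimately have "Z = UNIV" using clopen[of Z] by blast
  then have "x \<in> Z" by simp
  then obtain d where "d > 0" "\<And>y. \<bar>y - x\<bar> < d \<Longrightarrow> f y = 0" by (auto simp: Z_def)
  then show ?thesis by simp
qed

section \<open>Density for rotations of an analytic map\<close>

lemma to_circle_eqI: "w - v \<in> \<int> \<Longrightarrow> to_circle w = to_circle v"
  by (simp add: to_circle_eq_iff)

locale type2_data =
  fixes P :: "circle \<Rightarrow> real"
  assumes P: "type2_potential P"
begin

definition p :: "real \<Rightarrow> real" where "p w = P (to_circle w)"

lemma p_analytic: "real_analytic p" and p_small: "(SUP y. \<bar>deriv p y\<bar>) < 1"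
  using P by (simp_all add: type2_potential_def p_def[abs_def])

lemma p_periodic: "w - v \<in> \<int> \<Longrightarrow> p w = p v"
  unfolding p_def by (simp only: to_circle_eqI)

lemmas p_deriv = real_analytic_deriv(1)[OF p_analytic]
lemmas p'_deriv = real_analytic_deriv(1)[OF real_analytic_deriv(2)[OF p_analytic]]

lemma p'_periodic:
  assumes "w - v \<in> \<int>"
  shows "deriv p w = deriv p v"
proof -
  obtain m where "w - v = of_int m" using assms by (rule Ints_cases)
  then have w: "w = v + of_int m" by simp
  have "((\<lambda>w. p (w + of_int m)) has_field_derivative deriv p w) (at v)"
    using p_deriv[of w] unfolding w DERIV_shift .
  moreover have "(\<lambda>w. p (w + of_int m)) = p" by (rule ext, rule p_periodic) simp
  ultimately show ?thesis using DERIV_unique p_deriv by metis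
qed

lemma p_continuous: "continuous_on S p" and p'_continuous: "continuous_on S (deriv p)"
  and p''_continuous: "continuous_on S (deriv (deriv p))"
  using DERIV_isCont[OF p_deriv] DERIV_isCont[OF p'_deriv]
    DERIV_isCont[OF real_analytic_deriv(1)[OF real_analytic_deriv(2)[OF real_analytic_deriv(2)[OF p_analytic]]]]
  by (auto intro: continuous_at_imp_continuous_on)

lemma p'_bound: "\<bar>deriv p w\<bar> < 1"
proof -
  have "bounded (range (deriv p))"
    by (rule bounded_range_periodic[OF p'_continuous]) (rule p'_periodic, simp)
  then obtain B where "\<And>y. \<bar>deriv p y\<bar> \<le> B" by (auto simp: bounded_iff)
  then have "bdd_above (range (\<lambda>y. \<bar>deriv p y\<bar>))" by (intro bdd_aboveI2)
  from cSUP_upper[OF UNIV_I this, of w] p_small show ?thesis by simp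
qed

lemma p_lipschitz: "\<bar>p w - p v\<bar> \<le> \<bar>w - v\<bar>"
proof -
  have "norm (p w - p v) \<le> 1 * norm (w - v)"
  proof (rule field_differentiable_bound[of UNIV p "deriv p" 1])
    show "(p has_field_derivative deriv p z) (at z within UNIV)" for z using p_deriv by simp
    show "norm (deriv p z) \<le> 1" for z using p'_bound[of z] by simp
  qed auto
  then show ?thesis by simp
qed

text \<open>If the second derivative vanished on an interval, it would vanish everywhere, and a periodic
affine function is constant.\<close>

lemma p''_nonzero_dense:
  assumes "\<eta> > 0"
  obtains s where "\<bar>s\<bar> < \<eta>" "deriv (deriv p) (w + s) \<noteq> 0"
proof (rule ccontr)
  assume "\<not> thesis"
  with that have z: "deriv (deriv p) (w + s) = 0" if "\<bar>s\<bar> < \<eta>" for s using \<open>\<bar>s\<bar> < \<eta>\<close> by blast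
  have "deriv (deriv p) y = 0" if "\<bar>y - w\<bar> < \<eta>" for y using z[OF that] by simp
  from real_analytic_identity[OF real_analytic_deriv(2)[OF real_analytic_deriv(2)[OF p_analytic]] assms this]
  have "(deriv p has_field_derivative 0) (at y)" for y using p'_deriv[of y] by simp
  then obtain c where c: "deriv p y = c" for y using DERIV_isconst_all by metis
  have "((\<lambda>y. p y - c * y) has_field_derivative 0) (at y)" for y
    using p_deriv[of y] by (auto intro!: derivative_eq_intros simp: c)
  then have const: "p y - c * y = p v - c * v" for y v
    using DERIV_isconst_all[of "\<lambda>y. p y - c * y"] by blast
  have "p 1 = p 0" by (rule p_periodic) simp
  with const[of 1 0] have "c = 0" by simp
  with const have "p y = p 0" for y by (metis diff_0_right mult_zero_left)
  then have "P \<theta> = p 0" for \<theta> unfolding p_def by (metis to_circle_rep)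
  with P show False unfolding type2_potential_def by blast
qed

end


definition type2_lift :: "(circle \<Rightarrow> real) \<Rightarrow> ('a \<Rightarrow> real) \<Rightarrow> 'a \<Rightarrow> real \<Rightarrow> real"
  where "type2_lift P K x w = w + P (to_circle w) + K x"

lemma (in type2_data) type2_lift_deriv: "(type2_lift P K x has_field_derivative 1 + deriv p w) (at w)"
  unfolding type2_lift_def[abs_def] p_def[symmetric] using p_deriv[of w] by (auto intro!: derivative_eq_intros)

lemma type2_fibre_lift:
  fixes K :: "'a::metric_space \<Rightarrow> real"
  assumes P: "type2_potential P"
  shows "continuous_on UNIV K \<Longrightarrow> fibre_lift (type2_lift P K)"
    and "skew_product g (type2_action P) K = circle_map g (type2_lift P K)"
proof -
  interpret type2_data P by standard (rule P)
  show "fibre_lift (type2_lift P K)" if K: "continuous_on UNIV K"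
    unfolding fibre_lift_def
  proof (intro conjI allI)
    show "continuous_on UNIV (\<lambda>(x, w). type2_lift P K x w)"
      unfolding type2_lift_def p_def[symmetric] case_prod_beta
      by (intro continuous_intros continuous_on_compose2[OF K] continuous_on_compose2[OF p_continuous[of UNIV]]) auto
    show "strict_mono (type2_lift P K x)" for x
      unfolding strict_mono_def
    proof (intro allI impI)
      fix v w :: real assume "v < w"
      then show "type2_lift P K x v < type2_lift P K x w"
      proof (rule DERIV_pos_imp_increasing)
        fix y
        have "1 + deriv p y > 0" using p'_bound[of y] by simp
        then show "\<exists>D. (type2_lift P K x has_field_derivative D) (at y) \<and> D > 0"
          by (intro exI[of _ "1 + deriv p y"] conjI type2_lift_deriv)
      qed
    qed
    show "type2_lift P K x (w + 1) = type2_lift P K x w + 1" for x w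
      using p_periodic[of "w + 1" w] by (simp add: type2_lift_def p_def)
  qed
  show "skew_product g (type2_action P) K = circle_map g (type2_lift P K)"
  proof
    fix z :: "'a \<times> circle"
    obtain x \<theta> where z: "z = (x, \<theta>)" by (cases z)
    show "skew_product g (type2_action P) K z = circle_map g (type2_lift P K) z"
      using type2_action_to_circle[of P "K x" "rep_circle \<theta>"]
      by (simp add: z skew_product_def circle_map_def type2_lift_def)
  qed
qed

context unique_ergodic
begin

text \<open>Otherwise finitely many null sets would cover the compact space.\<close>

lemma support_point_exists:
  obtains x0 where "\<And>U. open U \<Longrightarrow> x0 \<in> U \<Longrightarrow> emeasure \<nu> U \<noteq> 0"
proof (rule ccontr)
  assume "\<not> thesis"
  then have "\<forall>x. \<exists>U. open U \<and> x \<in> U \<and> emeasure \<nu> U = 0" using that by blast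
  then obtain U where U: "\<And>x. open (U x)" "\<And>x. x \<in> U x" "\<And>x. emeasure \<nu> (U x) = 0" by metis
  obtain T where T: "finite T" "(UNIV :: 'a set) \<subseteq> (\<Union>x\<in>T. U x)"
    by (rule compactE_image[OF compact_space, of UNIV U]) (use U in auto)
  have sets: "sets \<nu> = sets borel" using invariant by (simp add: invariant_prob_def)
  have "U x \<in> null_sets \<nu>" for x using U(1,3)[of x] sets by (intro null_setsI) auto
  then have "(\<Union>x\<in>T. U x) \<in> null_sets \<nu>" using T(1) by (intro null_sets.finite_UN) auto
  moreover have "(\<Union>x\<in>T. U x) = space \<nu>" using T(2) sets_eq_imp_space_eq[OF sets] by auto
  ultimately show False using emeasure_space_1 by auto
qed

text \<open>For every small continuous \<open>v\<close> a rotation makes \<open>u + v\<close> invariant, with exponent the integral of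
\<open>E v\<close>. Near a point \<open>\<theta>0 + s\<close> where the second derivative of \<open>p\<close> is not zero, \<open>p'\<close> is strictly
monotone. Comparing the constant \<open>v0 = s\<close> with \<open>v1\<close>, which is larger by a bump supported where the
section is close to \<open>\<theta>0\<close>, shows that the exponents for \<open>v0\<close> and \<open>v1\<close> differ.\<close>

lemma type2_mode_locked_nearby:
  assumes dense: "closure (schwartzman_range g \<nu>) = UNIV" and P: "type2_potential P"
    and H: "continuous_on UNIV (H :: 'a \<Rightarrow> real)" and e: "e > 0"
  shows "\<exists>H'. continuous_on UNIV H' \<and> mode_locked g (skew_product g (type2_action P) H') \<and> (\<forall>x. \<bar>H x - H' x\<bar> \<le> e)"
proof -
  interpret type2_data P by standard (rule P)
  note lift = type2_fibre_lift(1)[OF P] and skew = type2_fibre_lift(2)[OF P]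
  have der: "(type2_lift P K x has_field_derivative 1 + deriv p w) (at w)" for K :: "'a \<Rightarrow> real" and x w
    by (rule type2_lift_deriv)
  have pos: "1 + deriv p w > 0" for w using p'_bound[of w] by simp
  have "e / 4 > 0" using e by simp
  from dense lift[OF H] this show ?thesis
  proof (cases rule: mode_locked_or_almost_invariant_section)
    case 1
    with H e show ?thesis by (intro exI[of _ H]) (simp add: skew)
  next
    case (2 \<psi> \<phi> u)
    \<comment> \<open>Moving \<open>u\<close> by at most \<open>\<eta>\<close> changes the invariance defect by at most \<open>3 * \<eta>\<close>, and \<open>e / 4 + 3 * \<eta> \<le> e\<close>.\<close>
    define \<eta> where "\<eta> = e / 8"
    have \<eta>: "\<eta> > 0" using e by (simp add: \<eta>_def)
    define E where "E v x = ln (1 + deriv p (u x + v x + rep_circle (\<psi> x)))" for v x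
    have E_cont: "continuous_on UNIV (E v)" if v: "continuous_on UNIV v" for v
    proof -
      have "continuous_on UNIV (\<lambda>w. ln (1 + deriv p w))"
        using pos by (intro continuous_intros p'_continuous) (auto simp: less_imp_neq[symmetric])
      then have "continuous_on UNIV (\<lambda>(x :: 'a, w). ln (1 + deriv p w))"
        unfolding case_prod_beta by (rule continuous_on_compose2) (auto intro!: continuous_intros)
      moreover have "ln (1 + deriv p w) = ln (1 + deriv p v)" if "w - v \<in> \<int>" for w v
        using p'_periodic[OF that] by simp
      ultimately have "continuous_on UNIV (\<lambda>(x, w). ln (1 + deriv p (w + rep_circle (\<psi> x))))"
        by (rule periodic_twist_continuous[OF _ _ 2(1)])
      from continuous_on_compose2[OF this continuous_on_Pair[OF continuous_on_id continuous_on_add[OF 2(4) v]]]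
      show ?thesis by (simp add: E_def[abs_def])
    qed
    have locked: ?thesis if v: "continuous_on UNIV v" "\<And>x. \<bar>v x\<bar> \<le> \<eta>" and nz: "(\<integral>x. E v x \<partial>\<nu>) \<noteq> 0" for v
    proof -
      define t where "t x = u (g x) + v (g x) - twist \<psi> \<phi> (type2_lift P H) x (u x + v x)" for x
      have t_cont: "continuous_on UNIV t"
        unfolding t_def
        by (intro continuous_intros fibre_lift_continuous[OF fibre_lift_twist[OF lift[OF H] 2(1,2)]] 2(4) v(1)
            continuous_on_compose2[OF 2(4) g_continuous] continuous_on_compose2[OF v(1) g_continuous]) auto
      have t_small: "\<bar>t x\<bar> \<le> e" for x
      proof -
        let ?y = "u x + rep_circle (\<psi> x)"
        have "twist \<psi> \<phi> (type2_lift P H) x (u x + v x) = twist \<psi> \<phi> (type2_lift P H) x (u x) + v x + (p (?y + v x) - p ?y)"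
          by (simp add: twist_def type2_lift_def p_def add.commute add.left_commute)
        moreover have "\<bar>p (?y + v x) - p ?y\<bar> \<le> \<bar>v x\<bar>" using p_lipschitz[of "?y + v x" ?y] by simp
        ultimately show ?thesis
          using 2(5)[of x] v(2)[of x] v(2)[of "g x"] unfolding t_def \<eta>_def by linarith
      qed
      have cont: "continuous_on UNIV (\<lambda>x. H x + t x)" by (intro continuous_intros H t_cont)
      have "mode_locked g (circle_map g (type2_lift P (\<lambda>x. H x + t x)))"
      proof (rule hyperbolic_section_mode_locked[OF lift[OF cont] der _ pos 2(1,2,3)])
        show "continuous_on UNIV (\<lambda>(x :: 'a, w). 1 + deriv p w)"
          unfolding case_prod_beta
          by (intro continuous_intros continuous_on_compose2[OF p'_continuous[of UNIV]]) auto
        show "continuous_on UNIV (\<lambda>x. u x + v x)" by (intro continuous_intros 2(4) v(1))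
        show "twist \<psi> \<phi> (type2_lift P (\<lambda>x. H x + t x)) x (u x + v x) = u (g x) + v (g x)" for x
          by (simp add: twist_def type2_lift_def p_def t_def)
        show "(\<integral>x. ln (1 + deriv p (u x + v x + rep_circle (\<psi> x))) \<partial>\<nu>) \<noteq> 0"
          using nz by (simp add: E_def)
      qed
      with cont t_small show ?thesis by (intro exI[of _ "\<lambda>x. H x + t x"]) (simp add: skew)
    qed
    obtain x0 where x0: "\<And>U. open U \<Longrightarrow> x0 \<in> U \<Longrightarrow> emeasure \<nu> U \<noteq> 0" using support_point_exists by blast
    define \<theta>0 where "\<theta>0 = u x0 + rep_circle (\<psi> x0)"
    obtain s where s: "\<bar>s\<bar> < \<eta> / 2" "deriv (deriv p) (\<theta>0 + s) \<noteq> 0"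
      using p''_nonzero_dense[of "\<eta> / 2" \<theta>0] \<eta> by auto
    define \<sigma> where "\<sigma> = sgn (deriv (deriv p) (\<theta>0 + s))"
    have "\<sigma> * deriv (deriv p) (\<theta>0 + s) > 0" using s(2) by (simp add: \<sigma>_def sgn_if)
    moreover have "continuous_on UNIV (\<lambda>y. \<sigma> * deriv (deriv p) y)" by (intro continuous_intros p''_continuous)
    ultimately obtain r where r: "r > 0" "\<And>y. dist y (\<theta>0 + s) < r \<Longrightarrow> \<sigma> * deriv (deriv p) y > 0"
    proof -
      assume a: "\<sigma> * deriv (deriv p) (\<theta>0 + s) > 0" and c: "continuous_on UNIV (\<lambda>y. \<sigma> * deriv (deriv p) y)"
      from c a obtain r where r: "r > 0" "\<And>y. dist y (\<theta>0 + s) < r \<Longrightarrow>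
          dist (\<sigma> * deriv (deriv p) y) (\<sigma> * deriv (deriv p) (\<theta>0 + s)) < \<sigma> * deriv (deriv p) (\<theta>0 + s)"
        unfolding continuous_on_iff by (metis UNIV_I)
      have "\<sigma> * deriv (deriv p) y > 0" if "dist y (\<theta>0 + s) < r" for y
        using r(2)[OF that] unfolding dist_real_def by linarith
      with r(1) show thesis by (rule that)
    qed
    define \<rho> where "\<rho> = min r \<eta>"
    have \<rho>: "\<rho> > 0" "\<rho> \<le> r" "\<rho> \<le> \<eta>" using r(1) \<eta> by (auto simp: \<rho>_def)
    have incr: "\<sigma> * deriv p y < \<sigma> * deriv p y'"
      if "y < y'" "\<bar>y - (\<theta>0 + s)\<bar> < \<rho>" "\<bar>y' - (\<theta>0 + s)\<bar> < \<rho>" for y y'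
    proof (rule DERIV_pos_imp_increasing[OF \<open>y < y'\<close>])
      fix z assume z: "y \<le> z" "z \<le> y'"
      have "dist z (\<theta>0 + s) < r" using z that(2,3) \<rho>(2) unfolding dist_real_def by linarith
      moreover have "((\<lambda>z. \<sigma> * deriv p z) has_field_derivative \<sigma> * deriv (deriv p) z) (at z)"
        using p'_deriv[of z] by (auto intro!: derivative_eq_intros)
      ultimately show "\<exists>D. ((\<lambda>z. \<sigma> * deriv p z) has_field_derivative D) (at z) \<and> D > 0" using r(2) by blast
    qed
    define \<delta> where "\<delta> x = dist (to_circle \<theta>0) (to_circle (u x) + \<psi> x)" for x
    have \<delta>_cont: "continuous_on UNIV \<delta>"
      unfolding \<delta>_def by (intro continuous_on_dist continuous_circle_add continuous_to_circle 2(1,4) continuous_on_const)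
    define \<xi> where "\<xi> x = max 0 (\<rho> / 2 - \<delta> x)" for x
    have "\<delta> x \<ge> 0" for x by (simp add: \<delta>_def)
    then have \<xi>: "0 \<le> \<xi> x" "\<xi> x \<le> \<rho> / 2" for x using \<rho>(1) by (auto simp: \<xi>_def max_def)
    define v0 where "v0 = (\<lambda>x :: 'a. s)"
    define v1 where "v1 = (\<lambda>x. s + \<xi> x)"
    have v: "continuous_on UNIV v0" "continuous_on UNIV v1" "\<bar>v0 x\<bar> \<le> \<eta>" "\<bar>v1 x\<bar> \<le> \<eta>" for x
    proof -
      show "continuous_on UNIV v0" "continuous_on UNIV v1"
        unfolding v0_def v1_def \<xi>_def by (auto intro!: continuous_intros \<delta>_cont)
      show "\<bar>v0 x\<bar> \<le> \<eta>" "\<bar>v1 x\<bar> \<le> \<eta>" using s(1) \<xi>[of x] \<rho>(3) \<eta> unfolding v0_def v1_def by linarith+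
    qed
    define A where "A = {x. \<delta> x < \<rho> / 2}"
    have "open A" unfolding A_def by (intro open_Collect_less \<delta>_cont continuous_on_const)
    moreover have "x0 \<in> A"
    proof -
      have "to_circle (u x0) + \<psi> x0 = to_circle \<theta>0"
        unfolding \<theta>0_def plus_circle.abs_eq[symmetric] to_circle_rep ..
      then show ?thesis using \<rho>(1) by (simp add: A_def \<delta>_def)
    qed
    ultimately have A: "open A" "emeasure \<nu> A \<noteq> 0" using x0 by auto
    have strict: "\<sigma> * deriv p (u x + v0 x + rep_circle (\<psi> x)) < \<sigma> * deriv p (u x + v1 x + rep_circle (\<psi> x))"
      if x: "x \<in> A" for x
    proof -
      obtain y where y: "to_circle y = to_circle (u x) + \<psi> x" "\<delta> x = \<bar>\<theta>0 - y\<bar>"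
        unfolding \<delta>_def by (rule dist_to_circle_attained)
      have "to_circle (u x + rep_circle (\<psi> x)) = to_circle y"
        unfolding y(1) plus_circle.abs_eq[symmetric] to_circle_rep ..
      then have int: "u x + rep_circle (\<psi> x) - y \<in> \<int>" by (simp only: to_circle_eq_iff)
      have eq: "deriv p (u x + c + rep_circle (\<psi> x)) = deriv p (y + c)" for c
        by (rule p'_periodic) (use int in \<open>simp add: algebra_simps\<close>)
      have small: "\<bar>\<theta>0 - y\<bar> < \<rho> / 2" using x y(2) by (simp add: A_def)
      then have "\<xi> x > 0" using y(2) by (simp add: \<xi>_def)
      show ?thesis
        unfolding eq v0_def v1_def
      proof (rule incr)
        show "y + s < y + (s + \<xi> x)" using \<open>\<xi> x > 0\<close> by simp
        show "\<bar>y + s - (\<theta>0 + s)\<bar> < \<rho>" "\<bar>y + (s + \<xi> x) - (\<theta>0 + s)\<bar> < \<rho>"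
          using small \<xi>[of x] by linarith+
      qed
    qed
    have same: "v1 x = v0 x" if "x \<notin> A" for x using that by (auto simp: A_def v0_def v1_def \<xi>_def)
    have "(\<integral>x. E v0 x \<partial>\<nu>) \<noteq> (\<integral>x. E v1 x \<partial>\<nu>)"
    proof (cases "\<sigma> > 0")
      case True
      then have "\<sigma> = 1" by (simp add: \<sigma>_def sgn_if split: if_splits)
      then have lt: "E v0 x < E v1 x" if "x \<in> A" for x using strict[OF that] pos by (simp add: E_def)
      have "(\<integral>x. E v0 x \<partial>\<nu>) < (\<integral>x. E v1 x \<partial>\<nu>)"
      proof (rule integral_continuous_less[OF E_cont[OF v(1)] E_cont[OF v(2)] _ A lt])
        show "E v0 x \<le> E v1 x" for x
        proof (cases "x \<in> A")
          case False then show ?thesis by (simp add: E_def same)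
        qed (use lt less_imp_le in blast)
      qed
      then show ?thesis by simp
    next
      case False
      then have "\<sigma> = - 1" using s(2) by (simp add: \<sigma>_def sgn_if split: if_splits)
      then have lt: "E v1 x < E v0 x" if "x \<in> A" for x using strict[OF that] pos by (simp add: E_def)
      have "(\<integral>x. E v1 x \<partial>\<nu>) < (\<integral>x. E v0 x \<partial>\<nu>)"
      proof (rule integral_continuous_less[OF E_cont[OF v(2)] E_cont[OF v(1)] _ A lt])
        show "E v1 x \<le> E v0 x" for x
        proof (cases "x \<in> A")
          case False then show ?thesis by (simp add: E_def same)
        qed (use lt less_imp_le in blast)
      qed
      then show ?thesis by simp
    qed
    then show ?thesis using locked[OF v(1,3)] locked[OF v(2,4)] by argo
  qed
qed

end


section \<open>The theorem\<close>

lemma type1_action_control: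
  assumes e: "e > 0"
  shows "\<exists>d>0. \<forall>a\<in>mspace (type1_metric r). \<forall>b\<in>mspace (type1_metric r). mdist (type1_metric r) a b < d \<longrightarrow>
    (\<forall>\<theta>. dist (type1_action a \<theta>) (type1_action b \<theta>) < e)"
proof -
  have zero: "enat 0 \<le> r" by (simp add: zero_enat_def[symmetric])
  obtain d where d: "d > 0" "\<And>a b. a \<in> lifted_Diff r \<Longrightarrow> b \<in> lifted_Diff r \<Longrightarrow> dist_Diff r a b < d \<Longrightarrow> dist_C 0 a b < e"
    using dist_Diff_controls_dist_C[OF zero e] by blast
  have "dist (type1_action a \<theta>) (type1_action b \<theta>) < e"
    if ab: "a \<in> lifted_Diff r" "b \<in> lifted_Diff r" "mdist (type1_metric r) a b < d" for a b \<theta>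
  proof -
    have "dist (type1_action a \<theta>) (type1_action b \<theta>) \<le> \<bar>a (rep_circle \<theta>) - b (rep_circle \<theta>)\<bar>"
      unfolding type1_action_def by (rule dist_to_circle_le)
    also have "\<dots> \<le> dist_C 0 a b" by (intro dist_C_ge lifted_DiffD(1)[OF _ zero] ab)
    also have "\<dots> < e" using ab by (intro d(2)) (simp_all add: mdist_type1_metric)
    finally show ?thesis .
  qed
  with d(1) show ?thesis by auto
qed

lemma type2_action_control:
  "dist (type2_action P a \<theta>) (type2_action P b \<theta>) \<le> \<bar>a - b\<bar>"
proof -
  have "type2_action P c \<theta> = to_circle (rep_circle \<theta> + P \<theta> + c)" for c
    using type2_action_to_circle[of P c "rep_circle \<theta>"] by simp
  then show ?thesis using dist_to_circle_le[of "rep_circle \<theta> + P \<theta> + a" "rep_circle \<theta> + P \<theta> + b"] by simp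
qed

theorem theorem1p7:
  fixes g :: "'a::metric_space \<Rightarrow> 'a"
    and \<nu> :: "'a measure"
    and Y :: "(real ^ 'd) set"
    and gbar :: "real ^ 'd \<Rightarrow> real ^ 'd"
    and h :: "'a \<Rightarrow> real ^ 'd"
  assumes "compact (UNIV :: 'a set)"
    and "homeomorphism UNIV UNIV g (inv g)"
    and "strictly_ergodic g"
    and "invariant_prob g \<nu>"
    and "compact Y" and "infinite Y"
    and "\<exists>gbar_inv. homeomorphism Y Y gbar gbar_inv"
    and "continuous_on UNIV h" and "range h = Y" and "\<forall>x. h (g x) = gbar (h x)"
    and "closure (schwartzman_range g \<nu>) = UNIV"
  shows "(\<forall>r\<ge>1. open_dense_in (cfunspace (euclidean :: 'a topology) (type1_metric r))
              (mode_locked_set g (type1_metric r) type1_action)) \<and>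
         (\<forall>P. type2_potential P \<longrightarrow>
            open_dense_in (cfunspace (euclidean :: 'a topology) euclidean_metric)
              (mode_locked_set g euclidean_metric (type2_action P)))"
proof -
  interpret unique_ergodic g \<nu>
  proof
    show "\<mu> = \<nu>" if "invariant_prob g \<mu>" for \<mu>
      using assms(3,4) that unfolding strictly_ergodic_def by blast
  qed (use assms(1,2,4) in auto)
  note dense = assms(11)
  have "open_dense_in (cfunspace (euclidean :: 'a topology) (type1_metric r))
      (mode_locked_set g (type1_metric r) type1_action)" if r: "r \<ge> 1" for r
  proof (rule open_dense_mode_locked_setI)
    fix H assume "H \<in> mspace (cfunspace (euclidean :: 'a topology) (type1_metric r))"
    then have H: "continuous_map euclidean (mtopology_of (type1_metric r)) H"
      unfolding mspace_cfunspace_compact[OF compact_space] by simp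
    show "forced_circle_homeo g (skew_product g type1_action H)"
      unfolding type1_fibre_lift(2)[OF H] by (rule fibre_lift_forced_circle_homeo[OF type1_fibre_lift(1)[OF H]])
    fix e :: real assume e: "e > 0"
    then have "e / 2 > 0" by simp
    from type1_mode_locked_nearby[OF dense H r this]
    obtain H' where H': "continuous_map euclidean (mtopology_of (type1_metric r)) H'"
        "mode_locked g (skew_product g type1_action H')" "\<And>x. mdist (type1_metric r) (H x) (H' x) \<le> e / 2"
      by blast
    have "mdist (cfunspace (euclidean :: 'a topology) (type1_metric r)) H H' \<le> e / 2"
      using e H'(3) by (intro mdist_cfunspace_le) auto
    with H' e show "\<exists>H'\<in>mspace (cfunspace (euclidean :: 'a topology) (type1_metric r)).
        mode_locked g (skew_product g type1_action H') \<and>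
        mdist (cfunspace (euclidean :: 'a topology) (type1_metric r)) H H' < e"
      unfolding mspace_cfunspace_compact[OF compact_space] by (intro bexI[of _ H']) auto
  qed (rule type1_action_control)
  moreover have "open_dense_in (cfunspace (euclidean :: 'a topology) euclidean_metric)
      (mode_locked_set g euclidean_metric (type2_action P))" if P: "type2_potential P" for P
  proof (rule open_dense_mode_locked_setI)
    show "\<exists>d>0. \<forall>a\<in>mspace euclidean_metric. \<forall>b\<in>mspace euclidean_metric. mdist euclidean_metric a b < d \<longrightarrow>
        (\<forall>\<theta>. dist (type2_action P a \<theta>) (type2_action P b \<theta>) < e)" if "e > 0" for e
      using that le_less_trans[OF type2_action_control] by (intro exI[of _ e]) (auto simp: dist_real_def)
    fix H assume "H \<in> mspace (cfunspace (euclidean :: 'a topology) (euclidean_metric :: real metric))"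
    then have H: "continuous_on UNIV H"
      unfolding mspace_cfunspace_compact[OF compact_space] by simp
    show "forced_circle_homeo g (skew_product g (type2_action P) H)"
      unfolding type2_fibre_lift(2)[OF P] by (rule fibre_lift_forced_circle_homeo[OF type2_fibre_lift(1)[OF P H]])
    fix e :: real assume e: "e > 0"
    then have "e / 2 > 0" by simp
    from type2_mode_locked_nearby[OF dense P H this]
    obtain H' where H': "continuous_on UNIV H'"
        "mode_locked g (skew_product g (type2_action P) H')" "\<And>x. \<bar>H x - H' x\<bar> \<le> e / 2"
      by blast
    have "mdist (cfunspace (euclidean :: 'a topology) euclidean_metric) H H' \<le> e / 2"
      using e H'(3) by (intro mdist_cfunspace_le) (auto simp: dist_real_def)
    with H' e show "\<exists>H'\<in>mspace (cfunspace (euclidean :: 'a topology) euclidean_metric).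
        mode_locked g (skew_product g (type2_action P) H') \<and>
        mdist (cfunspace (euclidean :: 'a topology) euclidean_metric) H H' < e"
      unfolding mspace_cfunspace_compact[OF compact_space] by (intro bexI[of _ H']) auto
  qed
  ultimately show ?thesis by blast
qed

end
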